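(* Assume the Undirected $k$-pairs Conjecture (stated in the context) holds. Then any randomized external memory algorithm for the permutation problem (defined in the context), having error probability at most $1/3$ on every input, must make an expected $$\Omega\Big(\min\Big\{n,\ \frac{nw}{\lg(nw)},\ \frac{n}{B}\cdot\lg_{2M/B}\frac{n}{B}\Big\}\Big)$$ I/Os.
   Context: External memory model: internal memory of $M$ words of $w$ bits ($m=Mw$ bits), unbounded disk partitioned into blocks of $B$ words ($b=Bw$ bits); an I/O reads or writes one block; cost is number of I/Os; computation in memory is free and unrestricted. Permutation problem: input is a permutation $\pi$ of $\{1,\dots,n\}$ and bit strings $d_1,\dots,d_n\in\{0,1\}^w$, with $w\ge\lg n$, given as an array $A$ whose $i$-th entry stores $(\pi(i),d_i)$ ($\pi(i)$ encoded in $\lceil\lg n\rceil$ bits), packed $b/(w+\lg n)$ entries per block. There is an initially empty output array $C$ of $n$ words of $w$ bits, packed $b/w$ per block. The goal is to store $d_i$ in $C[\pi(i)]$ for all $i$. Undirected $k$-pairs Conjecture (Li and Li). An instance is a directed acyclic graph $G=(V,E)$ with capacities $c(e)>0$ and $k$ source–sink pairs $(s_i,t_i)$, each with demand $1$. Each source $s_i$ receives a message $A_i$ drawn uniformly and independently from a finite set. A network coding solution assigns to every edge $e=(u,v)$ an alphabet and a function giving the message on $e$ from the messages on the in-edges of $u$, and to every sink $t_i$ a decoding function of the messages on its in-edges, which must output $A_i$ for all inputs. It achieves rate $r$ if $H(A_i)\ge r$ for all $i$ and $H(A_e)\le c(e)$ for every edge $e$, where $A_e$ is the random message on $e$ and $H$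 is binary Shannon entropy. A multicommodity flow in the undirected version $G'$ of $G$ consists of fractional flows $f_i$ supported on edges, satisfying flow conservation and sending one unit from $s_i$ to $t_i$; it achieves rate $r$ if $r\sum_i (f_i(u,v)+f_i(v,u))\le c(e)$ for every edge $e=\{u,v\}$. The conjecture states: for every such instance, the achievable network coding rate in $G$ is at most the achievable multicommodity flow rate in $G'$. *)

theory Defs
  imports "HOL-Probability.Probability"
begin

section \<open>The undirected $k$-pairs conjecture\<close>

text \<open>Vertices and message symbols are natural numbers; since graphs and message sets are finite,
  this loses no generality.  Pairs are indexed by \<open>{..<pairs I}\<close>.\<close>

record kpairs_instance =
  verts :: "nat set"
  edges :: "(nat \<times> nat) set"
  capacity :: "nat \<times> nat \<Rightarrow> real"
  pairs :: nat
  source :: "nat \<Rightarrow> nat"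
  sink :: "nat \<Rightarrow> nat"

definition kpairs_wf :: "kpairs_instance \<Rightarrow> bool" where
  "kpairs_wf I \<longleftrightarrow>
     finite (verts I) \<and> edges I \<subseteq> verts I \<times> verts I \<and> acyclic (edges I) \<and>
     (\<forall>e\<in>edges I. capacity I e > 0) \<and>
     (\<forall>i<pairs I. source I i \<in> verts I \<and> sink I i \<in> verts I)"

definition in_edges :: "kpairs_instance \<Rightarrow> nat \<Rightarrow> (nat \<times> nat) set" where
  "in_edges I u = {e \<in> edges I. snd e = u}"

text \<open>The message of pair \<open>i\<close> is regarded as arriving at the vertex \<open>source I i\<close> on an extra
  in-edge of unbounded capacity, so it is available at that vertex together with the messages on
  the ordinary in-edges.\<close>

definition sources_at :: "kpairs_instance \<Rightarrow> nat \<Rightarrow> nat set" where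
  "sources_at I u = {i. i < pairs I \<and> source I i = u}"

record network_code =
  source_alphabet :: "nat \<Rightarrow> nat set"
  edge_alphabet :: "nat \<times> nat \<Rightarrow> nat set"
  edge_fun :: "nat \<times> nat \<Rightarrow> (nat \<Rightarrow> nat) \<Rightarrow> (nat \<times> nat \<Rightarrow> nat) \<Rightarrow> nat"
  decode_fun :: "nat \<Rightarrow> (nat \<Rightarrow> nat) \<Rightarrow> (nat \<times> nat \<Rightarrow> nat) \<Rightarrow> nat"

definition source_messages :: "kpairs_instance \<Rightarrow> network_code \<Rightarrow> (nat \<Rightarrow> nat) set" where
  "source_messages I N = (\<Pi>\<^sub>E i\<in>{..<pairs I}. source_alphabet N i)"

text \<open>\<open>msg A e\<close> is the message on edge \<open>e\<close> when the sources receive \<open>A\<close>.  As the graph is acyclic,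
  the edge functions determine \<open>msg\<close> uniquely on the source messages and the edges; \<open>restrict\<close>
  limits each function to the messages present at its vertex.\<close>

definition nc_solution ::
    "kpairs_instance \<Rightarrow> network_code \<Rightarrow> ((nat \<Rightarrow> nat) \<Rightarrow> nat \<times> nat \<Rightarrow> nat) \<Rightarrow> bool" where
  "nc_solution I N msg \<longleftrightarrow>
     (\<forall>i<pairs I. finite (source_alphabet N i) \<and> source_alphabet N i \<noteq> {}) \<and>
     (\<forall>A\<in>source_messages I N.
        (\<forall>e\<in>edges I.
           msg A e \<in> edge_alphabet N e \<and>
           msg A e = edge_fun N e (restrict A (sources_at I (fst e)))
                                  (restrict (msg A) (in_edges I (fst e)))) \<and>
        (\<forall>i<pairs I.
           decode_fun N i (restrict A (sources_at I (sink I i)))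
                          (restrict (msg A) (in_edges I (sink I i))) = A i))"

text \<open>Binary Shannon entropy of \<open>X\<close> applied to a uniformly random element of the finite set \<open>S\<close>.
  A uniform element of \<open>source_messages I N\<close> consists of independent uniform messages.\<close>

definition entropy2 :: "'a set \<Rightarrow> ('a \<Rightarrow> nat) \<Rightarrow> real" where
  "entropy2 S X = prob_space.entropy (uniform_count_measure S) 2 (count_space (X ` S)) X"

definition nc_achieves :: "kpairs_instance \<Rightarrow> real \<Rightarrow> bool" where
  "nc_achieves I r \<longleftrightarrow>
     (\<exists>N msg. nc_solution I N msg \<and>
        (\<forall>i<pairs I. entropy2 (source_messages I N) (\<lambda>A. A i) \<ge> r) \<and>
        (\<forall>e\<in>edges I. entropy2 (source_messages I N) (\<lambda>A. msg A e) \<le> capacity I e))"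

definition multicommodity_flow ::
    "kpairs_instance \<Rightarrow> (nat \<Rightarrow> nat \<Rightarrow> nat \<Rightarrow> real) \<Rightarrow> bool" where
  "multicommodity_flow I f \<longleftrightarrow>
     (\<forall>i<pairs I.
        (\<forall>u v. f i u v \<ge> 0) \<and>
        (\<forall>u v. (u, v) \<notin> edges I \<and> (v, u) \<notin> edges I \<longrightarrow> f i u v = 0) \<and>
        (\<forall>u\<in>verts I. (\<Sum>v\<in>verts I. f i u v) - (\<Sum>v\<in>verts I. f i v u) =
                     of_bool (u = source I i) - of_bool (u = sink I i)))"

definition flow_achieves :: "kpairs_instance \<Rightarrow> real \<Rightarrow> bool" where
  "flow_achieves I r \<longleftrightarrow>
     (\<exists>f. multicommodity_flow I f \<and>
        (\<forall>(u, v)\<in>edges I. r * (\<Sum>i<pairs I. f i u v + f i v u) \<le> capacity I (u, v)))"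

text \<open>In \<^typ>\<open>ennreal\<close> the supremum of the empty set is 0, the right value of the flow
  rate when some source is not connected to its sink and no flow exists.\<close>

definition nc_rate :: "kpairs_instance \<Rightarrow> ennreal" where
  "nc_rate I = (SUP r\<in>{r. 0 \<le> r \<and> nc_achieves I r}. ennreal r)"

definition flow_rate :: "kpairs_instance \<Rightarrow> ennreal" where
  "flow_rate I = (SUP r\<in>{r. 0 \<le> r \<and> flow_achieves I r}. ennreal r)"

definition undirected_k_pairs_conjecture :: bool where
  "undirected_k_pairs_conjecture \<longleftrightarrow> (\<forall>I. kpairs_wf I \<longrightarrow> nc_rate I \<le> flow_rate I)"


section \<open>External memory algorithms\<close>

text \<open>A deterministic algorithm maps the number of I/Os made so far and the contents of internal
  memory to new contents of internal memory (the result of the free computation) and the next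
  action.  A read replaces the first \<open>b\<close> bits of memory by the block; a write stores the first
  \<open>b\<close> bits of memory in the block.  Fixing this position is no restriction, because memory can be
  rearranged for free.  Having the I/O count available without using memory only makes the
  algorithms more powerful.\<close>

type_synonym bits = "bool list"
type_synonym disk = "nat \<Rightarrow> bits"

datatype action = Halt | Read nat | Write nat

type_synonym det_algorithm = "nat \<Rightarrow> bits \<Rightarrow> bits \<times> action"

definition em_step :: "nat \<Rightarrow> det_algorithm \<Rightarrow> nat \<Rightarrow> bits \<times> disk \<Rightarrow> (bits \<times> disk) option" where
  "em_step b alg j = (\<lambda>(s, D).
     case alg j s of
       (s', Halt) \<Rightarrow> None
     | (s', Read a) \<Rightarrow> Some (D a @ drop b s', D)
     | (s', Write a) \<Rightarrow> Some (s', D(a := take b s')))"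

text \<open>The configuration after \<open>j\<close> I/Os, \<open>None\<close> if fewer than \<open>j\<close> I/Os are made.  Internal memory
  consists of \<open>m\<close> bits, initially 0.\<close>

primrec em_config :: "nat \<Rightarrow> nat \<Rightarrow> det_algorithm \<Rightarrow> disk \<Rightarrow> nat \<Rightarrow> (bits \<times> disk) option" where
  "em_config m b alg D0 0 = Some (replicate m False, D0)"
| "em_config m b alg D0 (Suc j) = Option.bind (em_config m b alg D0 j) (em_step b alg j)"

definition num_ios :: "nat \<Rightarrow> nat \<Rightarrow> det_algorithm \<Rightarrow> disk \<Rightarrow> ennreal" where
  "num_ios m b alg D0 = (SUP j\<in>{j. em_config m b alg D0 j \<noteq> None}. of_nat j)"

definition halts_with :: "nat \<Rightarrow> nat \<Rightarrow> det_algorithm \<Rightarrow> disk \<Rightarrow> disk \<Rightarrow> bool" where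
  "halts_with m b alg D0 D \<longleftrightarrow>
     (\<exists>j s. em_config m b alg D0 j = Some (s, D) \<and> em_config m b alg D0 (Suc j) = None)"

text \<open>A randomized algorithm is a family of deterministic ones indexed by an infinite tape of
  independent fair coin flips, to which it has free access.\<close>

type_synonym tape = "nat \<Rightarrow> bool"

definition coins :: "tape measure" where
  "coins = (\<Pi>\<^sub>M i\<in>UNIV. measure_pmf (bernoulli_pmf (1/2)))"

type_synonym rand_algorithm = "tape \<Rightarrow> det_algorithm"

definition em_algorithm :: "nat \<Rightarrow> rand_algorithm \<Rightarrow> bool" where
  "em_algorithm m alg \<longleftrightarrow>
     (\<forall>\<omega> j s. length s = m \<longrightarrow> length (fst (alg \<omega> j s)) = m) \<and>
     (\<forall>j s. length s = m \<longrightarrow> (\<lambda>\<omega>. alg \<omega> j s) \<in> coins \<rightarrow>\<^sub>M count_space UNIV)"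


section \<open>The permutation problem\<close>

definition perm_input :: "nat \<Rightarrow> nat \<Rightarrow> (nat \<Rightarrow> nat) \<Rightarrow> (nat \<Rightarrow> bits) \<Rightarrow> bool" where
  "perm_input n w \<pi> d \<longleftrightarrow> \<pi> permutes {1..n} \<and> (\<forall>i\<in>{1..n}. length (d i) = w)"

definition index_bits :: "nat \<Rightarrow> nat" where
  "index_bits n = nat \<lceil>log 2 (real n)\<rceil>"

text \<open>The index \<open>\<pi> i\<close> is represented by the binary expansion of \<open>\<pi> i - 1 < n\<close>.\<close>

definition input_bits :: "nat \<Rightarrow> (nat \<Rightarrow> nat) \<Rightarrow> (nat \<Rightarrow> bits) \<Rightarrow> bits" where
  "input_bits n \<pi> d =
     concat (map (\<lambda>i. map (bit (\<pi> i - 1)) [0..<index_bits n] @ d i) [1..<Suc n])"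

text \<open>The input array is stored contiguously from block 0 on, so that an entry may extend over a
  block boundary (an entry need not fit in a single block when \<open>B = 1\<close>).  The output array starts at
  the first block after it.  All remaining bits of the disk are initially 0.\<close>

definition perm_disk :: "nat \<Rightarrow> nat \<Rightarrow> (nat \<Rightarrow> nat) \<Rightarrow> (nat \<Rightarrow> bits) \<Rightarrow> disk" where
  "perm_disk b n \<pi> d = (\<lambda>a. take b (drop (a * b) (input_bits n \<pi> d) @ replicate b False))"

definition output_start :: "nat \<Rightarrow> nat \<Rightarrow> nat \<Rightarrow> nat" where
  "output_start b n w = nat \<lceil>real (n * (w + index_bits n)) / real b\<rceil>"

definition output_word :: "nat \<Rightarrow> nat \<Rightarrow> nat \<Rightarrow> disk \<Rightarrow> nat \<Rightarrow> bits" where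
  "output_word B n w D i =
     take w (drop ((i - 1) mod B * w) (D (output_start (B * w) n w + (i - 1) div B)))"

definition solves_perm ::
    "nat \<Rightarrow> nat \<Rightarrow> nat \<Rightarrow> nat \<Rightarrow> det_algorithm \<Rightarrow> (nat \<Rightarrow> nat) \<Rightarrow> (nat \<Rightarrow> bits) \<Rightarrow> bool" where
  "solves_perm M B w n alg \<pi> d \<longleftrightarrow>
     (\<exists>D. halts_with (M * w) (B * w) alg (perm_disk (B * w) n \<pi> d) D \<and>
          (\<forall>i\<in>{1..n}. output_word B n w D (\<pi> i) = d i))"

definition error_prob ::
    "nat \<Rightarrow> nat \<Rightarrow> nat \<Rightarrow> nat \<Rightarrow> rand_algorithm \<Rightarrow> (nat \<Rightarrow> nat) \<Rightarrow> (nat \<Rightarrow> bits) \<Rightarrow> real" where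
  "error_prob M B w n alg \<pi> d =
     measure coins {\<omega> \<in> space coins. \<not> solves_perm M B w n (alg \<omega>) \<pi> d}"

definition expected_ios ::
    "nat \<Rightarrow> nat \<Rightarrow> nat \<Rightarrow> nat \<Rightarrow> rand_algorithm \<Rightarrow> (nat \<Rightarrow> nat) \<Rightarrow> (nat \<Rightarrow> bits) \<Rightarrow> ennreal" where
  "expected_ios M B w n alg \<pi> d =
     (\<integral>\<^sup>+\<omega>. num_ios (M * w) (B * w) (alg \<omega>) (perm_disk (B * w) n \<pi> d) \<partial>coins)"

end

theory Submission
  imports Defs
begin

text \<open>By averaging, fix coins for which a quarter of the permutations \<open>\<pi>\<close> are correctly and quickly handled on a
  quarter of all data each.  A run of \<open>t\<close> I/Os has only \<open>2\<^bsup>O(t log n)\<^esup>\<close> access patterns, once scratch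
  blocks are named by their time of first use.  Hence some set \<open>F\<close> of data of density \<open>2\<^bsup>- \<epsilon>nw\<^esup>\<close> shares
  one pattern, and its runs are network codes on one fixed graph, except that messages are confined to
  \<open>F\<close>.

  To obtain independent uniform messages \<open>x\<close>, a hub learns all of \<open>x\<close>, computes a point of
  \<open>F\<close> and sends to both ends of pair \<open>i\<close> the offset \<open>z\<^sub>i\<close> between \<open>x\<^sub>i\<close> and that
  point.  A greedy choice coordinate by coordinate makes the total entropy of the offsets a small fraction
  of \<open>nw\<close>.  A unit of flow through the hub enters and leaves it, so the capacity of about \<open>nw\<close> at the
  hub carries only about half of the demand.  The rest has to be routed through the graph of the
  pattern.

  Grouping \<open>M/B\<close> successive I/Os into one vertex, that graph has degree \<open>O(M/B)\<close> and total capacity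
  \<open>O(tBw)\<close>.  A union bound over the patterns yields a permutation for which most pairs are at distance
  \<open>\<Omega>(log\<^bsub>2M/B\<^esub> (n/B))\<close> whatever the pattern, so that \<open>tBw\<close> is at least of order
  \<open>nw log\<^bsub>2M/B\<^esub> (n/B)\<close>.  Since \<open>w \<ge> log n\<close>, the middle term of the minimum is never needed.\<close>


section \<open>Transport into a dense set of words\<close>

text \<open>The conjecture concerns exact codes for independent messages on one fixed graph, whereas
  an algorithm that may err and adapts its accesses gives only a dense set of data with a common
  pattern. The hub repairs this and must be cheap. A path through it counts as length
  \<open>l\<close>; its edges then account for \<open>l/2 * (n w + 2 * n w / 32)\<close>, which is
  17/32 of \<open>l n w\<close>, against a demand of 15/16 from the far pairs. The remaining 13/32
  must be paid by the graph of the run. No flow is ever routed: the conjecture enters by weak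
  duality, through one potential per pair and common edge weights.

  The order of choices matters. The coins come before the permutation, but the pattern is known only
  after it, so the permutation has to be far under all patterns at once. This costs about
  \<open>t log n\<close> bits against a gain of order \<open>n log (n/B)\<close>; the terms
  \<open>n\<close> and \<open>n/B log\<close> of the minimum together keep the cost small even when
  \<open>B\<close> is close to \<open>n\<close>. If the logarithm to base \<open>2M/B\<close> is
  bounded, counting the changed output blocks is enough.\<close>

lemma card_filter_eq_sum:
  "finite S \<Longrightarrow> real (card {s\<in>S. P s}) = (\<Sum>s\<in>S. of_bool (P s))"
  by (simp add: Int_def)

text \<open>Greedy choice: double counting gives an element of \<open>Q\<close> that lies in at
  least a fraction \<open>\<eta>\<close> of the sets not hit so far, so each of the \<open>K\<close>
  picks multiplies their number by at most \<open>1 - \<eta>\<close>.\<close>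

lemma hitting_set_avoids_few:
  fixes G :: "'b \<Rightarrow> 'a set" and \<eta> :: real
  assumes "finite S" "finite Q" "Q \<noteq> {}"
    and G: "\<And>s. s \<in> S \<Longrightarrow> G s \<subseteq> Q" "\<And>s. s \<in> S \<Longrightarrow> real (card (G s)) \<ge> \<eta> * real (card Q)"
    and \<eta>: "\<eta> \<le> 1"
  shows "\<exists>R\<subseteq>Q. card R \<le> K \<and> real (card {s\<in>S. G s \<inter> R = {}}) \<le> (1 - \<eta>) ^ K * real (card S)"
proof (induction K)
  case 0
  show ?case by (rule exI[of _ "{}"]) simp
next
  case (Suc K)
  then obtain R where R: "R \<subseteq> Q" "card R \<le> K"
    and le: "real (card {s\<in>S. G s \<inter> R = {}}) \<le> (1 - \<eta>) ^ K * real (card S)" by blast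
  define S' where "S' = {s\<in>S. G s \<inter> R = {}}"
  have fS': "finite S'" using assms(1) by (simp add: S'_def)
  have "(\<Sum>r\<in>Q. real (card {s\<in>S'. r \<in> G s})) = (\<Sum>r\<in>Q. \<Sum>s\<in>S'. of_bool (r \<in> G s))"
    using fS' by (simp only: card_filter_eq_sum)
  also have "\<dots> = (\<Sum>s\<in>S'. \<Sum>r\<in>Q. of_bool (r \<in> G s))" by (rule sum.swap)
  also have "\<dots> = (\<Sum>s\<in>S'. real (card (G s)))"
  proof (rule sum.cong[OF refl])
    fix s assume "s \<in> S'"
    then have "Q \<inter> {r. r \<in> G s} = G s" using G(1) by (auto simp: S'_def)
    then show "(\<Sum>r\<in>Q. of_bool (r \<in> G s)) = real (card (G s))"
      using assms(2) by simp
  qed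
  also have "\<dots> \<ge> (\<Sum>s\<in>S'. \<eta> * real (card Q))" using G(2) by (intro sum_mono) (auto simp: S'_def)
  finally have sum: "real (card Q) * (\<eta> * real (card S')) \<le> (\<Sum>r\<in>Q. real (card {s\<in>S'. r \<in> G s}))"
    by (simp add: algebra_simps)
  have "\<exists>r\<in>Q. \<eta> * real (card S') \<le> real (card {s\<in>S'. r \<in> G s})"
  proof (rule ccontr)
    assume "\<not> ?thesis"
    then have "(\<Sum>r\<in>Q. real (card {s\<in>S'. r \<in> G s})) < (\<Sum>r\<in>Q. \<eta> * real (card S'))"
      using assms by (intro sum_strict_mono) auto
    then show False using sum by simp
  qed
  then obtain r where r: "r \<in> Q" "\<eta> * real (card S') \<le> real (card {s\<in>S'. r \<in> G s})" by blast
  have "{s\<in>S. G s \<inter> insert r R = {}} = S' - {s\<in>S'. r \<in> G s}" by (auto simp: S'_def)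
  then have "real (card {s\<in>S. G s \<inter> insert r R = {}}) = real (card S') - real (card {s\<in>S'. r \<in> G s})"
    using fS' by (simp add: card_Diff_subset of_nat_diff card_mono)
  also have "\<dots> \<le> (1 - \<eta>) * real (card S')" using r(2) by (simp add: algebra_simps)
  also have "\<dots> \<le> (1 - \<eta>) * ((1 - \<eta>) ^ K * real (card S))"
    using le \<eta> by (intro mult_left_mono) (auto simp: S'_def)
  finally have "real (card {s\<in>S. G s \<inter> insert r R = {}}) \<le> (1 - \<eta>) ^ Suc K * real (card S)"
    by (simp add: mult.assoc)
  moreover have "card (insert r R) \<le> Suc K"
    using R(2) card_insert_le_m1[of "Suc K" R r] by simp
  ultimately show ?case using R(1) r(1) by (intro exI[of _ "insert r R"]) auto
qed

section \<open>Words over a finite alphabet and transport into a dense set\<close>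

definition words :: "'a set \<Rightarrow> nat \<Rightarrow> 'a list set" where
  "words Q n = {xs. set xs \<subseteq> Q \<and> length xs = n}"

lemma words_0 [simp]: "words Q 0 = {[]}"
  by (auto simp: words_def)

lemma words_Suc: "words Q (Suc n) = (\<lambda>(x, xs). x # xs) ` (Q \<times> words Q n)"
  by (auto simp: words_def length_Suc_conv image_def)

lemma finite_words [simp]: "finite Q \<Longrightarrow> finite (words Q n)"
  unfolding words_def by (rule finite_lists_length_eq)

lemma card_words: "finite Q \<Longrightarrow> card (words Q n) = card Q ^ n"
  unfolding words_def by (rule card_lists_length_eq)

lemma sum_words_Suc:
  "(\<Sum>xs\<in>words Q (Suc n). f xs) = (\<Sum>x\<in>Q. \<Sum>xs\<in>words Q n. f (x # xs))"
proof -
  have "inj_on (\<lambda>(x, xs). x # xs) (Q \<times> words Q n)" by (auto simp: inj_on_def)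
  then show ?thesis
    by (simp add: words_Suc sum.reindex sum.cartesian_product) (simp add: case_prod_beta)
qed

text \<open>For nonempty \<open>F\<close> inside the words, this is the relative entropy of the
  uniform distribution on \<open>F\<close> with respect to the uniform distribution on all
  words.\<close>

definition deficiency :: "'a set \<Rightarrow> nat \<Rightarrow> 'a list set \<Rightarrow> real" where
  "deficiency Q n F = log 2 (real (card Q) ^ n / real (card F))"

text \<open>Coordinates are fixed one after the other.  If at least a fraction \<open>\<eta>\<close> of the values loses at most one
  bit of density, then a few random offsets lead from almost every \<open>x\<^sub>i\<close> to such a value.  Otherwise
  some value increases the density by a factor of order \<open>1/\<eta>\<close>, which can happen only rarely.  The
  index \<open>a\<close> is the reversed list of the coordinates of \<open>x\<close> processed so far.\<close>

theorem transport_into_dense_family: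
  fixes Q :: "'a set" and act :: "'a \<Rightarrow> 'a \<Rightarrow> 'a" and \<eta> :: real
  assumes finQ: "finite Q" and neQ: "Q \<noteq> {}" and \<eta>: "0 < \<eta>" "\<eta> \<le> 1"
    and act: "\<And>x. x \<in> Q \<Longrightarrow> bij_betw (\<lambda>r. act r x) Q Q"
    and A: "finite A" "\<And>a. a \<in> A \<Longrightarrow> F a \<noteq> {} \<and> F a \<subseteq> words Q n"
  shows "\<exists>R Y. (\<forall>i<n. R i \<subseteq> Q \<and> card (R i) \<le> K) \<and> (\<forall>a\<in>A. \<forall>x\<in>words Q n. Y a x \<in> F a) \<and>
     log 2 (1/\<eta>) * (\<Sum>a\<in>A. \<Sum>x\<in>words Q n. \<Sum>i<n. of_bool (\<forall>r\<in>R i. act r (x!i) \<noteq> Y a x ! i))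
     \<le> (\<Sum>a\<in>(A::'a list set). real (card Q) ^ n *
          (deficiency Q n (F a) + real n + real n * log 2 (1/\<eta>) * (1 - \<eta>) ^ K))"
  using A
proof (induction n arbitrary: A F)
  case 0
  have "F a = {[]}" if "a \<in> A" for a using 0(2)[OF that] by auto
  then show ?case by (intro exI[of _ "\<lambda>_. {}"] exI[of _ "\<lambda>_ _. []"]) (simp add: deficiency_def)
next
  case (Suc n)
  define q where "q = real (card Q)"
  define L where "L = log 2 (1/\<eta>)"
  define \<rho> where "\<rho> = (1 - \<eta>) ^ K"
  have q: "q > 0" using finQ neQ by (simp add: q_def card_gt_0_iff)
  have L: "L \<ge> 0" unfolding L_def using \<eta> by simp
  define ext where "ext a v = {t. v # t \<in> F a}" for a v
  have ext_sub: "ext a v \<subseteq> words Q n" if "a \<in> A" for a v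
    using Suc.prems(2)[OF that] by (fastforce simp: ext_def words_def)
  have fin_ext: "finite (ext a v)" if "a \<in> A" for a v
    using finite_subset[OF ext_sub[OF that]] finQ by simp
  define N where "N a v = real (card (ext a v))" for a v
  define f where "f a = real (card (F a))" for a
  have finF: "finite (F a)" if "a \<in> A" for a
    using Suc.prems(2)[OF that] finQ finite_subset by (metis finite_words)
  have f: "f a > 0" if "a \<in> A" for a
    using Suc.prems(2)[OF that] finF[OF that] by (simp add: f_def card_gt_0_iff)
  have N_sum: "(\<Sum>v\<in>Q. N a v) = f a" if a: "a \<in> A" for a
  proof -
    have "F a = (\<Union>v\<in>Q. (#) v ` ext a v)"
      using Suc.prems(2)[OF a] by (auto simp: ext_def words_def length_Suc_conv subset_iff image_iff)
    then have "card (F a) = (\<Sum>v\<in>Q. card ((#) v ` ext a v))"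
      using finQ fin_ext[OF a] by (simp only:) (rule card_UN_disjoint, auto)
    also have "\<dots> = (\<Sum>v\<in>Q. card (ext a v))" by (intro sum.cong refl card_image) auto
    finally show ?thesis by (simp add: N_def f_def)
  qed
  \<comment> \<open>The average value has \<open>f a / q\<close> extensions. A value in
    \<open>U a\<close> has at least half as many, so fixing it raises the deficiency by at most one
    bit.\<close>
  define U where "U a = {v\<in>Q. f a \<le> N a v * (2 * q)}" for a
  define big where "big a \<longleftrightarrow> \<eta> * q \<le> real (card (U a))" for a
  define best where "best a = (SOME v. v \<in> Q \<and> (\<forall>u\<in>Q. N a u \<le> N a v))" for a
  have "\<exists>v. v \<in> Q \<and> (\<forall>u\<in>Q. N a u \<le> N a v)" for a
  proof -
    have "Max (N a ` Q) \<in> N a ` Q" using finQ neQ by simp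
    then obtain v where "v \<in> Q" "N a v = Max (N a ` Q)" by auto
    then show ?thesis using finQ by (metis Max_ge finite_imageI image_eqI)
  qed
  then have best: "best a \<in> Q" "v \<in> Q \<Longrightarrow> N a v \<le> N a (best a)" for a v
    using someI_ex[of "\<lambda>v. v \<in> Q \<and> (\<forall>u\<in>Q. N a u \<le> N a v)"] unfolding best_def by blast+
  \<comment> \<open>One set of offsets must serve all histories \<open>a\<close> and all current
    values \<open>x\<close>, hence sets indexed by pairs. As \<open>act\<close> is a bijection in
    the offset, each of them is as large as \<open>U a\<close>, at least a fraction
    \<open>\<eta>\<close> of \<open>Q\<close>.\<close>
  define S where "S = {a\<in>A. big a} \<times> Q"
  define G where "G = (\<lambda>(a, x). {r\<in>Q. act r x \<in> U a})"
  have cardG: "card (G (a, x)) = card (U a)" if "x \<in> Q" for a x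
  proof -
    have "(\<lambda>r. act r x) ` G (a, x) = U a"
      using act[OF that] by (auto simp: G_def U_def bij_betw_def image_iff)
    moreover have "inj_on (\<lambda>r. act r x) (G (a, x))"
      using act[OF that] by (auto simp: G_def bij_betw_def inj_on_def)
    ultimately show ?thesis using card_image by metis
  qed
  have "\<exists>R\<subseteq>Q. card R \<le> K \<and> real (card {s\<in>S. G s \<inter> R = {}}) \<le> (1 - \<eta>) ^ K * real (card S)"
  proof (rule hitting_set_avoids_few)
    show "finite S" using Suc.prems(1) finQ by (simp add: S_def)
    show "\<eta> * real (card Q) \<le> real (card (G s))" if "s \<in> S" for s
      using that cardG by (auto simp: S_def big_def q_def)
  qed (use finQ neQ \<eta> in \<open>auto simp: G_def\<close>)
  then obtain R0 where R0: "R0 \<subseteq> Q" "card R0 \<le> K"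
    and unl: "real (card {s\<in>S. G s \<inter> R0 = {}}) \<le> \<rho> * real (card S)" unfolding \<rho>_def by blast
  define y where "y a x = (if big a \<and> (\<exists>r\<in>R0. act r x \<in> U a) then act (SOME r. r \<in> R0 \<and> act r x \<in> U a) x else best a)" for a x
  define unlucky where "unlucky a x \<longleftrightarrow> (big a \<and> (\<forall>r\<in>R0. act r x \<notin> U a))" for a x
  define miss where "miss a x \<longleftrightarrow> (\<forall>r\<in>R0. act r x \<noteq> y a x)" for a x
  have D_le: "deficiency Q n (ext a v) \<le> deficiency Q (Suc n) (F a) + log 2 c \<and> ext a v \<noteq> {}"
    if "a \<in> A" "c > 0" "f a \<le> N a v * (c * q)" for a v c
  proof -
    have N: "N a v > 0" using f[OF that(1)] that(2,3) q
      by (metis N_def linorder_not_less mult_eq_0_iff of_nat_0_less_iff of_nat_eq_0_iff bot_nat_0.not_eq_extremum)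
    have "q ^ n / N a v \<le> q ^ Suc n / f a * c"
      using that(3) N f[OF that(1)] q by (simp add: divide_simps mult_left_mono mult.commute mult.left_commute)
    then have "log 2 (q ^ n / N a v) \<le> log 2 (q ^ Suc n / f a * c)"
      using N q by (intro log_mono) auto
    also have "\<dots> = log 2 (q ^ Suc n / f a) + log 2 c"
      using q f[OF that(1)] that(2) by (intro log_mult_pos) auto
    finally show ?thesis using N by (auto simp: deficiency_def N_def f_def q_def)
  qed
  \<comment> \<open>Amortization with the deficiency as potential. A hit costs one bit. An unlucky
    miss is charged to its own term, and the best value does not raise the deficiency. If
    \<open>U a\<close> is small, half of \<open>F a\<close> extends values in \<open>U a\<close>, so
    the best value lowers the deficiency by \<open>L - 1\<close>, which pays for the miss.\<close>
  have step: "L * of_bool (miss a x) + deficiency Q n (ext a (y a x)) \<le> deficiency Q (Suc n) (F a) + 1 + L * of_bool (unlucky a x)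
      \<and> ext a (y a x) \<noteq> {}"
    if a: "a \<in> A" and x: "x \<in> Q" for a x
  proof (cases "big a \<and> (\<exists>r\<in>R0. act r x \<in> U a)")
    case True
    define r where "r = (SOME r. r \<in> R0 \<and> act r x \<in> U a)"
    have r: "r \<in> R0 \<and> act r x \<in> U a" unfolding r_def by (rule someI_ex) (use True in auto)
    have y: "y a x = act r x" using True by (simp add: y_def r_def)
    then have "\<not> miss a x" using r by (auto simp: miss_def)
    moreover have "f a \<le> N a (y a x) * (2 * q)" using r y by (simp add: U_def)
    from D_le[OF a _ this] have "deficiency Q n (ext a (y a x)) \<le> deficiency Q (Suc n) (F a) + 1" "ext a (y a x) \<noteq> {}" by auto
    ultimately show ?thesis using L by (simp add: add_increasing2)
  next
    case False
    then have y: "y a x = best a" by (auto simp: y_def)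
    show ?thesis
    proof (cases "big a")
      case True
      with False have u: "unlucky a x" by (auto simp: unlucky_def)
      have "f a \<le> (\<Sum>v\<in>Q. N a (best a))" unfolding N_sum[OF a, symmetric]
        using best by (intro sum_mono) auto
      then have "f a \<le> N a (y a x) * (1 * q)" by (simp add: y q_def mult.commute)
      from D_le[OF a _ this] have "deficiency Q n (ext a (y a x)) \<le> deficiency Q (Suc n) (F a)" "ext a (y a x) \<noteq> {}" by auto
      then show ?thesis using L u by (cases "miss a x") auto
    next
      case False
      have "f a = (\<Sum>v\<in>U a. N a v) + (\<Sum>v\<in>Q - U a. N a v)"
        unfolding N_sum[OF a, symmetric] using finQ
        by (subst sum.subset_diff[of "U a"]) (auto simp: U_def)
      also have "(\<Sum>v\<in>U a. N a v) \<le> (\<Sum>v\<in>U a. N a (best a))"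
        using best by (intro sum_mono) (auto simp: U_def)
      also have "(\<Sum>v\<in>Q - U a. N a v) \<le> (\<Sum>v\<in>Q - U a. f a / (2 * q))"
        using q by (intro sum_mono) (auto simp: U_def not_le divide_simps)
      also have "\<dots> \<le> q * (f a / (2 * q))"
        unfolding sum_constant q_def using finQ f[OF a]
        by (intro mult_right_mono) (auto simp: card_mono)
      also have "\<dots> = f a / 2" using q by simp
      finally have "f a / 2 \<le> real (card (U a)) * N a (best a)" by simp
      also have "\<dots> \<le> (\<eta> * q) * N a (best a)" using False by (intro mult_right_mono) (auto simp: big_def N_def)
      finally have "f a \<le> N a (y a x) * ((2 * \<eta>) * q)" by (simp add: y mult.commute mult.left_commute)
      from D_le[OF a _ this] have "deficiency Q n (ext a (y a x)) \<le> deficiency Q (Suc n) (F a) + log 2 (2 * \<eta>)"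
        "ext a (y a x) \<noteq> {}" using \<eta> by auto
      moreover have "log 2 (2 * \<eta>) = 1 - L" using \<eta> by (simp add: L_def log_mult log_divide)
      ultimately show ?thesis using L by (cases "miss a x"; cases "unlucky a x") auto
    qed
  qed
  \<comment> \<open>All extended histories form one family, so a single use of the induction
    hypothesis gives sets \<open>R'\<close> common to all of them. This is why the statement is
    about families.\<close>
  define A' where "A' = (\<lambda>(a, x). x # a) ` (A \<times> Q)"
  define F' where "F' = (\<lambda>b. ext (tl b) (y (tl b) (hd b)))"
  have sumA': "(\<Sum>b\<in>A'. g b) = (\<Sum>a\<in>A. \<Sum>x\<in>Q. g (x # a))" for g :: "'a list \<Rightarrow> real"
  proof -
    have "inj_on (\<lambda>(a, x). x # a) (A \<times> Q)" by (auto simp: inj_on_def)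
    then show ?thesis
      by (simp add: A'_def sum.reindex sum.cartesian_product) (simp add: case_prod_beta)
  qed
  have "finite A'" using Suc.prems(1) finQ by (simp add: A'_def)
  moreover have "F' b \<noteq> {} \<and> F' b \<subseteq> words Q n" if "b \<in> A'" for b
    using that step ext_sub unfolding A'_def F'_def by fastforce
  ultimately obtain R' Y' where R': "\<forall>i<n. R' i \<subseteq> Q \<and> card (R' i) \<le> K"
    and Y': "\<forall>b\<in>A'. \<forall>x\<in>words Q n. Y' b x \<in> F' b"
    and IH: "L * (\<Sum>b\<in>A'. \<Sum>x\<in>words Q n. \<Sum>i<n. of_bool (\<forall>r\<in>R' i. act r (x!i) \<noteq> Y' b x ! i))
     \<le> (\<Sum>b\<in>A'. q ^ n * (deficiency Q n (F' b) + real n + real n * L * \<rho>))"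
    using Suc.IH[of A' F'] unfolding q_def L_def \<rho>_def by blast
  define R where "R = case_nat R0 R'"
  define Y where "Y a xs = y a (hd xs) # Y' (hd xs # a) (tl xs)" for a xs
  have unl_sum: "(\<Sum>a\<in>A. \<Sum>x\<in>Q. of_bool (unlucky a x)) \<le> (\<Sum>a\<in>A. q * \<rho>)"
  proof -
    have "(\<Sum>a\<in>A. \<Sum>x\<in>Q. of_bool (unlucky a x)) = (\<Sum>s\<in>A \<times> Q. of_bool (unlucky (fst s) (snd s)) :: real)"
      by (simp add: sum.cartesian_product case_prod_beta)
    also have "\<dots> = real (card {s\<in>A \<times> Q. unlucky (fst s) (snd s)})"
      using Suc.prems(1) finQ by (simp only: card_filter_eq_sum finite_cartesian_product)
    also have "{s\<in>A \<times> Q. unlucky (fst s) (snd s)} = {s\<in>S. G s \<inter> R0 = {}}"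
      using R0(1) by (auto simp: S_def G_def unlucky_def)
    also have "real (card \<dots>) \<le> \<rho> * real (card S)" by (rule unl)
    also have "\<dots> \<le> \<rho> * real (card (A \<times> Q))"
      using \<eta> Suc.prems(1) finQ by (intro mult_left_mono of_nat_mono card_mono) (auto simp: S_def \<rho>_def)
    finally show ?thesis by (simp add: q_def card_cartesian_product mult_ac)
  qed
  have "L * (\<Sum>a\<in>A. \<Sum>x\<in>words Q (Suc n). \<Sum>i<Suc n. of_bool (\<forall>r\<in>R i. act r (x!i) \<noteq> Y a x ! i))
     = L * (\<Sum>a\<in>A. \<Sum>x\<in>Q. \<Sum>xs\<in>words Q n. of_bool (miss a x) + (\<Sum>i<n. of_bool (\<forall>r\<in>R' i. act r (xs!i) \<noteq> Y' (x # a) xs ! i)))"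
    unfolding sum_words_Suc sum.lessThan_Suc_shift by (simp add: R_def Y_def miss_def)
  also have "\<dots> = (\<Sum>a\<in>A. \<Sum>x\<in>Q. q ^ n * (L * of_bool (miss a x))) +
      L * (\<Sum>b\<in>A'. \<Sum>x\<in>words Q n. \<Sum>i<n. of_bool (\<forall>r\<in>R' i. act r (x!i) \<noteq> Y' b x ! i))"
    by (simp add: sum.distrib sumA' card_words finQ q_def sum_distrib_left distrib_left mult_ac
        del: sum_of_bool_eq sum_mult_of_bool_eq sum_of_bool_mult_eq)
  also have "\<dots> \<le> (\<Sum>a\<in>A. \<Sum>x\<in>Q. q ^ n * (L * of_bool (miss a x))) +
      (\<Sum>a\<in>A. \<Sum>x\<in>Q. q ^ n * (deficiency Q n (ext a (y a x)) + real n + real n * L * \<rho>))"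
    using IH by (simp add: sumA' F'_def)
  also have "\<dots> = (\<Sum>a\<in>A. \<Sum>x\<in>Q. q ^ n * ((L * of_bool (miss a x) + deficiency Q n (ext a (y a x))) + real n + real n * L * \<rho>))"
    by (simp add: sum.distrib[symmetric] distrib_left add_ac)
  also have "\<dots> \<le> (\<Sum>a\<in>A. \<Sum>x\<in>Q. q ^ n * ((deficiency Q (Suc n) (F a) + 1 + L * of_bool (unlucky a x)) + real n + real n * L * \<rho>))"
    using step q by (intro sum_mono mult_left_mono add_right_mono) auto
  also have "\<dots> = (\<Sum>a\<in>A. q * (q ^ n * (deficiency Q (Suc n) (F a) + 1 + real n + real n * L * \<rho>)))
      + q ^ n * L * (\<Sum>a\<in>A. \<Sum>x\<in>Q. of_bool (unlucky a x))"
    by (simp add: sum.distrib distrib_left q_def sum_distrib_left mult_ac add_ac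
        del: sum_of_bool_eq sum_mult_of_bool_eq sum_of_bool_mult_eq)
  also have "\<dots> \<le> (\<Sum>a\<in>A. q * (q ^ n * (deficiency Q (Suc n) (F a) + 1 + real n + real n * L * \<rho>)))
      + q ^ n * L * (\<Sum>a\<in>A. q * \<rho>)"
    using unl_sum L q by (intro add_left_mono mult_left_mono) auto
  also have "\<dots> = (\<Sum>a\<in>A. q ^ Suc n * (deficiency Q (Suc n) (F a) + real (Suc n) + real (Suc n) * L * \<rho>))"
    unfolding sum_distrib_left sum.distrib[symmetric]
    by (intro sum.cong refl) (simp add: algebra_simps)
  finally have fin: "L * (\<Sum>a\<in>A. \<Sum>x\<in>words Q (Suc n). \<Sum>i<Suc n. of_bool (\<forall>r\<in>R i. act r (x!i) \<noteq> Y a x ! i)) \<le> \<dots>" .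
  have "R i \<subseteq> Q \<and> card (R i) \<le> K" if "i < Suc n" for i
    using that R0 R' by (cases i) (auto simp: R_def)
  moreover have "Y a x \<in> F a" if a: "a \<in> A" and x: "x \<in> words Q (Suc n)" for a x
  proof -
    obtain v t where vt: "x = v # t" "v \<in> Q" "t \<in> words Q n" using x by (auto simp: words_Suc)
    then have "v # a \<in> A'" using a by (auto simp: A'_def)
    with Y' vt have "Y' (v # a) t \<in> F' (v # a)" by auto
    then show ?thesis by (simp add: Y_def vt F'_def ext_def)
  qed
  ultimately show ?case using fin unfolding q_def L_def \<rho>_def by blast
qed

section \<open>Entropy of functions of a uniform element\<close>

lemma entropy2_eq_sum:
  assumes "finite S" "S \<noteq> {}"
  shows "entropy2 S X = (\<Sum>v\<in>X`S. - (real (card {s\<in>S. X s = v}) / real (card S)) *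
           log 2 (real (card {s\<in>S. X s = v}) / real (card S)))"
proof -
  let ?M = "uniform_count_measure S"
  interpret prob_space ?M using assms by (rule prob_space_uniform_count_measure)
  interpret information_space ?M 2 by unfold_locales simp
  have sp: "space ?M = S" by (simp add: space_uniform_count_measure)
  have "simple_distributed ?M X (\<lambda>v. measure ?M (X -` {v} \<inter> space ?M))"
    by (rule simple_distributedI) (use assms in \<open>auto simp: simple_function_def sp sets_uniform_count_measure\<close>)
  from entropy_simple_distributed[OF this]
  have "entropy2 S X = - (\<Sum>v\<in>X`S. measure ?M (X -` {v} \<inter> S) * log 2 (measure ?M (X -` {v} \<inter> S)))"
    by (simp add: sp entropy2_def)
  moreover have "measure ?M (X -` {v} \<inter> S) = real (card {s\<in>S. X s = v}) / real (card S)" for v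
  proof -
    have "X -` {v} \<inter> S = {s\<in>S. X s = v}" by auto
    then show ?thesis using assms(1) by (simp add: measure_uniform_count_measure)
  qed
  ultimately show ?thesis by (simp add: sum_negf)
qed

text \<open>Gibbs' inequality, from \<open>ln x \<le> x - 1\<close> applied termwise. Any
  subprobability \<open>p\<close> that is positive on the values gives an upper bound on the
  entropy.\<close>

lemma entropy2_le_cross_entropy:
  assumes S: "finite S" "S \<noteq> {}" and p: "\<And>v. v \<in> X ` S \<Longrightarrow> p v > 0" "(\<Sum>v\<in>X`S. p v) \<le> 1"
  shows "entropy2 S X \<le> (\<Sum>s\<in>S. log 2 (1 / p (X s))) / real (card S)"
proof -
  define c where "c = real (card S)"
  define m where "m v = real (card {s\<in>S. X s = v})" for v
  have c: "c > 0" using S by (simp add: c_def card_gt_0_iff)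
  have m: "m v > 0" if "v \<in> X ` S" for v using that S by (auto simp: m_def card_gt_0_iff)
  have sum_eq: "(\<Sum>s\<in>S. g (X s)) = (\<Sum>v\<in>X`S. m v * g v)" for g :: "nat \<Rightarrow> real"
  proof -
    have "(\<Sum>s\<in>S. g (X s)) = (\<Sum>v\<in>X`S. \<Sum>s\<in>{s\<in>S. X s = v}. g (X s))"
      using S by (intro sum.image_gen) auto
    also have "\<dots> = (\<Sum>v\<in>X`S. m v * g v)" by (intro sum.cong) (auto simp: m_def)
    finally show ?thesis .
  qed
  have msum: "(\<Sum>v\<in>X`S. m v) = c" using sum_eq[of "\<lambda>_. 1"] by (simp add: c_def)
  have "entropy2 S X - (\<Sum>s\<in>S. log 2 (1 / p (X s))) / c
     = (\<Sum>v\<in>X`S. - (m v / c) * log 2 (m v / c) - (m v / c) * log 2 (1 / p v))"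
    using sum_eq[of "\<lambda>v. log 2 (1 / p v)"]
    by (simp add: entropy2_eq_sum[OF S] m_def[symmetric] c_def[symmetric] sum_subtractf sum_divide_distrib)
  also have "\<dots> \<le> (\<Sum>v\<in>X`S. (p v - m v / c) / ln 2)"
  proof (rule sum_mono)
    fix v assume v: "v \<in> X ` S"
    have "- (m v / c) * log 2 (m v / c) - (m v / c) * log 2 (1 / p v) = (m v / c) * (ln (p v / (m v / c)) / ln 2)"
      using c m[OF v] p(1)[OF v] by (simp add: log_def ln_div ln_mult field_simps)
    also have "\<dots> \<le> (m v / c) * ((p v / (m v / c) - 1) / ln 2)"
      using c m[OF v] p(1)[OF v] by (intro mult_left_mono divide_right_mono ln_le_minus_one) auto
    also have "\<dots> = (p v - m v / c) / ln 2" using c m[OF v] by (simp add: field_simps)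
    finally show "- (m v / c) * log 2 (m v / c) - (m v / c) * log 2 (1 / p v) \<le> (p v - m v / c) / ln 2" .
  qed
  also have "\<dots> = ((\<Sum>v\<in>X`S. p v) - 1) / ln 2"
    unfolding sum_divide_distrib[symmetric] sum_subtractf msum using c by simp
  also have "\<dots> \<le> 0" using p(2) by (simp add: divide_nonpos_pos)
  finally show ?thesis by (simp add: c_def)
qed

lemma entropy2_le_log_card:
  assumes "finite S" "S \<noteq> {}" "X ` S \<subseteq> T" "finite T"
  shows "entropy2 S X \<le> log 2 (real (card T))"
proof -
  have T: "card T > 0" using assms by (auto simp: card_gt_0_iff)
  have "card (X ` S) \<le> card T" using assms by (intro card_mono)
  then have "entropy2 S X \<le> (\<Sum>s\<in>S. log 2 (1 / (1 / real (card T)))) / real (card S)"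
    using assms T by (intro entropy2_le_cross_entropy) auto
  then show ?thesis using assms T by simp
qed

text \<open>The cross entropy relative to the even mixture of the uniform distributions on \<open>R\<close> and on \<open>T\<close>.\<close>

lemma entropy2_le_mixture:
  assumes S: "finite S" "S \<noteq> {}" and T: "X ` S \<subseteq> T" "finite T" and R: "finite R" "card R \<le> K" "0 < K"
  shows "entropy2 S X \<le> 1 + log 2 (real K) +
           real (card {s\<in>S. X s \<notin> R}) / real (card S) * log 2 (real (card T))"
proof -
  have cT: "card T > 0" using assms by (auto simp: card_gt_0_iff)
  define p where "p v = (if v \<in> R then 1 / (2 * real K) else 1 / (2 * real (card T)))" for v
  have p0: "p v > 0" for v using cT R by (simp add: p_def)
  have "(\<Sum>v\<in>X`S. p v) \<le> (\<Sum>v\<in>R. 1 / (2 * real K)) + (\<Sum>v\<in>T. 1 / (2 * real (card T)))"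
  proof -
    have "(\<Sum>v\<in>X`S. p v) = (\<Sum>v\<in>X`S \<inter> R. p v) + (\<Sum>v\<in>X`S - R. p v)"
      using S by (intro sum.Int_Diff) auto
    also have "(\<Sum>v\<in>X`S \<inter> R. p v) = (\<Sum>v\<in>X`S \<inter> R. 1 / (2 * real K))"
      by (intro sum.cong) (auto simp: p_def)
    also have "\<dots> \<le> (\<Sum>v\<in>R. 1 / (2 * real K))" using R by (intro sum_mono2) auto
    also have "(\<Sum>v\<in>X`S - R. p v) = (\<Sum>v\<in>X`S - R. 1 / (2 * real (card T)))"
      by (intro sum.cong) (auto simp: p_def)
    also have "\<dots> \<le> (\<Sum>v\<in>T. 1 / (2 * real (card T)))" using T by (intro sum_mono2) auto
    finally show ?thesis by simp
  qed
  also have "\<dots> \<le> 1" using R cT by (simp add: field_simps)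
  finally have "entropy2 S X \<le> (\<Sum>s\<in>S. log 2 (1 / p (X s))) / real (card S)"
    using S p0 by (intro entropy2_le_cross_entropy) auto
  also have "\<dots> \<le> (\<Sum>s\<in>S. 1 + log 2 (real K) + of_bool (X s \<notin> R) * log 2 (real (card T))) / real (card S)"
    using R cT by (intro divide_right_mono sum_mono) (auto simp: p_def log_mult)
  also have "\<dots> = 1 + log 2 (real K) + real (card {s\<in>S. X s \<notin> R}) / real (card S) * log 2 (real (card T))"
    using S by (simp add: sum.distrib sum_distrib_right[symmetric] add_divide_distrib Int_def)
  finally show ?thesis .
qed

lemma entropy2_uniform:
  assumes "finite S" "S \<noteq> {}" "0 < k" "\<And>v. v \<in> X ` S \<Longrightarrow> card {s\<in>S. X s = v} = k"
  shows "entropy2 S X = log 2 (real (card (X ` S)))"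
proof -
  have "card S = (\<Sum>v\<in>X`S. \<Sum>s\<in>{s\<in>S. X s = v}. 1)"
    using assms(1) sum.image_gen[of S "\<lambda>_. 1::nat" X] by simp
  also have "\<dots> = card (X ` S) * k" using assms(4) by simp
  finally have c: "card S = card (X ` S) * k" .
  moreover have "card S > 0" using assms by (simp add: card_gt_0_iff)
  ultimately have c0: "card (X ` S) > 0" using assms by (simp add: card_gt_0_iff)
  have "entropy2 S X = (\<Sum>v\<in>X`S. - (1 / real (card (X ` S))) * log 2 (1 / real (card (X ` S))))"
    unfolding entropy2_eq_sum[OF assms(1,2)] using assms(3,4) c by (intro sum.cong) auto
  also have "\<dots> = log 2 (real (card (X ` S)))" using c0 by (simp add: log_divide)
  finally show ?thesis .
qed

section \<open>Independent uniform coordinates\<close>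

lemma card_PiE_fixed:
  assumes "finite I" "i \<in> I" "v \<in> B i"
  shows "card {A \<in> PiE I B. A i = v} = card (PiE (I - {i}) B)"
proof -
  define I' where "I' = I - {i}"
  have I: "I = insert i I'" and i: "i \<notin> I'" using assms by (auto simp: I'_def)
  have "{A \<in> PiE I B. A i = v} = (\<lambda>g. g(i := v)) ` PiE I' B"
    using assms(3) unfolding I PiE_insert_eq by auto
  moreover have "inj_on (\<lambda>g. g(i := v)) (PiE I' B)"
    using inj_combinator[OF i, of B] assms(3) by (auto simp: inj_on_def)
  ultimately show ?thesis by (simp add: card_image I'_def)
qed

lemma entropy2_PiE_component:
  assumes "finite I" "i \<in> I" "\<And>j. j \<in> I \<Longrightarrow> finite (B j) \<and> B j \<noteq> {}"
  shows "entropy2 (PiE I B) (\<lambda>A. A i) = log 2 (real (card (B i)))"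
proof -
  have ne: "PiE I B \<noteq> {}" using assms by (auto simp: PiE_eq_empty_iff)
  have fin: "finite (PiE I B)" using assms by (intro finite_PiE) auto
  have im: "(\<lambda>A. A i) ` PiE I B = B i"
    using ne assms(2) by (rule_tac image_projection_PiE[THEN trans]) auto
  have k: "card (PiE (I - {i}) B) > 0" using assms by (auto simp: card_gt_0_iff PiE_eq_empty_iff intro!: finite_PiE)
  show ?thesis
    using entropy2_uniform[OF fin ne k, of "\<lambda>A. A i"] card_PiE_fixed[OF assms(1,2), of _ B] unfolding im by simp
qed

section \<open>Permutations with many near points\<close>

text \<open>A generating function for the number of near points. A permutation of
  \<open>insert a S\<close> is a transposition of \<open>a\<close> and \<open>b\<close> after a
  permutation of \<open>S\<close>; summing the factor for \<open>a\<close> over \<open>b\<close>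
  gives \<open>card + \<alpha> * K\<close>. The relation varies in the induction because the
  transposition is absorbed into it.\<close>

lemma sum_permutations_power_near_le:
  fixes \<alpha> :: real and near :: "'a \<Rightarrow> 'a \<Rightarrow> bool"
  assumes "finite S" "\<alpha> \<ge> 0" "\<And>i. i \<in> S \<Longrightarrow> card {v\<in>S. near i v} \<le> K"
  shows "(\<Sum>\<pi> | \<pi> permutes S. (1 + \<alpha>) ^ card {i\<in>S. near i (\<pi> i)}) \<le> (\<Prod>m=1..card S. real m + \<alpha> * real K)"
  using assms
proof (induction S arbitrary: near rule: finite_induct)
  case empty
  show ?case by simp
next
  case (insert a S)
  define W where "W = (\<Prod>m=1..card S. real m + \<alpha> * real K)"
  have W: "W \<ge> 0" unfolding W_def using insert.prems by (intro prod_nonneg) auto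
  have inner: "(\<Sum>q | q permutes S. (1 + \<alpha>) ^ card {i\<in>insert a S. near i ((Transposition.transpose a b \<circ> q) i)})
      \<le> (1 + \<alpha> * of_bool (near a b)) * W" if b: "b \<in> insert a S" for b
  proof -
    define near' where "near' i v = near i (Transposition.transpose a b v)" for i v
    have IH: "(\<Sum>q | q permutes S. (1 + \<alpha>) ^ card {i\<in>S. near' i (q i)}) \<le> W"
      unfolding W_def
    proof (rule insert.IH)
      fix i assume i: "i \<in> S"
      have "Transposition.transpose a b ` {v\<in>S. near' i v} \<subseteq> {v\<in>insert a S. near i v}"
        using b by (auto simp: near'_def Transposition.transpose_def)
      then have "card {v\<in>S. near' i v} \<le> card {v\<in>insert a S. near i v}"
        using insert.hyps(1) by (intro card_inj_on_le[of "Transposition.transpose a b"])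
          (auto intro!: inj_onI dest: arg_cong[of _ _ "Transposition.transpose a b"])
      then show "card {v\<in>S. near' i v} \<le> K" using insert.prems(2)[of i] i by auto
    qed (use insert.prems in auto)
    have "(\<Sum>q | q permutes S. (1 + \<alpha>) ^ card {i\<in>insert a S. near i ((Transposition.transpose a b \<circ> q) i)})
      = (\<Sum>q | q permutes S. (1 + \<alpha> * of_bool (near a b)) * (1 + \<alpha>) ^ card {i\<in>S. near' i (q i)})"
    proof (rule sum.cong[OF refl])
      fix q assume "q \<in> {q. q permutes S}"
      then have "q a = a" using insert.hyps by (simp add: permutes_not_in)
      then have "{i\<in>insert a S. near i ((Transposition.transpose a b \<circ> q) i)}
         = (if near a b then insert a {i\<in>S. near' i (q i)} else {i\<in>S. near' i (q i)})"
        by (auto simp: near'_def)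
      then show "(1 + \<alpha>) ^ card {i\<in>insert a S. near i ((Transposition.transpose a b \<circ> q) i)}
        = (1 + \<alpha> * of_bool (near a b)) * (1 + \<alpha>) ^ card {i\<in>S. near' i (q i)}"
        using insert.hyps by simp
    qed
    also have "\<dots> \<le> (1 + \<alpha> * of_bool (near a b)) * W"
      unfolding sum_distrib_left[symmetric] using IH insert.prems by (intro mult_left_mono) auto
    finally show ?thesis .
  qed
  have "(\<Sum>\<pi> | \<pi> permutes (insert a S). (1 + \<alpha>) ^ card {i\<in>insert a S. near i (\<pi> i)})
     = (\<Sum>b\<in>insert a S. \<Sum>q | q permutes S. (1 + \<alpha>) ^ card {i\<in>insert a S. near i ((Transposition.transpose a b \<circ> q) i)})"
    using insert.hyps by (subst sum_over_permutations_insert) auto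
  also have "\<dots> \<le> (\<Sum>b\<in>insert a S. (1 + \<alpha> * of_bool (near a b)) * W)"
    by (rule sum_mono) (rule inner)
  also have "\<dots> = (real (card (insert a S)) + \<alpha> * real (card {b\<in>insert a S. near a b})) * W"
    using insert.hyps(1) by (simp only: sum_distrib_right[symmetric] sum.distrib sum_distrib_left[symmetric])
      (simp add: Int_def del: sum.insert)
  also have "\<dots> \<le> (real (card (insert a S)) + \<alpha> * real K) * W"
    using insert.prems W by (intro mult_right_mono add_left_mono mult_left_mono of_nat_mono) auto
  also have "\<dots> = (\<Prod>m=1..card (insert a S). real m + \<alpha> * real K)"
    using insert.hyps by (simp add: W_def mult.commute)
  finally show ?case .
qed

text \<open>The product is \<open>(2n)! / n!\<close>, that is, \<open>n!\<close> times the central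
  binomial coefficient.\<close>

lemma prod_add_le_fact: "(\<Prod>m=1..n. real m + real n) \<le> 4 ^ n * fact n"
proof -
  have "(\<Prod>m=1..k. real m + real n) * fact n = fact (n + k)" for k
  proof (induction k)
    case (Suc k)
    have "(\<Prod>m=1..Suc k. real m + real n) * fact n = (real (Suc k) + real n) * ((\<Prod>m=1..k. real m + real n) * fact n)"
      by simp
    also have "\<dots> = fact (n + Suc k)" unfolding Suc.IH by simp
    finally show ?case .
  qed simp
  moreover have "real ((2 * n) choose n) * fact n * fact n = fact (n + n)"
    using binomial_fact[of n "2 * n", where 'a = real] by (simp add: mult_2[symmetric])
  ultimately have "(\<Prod>m=1..n. real m + real n) * fact n = real ((2 * n) choose n) * fact n * fact n"
    by simp
  then have "(\<Prod>m=1..n. real m + real n) = real ((2 * n) choose n) * fact n" by simp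
  also have "real ((2 * n) choose n) \<le> 2 ^ (2 * n)"
    using binomial_le_pow2[of "2 * n" n] by (metis of_nat_le_iff of_nat_numeral of_nat_power)
  finally show ?thesis by (simp add: power_mult)
qed

text \<open>Markov's inequality for the weight \<open>(1 + \<alpha>) ^ count\<close>. The choice
  \<open>\<alpha> = n / K\<close> turns the product of the moment bound into
  \<open>(2n)! / n!\<close>, so that only a factor \<open>4 ^ n\<close> is lost.\<close>

lemma card_permutations_many_near_le:
  fixes near :: "'a \<Rightarrow> 'a \<Rightarrow> bool"
  assumes S: "finite S" and K: "K > 0" "\<And>i. i \<in> S \<Longrightarrow> card {v\<in>S. near i v} \<le> K"
  shows "real (card {\<pi>. \<pi> permutes S \<and> q \<le> card {i\<in>S. near i (\<pi> i)}})
    \<le> 4 ^ card S * fact (card S) * (real K / real (card S)) ^ q"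
proof (cases "card S = 0")
  case True
  then have "S = {}" using S by simp
  then show ?thesis by (cases q) auto
next
  case False
  define n where "n = card S"
  define \<alpha> where "\<alpha> = real n / real K"
  have n: "n > 0" using False by (simp add: n_def)
  have \<alpha>: "\<alpha> > 0" using n K by (simp add: \<alpha>_def)
  let ?B = "{\<pi>. \<pi> permutes S \<and> q \<le> card {i\<in>S. near i (\<pi> i)}}"
  have "\<alpha> ^ q * real (card ?B) = (\<Sum>\<pi>\<in>?B. \<alpha> ^ q)" by simp
  also have "\<dots> \<le> (\<Sum>\<pi>\<in>?B. (1 + \<alpha>) ^ card {i\<in>S. near i (\<pi> i)})"
  proof (rule sum_mono)
    fix \<pi> assume "\<pi> \<in> ?B"
    then have "(1 + \<alpha>) ^ q \<le> (1 + \<alpha>) ^ card {i\<in>S. near i (\<pi> i)}" using \<alpha> by (intro power_increasing) auto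
    moreover have "\<alpha> ^ q \<le> (1 + \<alpha>) ^ q" using \<alpha> by (intro power_mono) auto
    ultimately show "\<alpha> ^ q \<le> (1 + \<alpha>) ^ card {i\<in>S. near i (\<pi> i)}" by simp
  qed
  also have "\<dots> \<le> (\<Sum>\<pi> | \<pi> permutes S. (1 + \<alpha>) ^ card {i\<in>S. near i (\<pi> i)})"
    using S \<alpha> by (intro sum_mono2) (auto simp: finite_permutations)
  also have "\<dots> \<le> (\<Prod>m=1..card S. real m + \<alpha> * real K)"
    using S \<alpha> K by (intro sum_permutations_power_near_le) auto
  also have "\<dots> = (\<Prod>m=1..n. real m + real n)" using K by (simp add: \<alpha>_def n_def)
  also have "\<dots> \<le> 4 ^ n * fact n" by (rule prod_add_le_fact)
  finally have "real (card ?B) \<le> 4 ^ n * fact n / \<alpha> ^ q"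
    using \<alpha> by (simp add: field_simps)
  also have "\<dots> = 4 ^ n * fact n * (real K / real n) ^ q"
    by (simp add: \<alpha>_def power_divide)
  finally show ?thesis by (simp add: n_def)
qed

section \<open>Measurability and averaging over the coins\<close>

lemma prob_space_coins: "prob_space coins"
  unfolding coins_def by (intro prob_space_PiM measure_pmf.prob_space_axioms)

text \<open>Only countably many configurations are reachable from a given disk, so measurability of a
  run reduces to that of a single step.\<close>

definition reachable_configs :: "nat \<Rightarrow> disk \<Rightarrow> (bits \<times> disk) option set" where
  "reachable_configs m D0 = insert None (Some ` ({s. length s = m} \<times> {D. finite {a. D a \<noteq> D0 a}}))"

text \<open>A finite modification is described by a finite association list, and there are countably
  many of these.\<close>

lemma countable_finite_modifications:
  fixes D0 :: "'a::countable \<Rightarrow> 'b::countable"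
  shows "countable {D. finite {a. D a \<noteq> D0 a}}"
proof -
  have "{D. finite {a. D a \<noteq> D0 a}} \<subseteq>
      (\<lambda>xs a. case map_of xs a of None \<Rightarrow> D0 a | Some v \<Rightarrow> v) ` (UNIV :: ('a \<times> 'b) list set)"
  proof
    fix D assume "D \<in> {D. finite {a. D a \<noteq> D0 a}}"
    then obtain as where as: "set as = {a. D a \<noteq> D0 a}" using finite_list by blast
    have "D = (\<lambda>a. case map_of (map (\<lambda>a. (a, D a)) as) a of None \<Rightarrow> D0 a | Some v \<Rightarrow> v)"
      using as by (auto simp: fun_eq_iff map_of_map_restrict restrict_map_def split: option.split)
    then show "D \<in> (\<lambda>xs a. case map_of xs a of None \<Rightarrow> D0 a | Some v \<Rightarrow> v) ` UNIV" by blast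
  qed
  then show ?thesis by (rule countable_subset) simp
qed

lemma countable_reachable_configs: "countable (reachable_configs m D0)"
  unfolding reachable_configs_def by (intro countable_insert countable_image countable_SIGMA
    countable_finite_modifications) (auto intro: countable_subset[OF subset_UNIV])

lemma em_step_reachable:
  assumes "(\<And>j s. length s = m \<Longrightarrow> length (fst (alg j s)) = m)" "b \<le> m" "\<And>a. length (D0 a) = b"
    and "length s = m" "finite {a. D a \<noteq> D0 a}" "\<And>a. length (D a) = b"
    and "em_step b alg j (s, D) = Some (s', D')"
  shows "length s' = m \<and> finite {a. D' a \<noteq> D0 a} \<and> (\<forall>a. length (D' a) = b)"
proof -
  obtain t act where t: "alg j s = (t, act)" by fastforce
  then have "length t = m" using assms(1)[OF assms(4), of j] by simp
  moreover have "{a'. (D(a := X)) a' \<noteq> D0 a'} \<subseteq> insert a {a. D a \<noteq> D0 a}" for a X by auto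
  then have "finite {a'. (D(a := X)) a' \<noteq> D0 a'}" for a X
    using assms(5) finite_subset by (metis finite_insert)
  ultimately show ?thesis using assms t by (cases act) (auto simp: em_step_def)
qed

lemma em_config_reachable:
  assumes "(\<And>j s. length s = m \<Longrightarrow> length (fst (alg j s)) = m)" "b \<le> m" "\<And>a. length (D0 a) = b"
    and "em_config m b alg D0 j = Some (s, D)"
  shows "length s = m \<and> finite {a. D a \<noteq> D0 a} \<and> (\<forall>a. length (D a) = b)"
  using assms(4)
proof (induction j arbitrary: s D)
  case 0
  then show ?case using assms by auto
next
  case (Suc j)
  then obtain s0 D1 where "em_config m b alg D0 j = Some (s0, D1)" "em_step b alg j (s0, D1) = Some (s, D)"
    by (cases "em_config m b alg D0 j") auto
  moreover from Suc.IH[OF this(1)] have "length s0 = m" "finite {a. D1 a \<noteq> D0 a}" "\<And>a. length (D1 a) = b" by auto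
  ultimately show ?case
    using em_step_reachable[of m alg b D0 s0 D1 j s D] assms(1-3) by blast
qed

text \<open>From each fixed configuration one step is a measurable function of the coins;
  countability of the reachable configurations allows these to be glued. A step is known to be
  measurable only for memory contents of length \<open>m\<close>, so the reachable set carries that
  invariant.\<close>

lemma measurable_em_config:
  assumes alg: "em_algorithm m alg" and b: "b \<le> m" "\<And>a. length (D0 a) = b"
  shows "(\<lambda>\<omega>. em_config m b (alg \<omega>) D0 j) \<in> coins \<rightarrow>\<^sub>M count_space UNIV"
proof -
  have range: "em_config m b (alg \<omega>) D0 j \<in> reachable_configs m D0" for \<omega> j
  proof (cases "em_config m b (alg \<omega>) D0 j")
    case (Some c)
    obtain s D where c: "c = (s, D)" by fastforce
    have "\<And>j s. length s = m \<Longrightarrow> length (fst (alg \<omega> j s)) = m" using alg by (auto simp: em_algorithm_def)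
    then have "length s = m \<and> finite {a. D a \<noteq> D0 a} \<and> (\<forall>a. length (D a) = b)"
      using b Some c by (intro em_config_reachable) auto
    then show ?thesis using Some c by (auto simp: reachable_configs_def)
  qed (simp add: reachable_configs_def)
  show ?thesis
  proof (induction j)
    case 0
    show ?case by simp
  next
    case (Suc j)
    have "(\<lambda>\<omega>. Option.bind c (em_step b (alg \<omega>) j)) \<in> coins \<rightarrow>\<^sub>M count_space UNIV"
      if c: "c \<in> reachable_configs m D0" for c
    proof (cases c)
      case (Some c')
      then obtain s D where c': "c' = (s, D)" "length s = m" using c by (auto simp: reachable_configs_def)
      have "(\<lambda>\<omega>. alg \<omega> j s) \<in> coins \<rightarrow>\<^sub>M count_space UNIV"
        using alg c' by (auto simp: em_algorithm_def)
      then have "(\<lambda>\<omega>. (\<lambda>r. case r of (s', Halt) \<Rightarrow> None | (s', Read a) \<Rightarrow> Some (D a @ drop b s', D)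
           | (s', Write a) \<Rightarrow> Some (s', D(a := take b s'))) (alg \<omega> j s)) \<in> coins \<rightarrow>\<^sub>M count_space UNIV"
        by (rule measurable_compose) simp
      then show ?thesis using Some c' by (simp add: em_step_def)
    qed simp
    moreover have "(\<lambda>\<omega>. em_config m b (alg \<omega>) D0 j) \<in> coins \<rightarrow>\<^sub>M count_space (reachable_configs m D0)"
      using Suc range unfolding measurable_def by simp
    ultimately show ?case unfolding em_config.simps
      by (rule measurable_compose_countable'[OF _ _ countable_reachable_configs])
  qed
qed

lemma length_perm_disk: "length (perm_disk b n \<pi> d a) = b"
  by (simp add: perm_disk_def)

section \<open>Halting times and the event of fast success\<close>

definition halts_at where
  "halts_at m b alg D0 j D \<longleftrightarrow>
     (\<exists>s. em_config m b alg D0 j = Some (s, D)) \<and> em_config m b alg D0 (Suc j) = None"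

lemma em_config_None_mono: "em_config m b alg D0 j = None \<Longrightarrow> j \<le> j' \<Longrightarrow> em_config m b alg D0 j' = None"
  by (induction j') (auto simp: le_Suc_eq)

lemma num_ios_halts_at:
  assumes "halts_at m b alg D0 j D"
  shows "num_ios m b alg D0 = of_nat j"
proof -
  have "{i. em_config m b alg D0 i \<noteq> None} = {..j}"
  proof (intro set_eqI iffI)
    fix i assume i: "i \<in> {i. em_config m b alg D0 i \<noteq> None}"
    show "i \<in> {..j}"
    proof (rule ccontr)
      assume "i \<notin> {..j}"
      then have "em_config m b alg D0 i = None"
        using assms em_config_None_mono[of m b alg D0 "Suc j" i] by (simp add: halts_at_def)
      then show False using i by simp
    qed
  next
    fix i assume "i \<in> {..j}"
    then show "i \<in> {i. em_config m b alg D0 i \<noteq> None}"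
      using assms em_config_None_mono[of m b alg D0 i j]
      by (cases "em_config m b alg D0 i") (auto simp: halts_at_def)
  qed
  then show ?thesis unfolding num_ios_def
    by (intro antisym SUP_least SUP_upper2[of j]) (auto intro: of_nat_mono)
qed

definition solves_within where
  "solves_within M B w n alg \<pi> d t \<longleftrightarrow>
     (\<exists>T\<le>t. \<exists>D. halts_at (M * w) (B * w) alg (perm_disk (B * w) n \<pi> d) T D \<and>
          (\<forall>i\<in>{1..n}. output_word B n w D (\<pi> i) = d i))"

lemma solves_within_iff:
  "solves_within M B w n alg \<pi> d t \<longleftrightarrow> solves_perm M B w n alg \<pi> d \<and>
     num_ios (M * w) (B * w) alg (perm_disk (B * w) n \<pi> d) \<le> of_nat t"
proof -
  have "solves_perm M B w n alg \<pi> d \<longleftrightarrow> (\<exists>T D. halts_at (M * w) (B * w) alg (perm_disk (B * w) n \<pi> d) T D \<and>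
          (\<forall>i\<in>{1..n}. output_word B n w D (\<pi> i) = d i))"
    unfolding solves_perm_def halts_with_def halts_at_def by blast
  then show ?thesis
    unfolding solves_within_def using num_ios_halts_at by (metis of_nat_le_iff)
qed

lemma measurable_config_pred:
  assumes alg: "em_algorithm (M * w) alg" and "B \<le> M"
  shows "{\<omega> \<in> space coins. P (em_config (M * w) (B * w) (alg \<omega>) (perm_disk (B * w) n \<pi> d) j)} \<in> sets coins"
proof -
  have "B * w \<le> M * w" using assms by simp
  from measurable_em_config[OF alg this length_perm_disk]
  have "(\<lambda>\<omega>. P (em_config (M * w) (B * w) (alg \<omega>) (perm_disk (B * w) n \<pi> d) j)) \<in> coins \<rightarrow>\<^sub>M count_space UNIV"
    by (rule measurable_compose) simp
  then show ?thesis by (simp add: pred_def)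
qed

lemma measurable_solves_perm:
  assumes "em_algorithm (M * w) alg" "B \<le> M"
  shows "{\<omega> \<in> space coins. solves_perm M B w n (alg \<omega>) \<pi> d} \<in> sets coins"
proof -
  let ?c = "\<lambda>\<omega> j. em_config (M * w) (B * w) (alg \<omega>) (perm_disk (B * w) n \<pi> d) j"
  have "{\<omega> \<in> space coins. solves_perm M B w n (alg \<omega>) \<pi> d} =
    (\<Union>j. {\<omega> \<in> space coins. ?c \<omega> j \<noteq> None \<and> (\<forall>i\<in>{1..n}. output_word B n w (snd (the (?c \<omega> j))) (\<pi> i) = d i)}
       \<inter> {\<omega> \<in> space coins. ?c \<omega> (Suc j) = None})"
    unfolding solves_perm_def halts_with_def by fastforce
  also have "\<dots> \<in> sets coins"
    by (intro sets.countable_UN sets.Int measurable_config_pred[OF assms] image_subsetI)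
  finally show ?thesis .
qed

text \<open>The index set of the supremum depends on the coins. Giving 0 to times that are not
  reached makes it a supremum over all \<open>j\<close>.\<close>

lemma measurable_num_ios:
  assumes "em_algorithm (M * w) alg" "B \<le> M"
  shows "(\<lambda>\<omega>. num_ios (M * w) (B * w) (alg \<omega>) (perm_disk (B * w) n \<pi> d)) \<in> borel_measurable coins"
proof -
  let ?c = "\<lambda>\<omega> j. em_config (M * w) (B * w) (alg \<omega>) (perm_disk (B * w) n \<pi> d) j"
  have "num_ios (M * w) (B * w) (alg \<omega>) (perm_disk (B * w) n \<pi> d) =
     (SUP j. if ?c \<omega> j \<noteq> None then of_nat j else 0)" for \<omega>
  proof (unfold num_ios_def, intro antisym SUP_least)
    fix j assume "j \<in> {j. ?c \<omega> j \<noteq> None}"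
    then show "of_nat j \<le> (SUP j. if ?c \<omega> j \<noteq> None then of_nat j else 0 :: ennreal)"
      by (intro SUP_upper2[of j]) auto
  next
    fix j
    show "(if ?c \<omega> j \<noteq> None then of_nat j else 0) \<le> (SUP j\<in>{j. ?c \<omega> j \<noteq> None}. of_nat j :: ennreal)"
      by (cases "?c \<omega> j = None") (auto intro: SUP_upper)
  qed
  moreover have "(\<lambda>\<omega>. SUP j. if ?c \<omega> j \<noteq> None then of_nat j else 0 :: ennreal) \<in> borel_measurable coins"
    by (intro borel_measurable_SUP measurable_If measurable_const measurable_config_pred[OF assms]) auto
  ultimately show ?thesis by simp
qed

text \<open>More than \<open>t\<close> I/Os means at least \<open>t + 1\<close>, so by Markov this
  has probability at most \<open>X / (t + 1) \<le> 1/6\<close>. With the error 1/3, every input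
  succeeds within \<open>t\<close> I/Os with probability at least 1/2; averaging over the inputs
  fixes the coins.\<close>

lemma good_coins_exist:
  assumes alg: "em_algorithm (M * w) alg" "B \<le> M" and I: "finite I"
    and err: "\<And>\<pi> d. (\<pi>, d) \<in> I \<Longrightarrow> error_prob M B w n alg \<pi> d \<le> 1/3"
    and ios: "\<And>\<pi> d. (\<pi>, d) \<in> I \<Longrightarrow> expected_ios M B w n alg \<pi> d \<le> ennreal X"
    and t: "6 * X \<le> real t + 1" "0 \<le> X"
  shows "\<exists>\<omega>. card I \<le> 2 * card {(\<pi>, d) \<in> I. solves_within M B w n (alg \<omega>) \<pi> d t}"
proof (rule ccontr)
  assume neg: "\<not> ?thesis"
  interpret prob_space coins by (rule prob_space_coins)
  define E where "E = (\<lambda>(\<pi>, d). {\<omega> \<in> space coins. solves_within M B w n (alg \<omega>) \<pi> d t})"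
  define N where "N = (\<lambda>(\<pi>, d) \<omega>. num_ios (M * w) (B * w) (alg \<omega>) (perm_disk (B * w) n \<pi> d))"
  have N: "N x \<in> borel_measurable coins" for x
    using measurable_num_ios[OF alg] by (cases x) (simp add: N_def)
  have E_eq: "E (\<pi>, d) = {\<omega> \<in> space coins. solves_perm M B w n (alg \<omega>) \<pi> d} \<inter> {\<omega> \<in> space coins. N (\<pi>, d) \<omega> \<le> of_nat t}" for \<pi> d
    by (auto simp: E_def N_def solves_within_iff)
  have E_sets: "E x \<in> sets coins" for x
    using measurable_solves_perm[OF alg] N[of x] by (cases x) (simp add: E_eq)
  have E_half: "1/2 \<le> measure coins (E (\<pi>, d))" if x: "(\<pi>, d) \<in> I" for \<pi> d
  proof -
    let ?S = "{\<omega> \<in> space coins. \<not> solves_perm M B w n (alg \<omega>) \<pi> d}"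
    let ?L = "{\<omega> \<in> space coins. 1 \<le> ennreal (1 / (real t + 1)) * N (\<pi>, d) \<omega>}"
    have S: "?S \<in> sets coins"
      using sets.compl_sets[OF measurable_solves_perm[OF alg, of n \<pi> d]] by (simp add: set_diff_eq conj_commute cong: conj_cong)
    have L: "?L \<in> sets coins" using N by measurable
    have "emeasure coins ?L \<le> ennreal (1 / (real t + 1)) * (\<integral>\<^sup>+\<omega>. N (\<pi>, d) \<omega> * indicator (space coins) \<omega> \<partial>coins)"
      using N by (intro nn_integral_Markov_inequality[of "N (\<pi>, d)", THEN order_trans[rotated]]) (auto intro: emeasure_mono)
    also have "(\<integral>\<^sup>+\<omega>. N (\<pi>, d) \<omega> * indicator (space coins) \<omega> \<partial>coins) = expected_ios M B w n alg \<pi> d"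
      unfolding expected_ios_def by (intro nn_integral_cong) (auto simp: N_def)
    also have "ennreal (1 / (real t + 1)) * \<dots> \<le> ennreal (1 / (real t + 1)) * ennreal X"
      using ios[OF x] by (intro mult_left_mono) auto
    also have "\<dots> = ennreal (X / (real t + 1))" using t by (simp add: ennreal_mult[symmetric])
    also have "\<dots> \<le> ennreal (1/6)" using t by (intro ennreal_leI) (simp add: field_simps)
    finally have "measure coins ?L \<le> 1/6" by (simp add: emeasure_eq_measure)
    moreover have "measure coins ?S \<le> 1/3" using err[OF x] by (simp add: error_prob_def)
    moreover have "space coins - E (\<pi>, d) \<subseteq> ?S \<union> ?L"
    proof
      fix \<omega> assume w: "\<omega> \<in> space coins - E (\<pi>, d)"
      show "\<omega> \<in> ?S \<union> ?L"
      proof (cases "solves_perm M B w n (alg \<omega>) \<pi> d")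
        case True
        then have "of_nat t < N (\<pi>, d) \<omega>" using w by (auto simp: E_eq not_le)
        then obtain j where j: "em_config (M * w) (B * w) (alg \<omega>) (perm_disk (B * w) n \<pi> d) j \<noteq> None"
          "of_nat t < (of_nat j :: ennreal)"
          unfolding N_def num_ios_def prod.case less_SUP_iff by blast
        then have "of_nat (t + 1) \<le> (of_nat j :: ennreal)" by (intro of_nat_mono) simp
        also have "\<dots> \<le> N (\<pi>, d) \<omega>" unfolding N_def num_ios_def prod.case using j by (intro SUP_upper) auto
        finally have "ennreal (1 / (real t + 1)) * ennreal (real t + 1) \<le> ennreal (1 / (real t + 1)) * N (\<pi>, d) \<omega>"
          by (intro mult_left_mono) (auto simp: ennreal_of_nat_eq_real_of_nat add.commute)
        also have "ennreal (1 / (real t + 1)) * ennreal (real t + 1) = 1"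
          by (simp add: ennreal_mult[symmetric] del: ennreal_plus)
        finally show ?thesis using w by simp
      qed (use w in auto)
    qed
    then have "measure coins (space coins - E (\<pi>, d)) \<le> measure coins (?S \<union> ?L)"
      using S L by (intro finite_measure_mono) auto
    moreover have "\<dots> \<le> measure coins ?S + measure coins ?L" using S L by (rule measure_Un_le)
    moreover have "measure coins (space coins - E (\<pi>, d)) = 1 - measure coins (E (\<pi>, d))"
      using E_sets by (rule prob_compl)
    ultimately show ?thesis by simp
  qed
  \<comment> \<open>Integrality turns the strict inequality into a gap that does not depend on
    \<open>\<omega>\<close>, so integrating a non-strict inequality already gives the
    contradiction.\<close>
  have lt: "2 * real (card {(\<pi>, d) \<in> I. solves_within M B w n (alg \<omega>) \<pi> d t}) + 1 \<le> real (card I)" for \<omega>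
  proof -
    let ?c = "card {(\<pi>, d) \<in> I. solves_within M B w n (alg \<omega>) \<pi> d t}"
    have "\<not> card I \<le> 2 * ?c" using neg by blast
    then have "2 * ?c + 1 \<le> card I" by linarith
    then have "real (2 * ?c + 1) \<le> real (card I)" by (simp only: of_nat_le_iff)
    then show ?thesis by simp
  qed
  have "real (card I) / 2 = (\<Sum>x\<in>I. 1/2)" by simp
  also have "\<dots> \<le> (\<Sum>x\<in>I. measure coins (E x))" using E_half by (intro sum_mono) auto
  also have "\<dots> = (\<integral>\<omega>. (\<Sum>x\<in>I. indicator (E x) \<omega>) \<partial>coins)"
    using E_sets by (subst Bochner_Integration.integral_sum) (auto simp: emeasure_eq_measure)
  also have "\<dots> \<le> (\<integral>\<omega>. (real (card I) - 1) / 2 \<partial>coins)"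
  proof (rule integral_mono)
    fix \<omega> assume w: "\<omega> \<in> space coins"
    have "(\<Sum>x\<in>I. indicator (E x) \<omega>) = (\<Sum>x\<in>I. of_bool (case x of (\<pi>, d) \<Rightarrow> solves_within M B w n (alg \<omega>) \<pi> d t) :: real)"
      using w by (intro sum.cong) (auto simp: E_def)
    also have "\<dots> = real (card {(\<pi>, d) \<in> I. solves_within M B w n (alg \<omega>) \<pi> d t})"
      using I by (auto simp: Int_def intro!: arg_cong[of _ _ card])
    finally show "(\<Sum>x\<in>I. indicator (E x) \<omega>) \<le> (real (card I) - 1) / 2" using lt[of \<omega>] by simp
  qed (use E_sets in \<open>auto simp: emeasure_eq_measure\<close>)
  finally show False by (simp add: prob_space)
qed

section \<open>Runs and their access patterns\<close>

text \<open>A step sees the disk only through the content \<open>c\<close> of the block that it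
  accesses. Expressed as functions of memory and \<open>c\<close>, steps become local operations of
  a network.\<close>

definition step_mem :: "nat \<Rightarrow> det_algorithm \<Rightarrow> nat \<Rightarrow> bits \<Rightarrow> bits \<Rightarrow> bits" where
  "step_mem b alg j s c = (case alg j s of (s', Read a) \<Rightarrow> c @ drop b s' | (s', _) \<Rightarrow> s')"

definition step_block :: "nat \<Rightarrow> det_algorithm \<Rightarrow> nat \<Rightarrow> bits \<Rightarrow> bits \<Rightarrow> bits" where
  "step_block b alg j s c = (case alg j s of (s', Write a) \<Rightarrow> take b s' | (s', _) \<Rightarrow> c)"

definition step_addr :: "det_algorithm \<Rightarrow> nat \<Rightarrow> bits \<Rightarrow> nat" where
  "step_addr alg j s = (case snd (alg j s) of Read a \<Rightarrow> a | Write a \<Rightarrow> a | Halt \<Rightarrow> 0)"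

definition run_mem where
  "run_mem m b alg D0 j = fst (the (em_config m b alg D0 j))"

definition run_disk where
  "run_disk m b alg D0 j = snd (the (em_config m b alg D0 j))"

definition run_addr where
  "run_addr m b alg D0 j = step_addr alg j (run_mem m b alg D0 j)"

text \<open>A read counts as creating a version too, with unchanged content. Thus every access has
  exactly one version, and an access depends on the version of the previous access to its
  block.\<close>

definition run_block where
  "run_block m b alg D0 j = run_disk m b alg D0 (Suc j) (run_addr m b alg D0 j)"

lemma run_0 [simp]: "run_mem m b alg D0 0 = replicate m False" "run_disk m b alg D0 0 = D0"
  by (simp_all add: run_mem_def run_disk_def)

lemma run_Suc:
  fixes m b alg D0
  defines "s \<equiv> run_mem m b alg D0" and "D \<equiv> run_disk m b alg D0" and "a \<equiv> run_addr m b alg D0"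
  assumes "em_config m b alg D0 (Suc j) \<noteq> None"
  shows "s (Suc j) = step_mem b alg j (s j) (D j (a j))"
    and "D (Suc j) = (D j)(a j := step_block b alg j (s j) (D j (a j)))"
proof -
  obtain s0 D1 where c: "em_config m b alg D0 j = Some (s0, D1)"
    using assms(4) by (cases "em_config m b alg D0 j") auto
  then have sD: "s j = s0" "D j = D1" by (simp_all add: s_def D_def run_mem_def run_disk_def)
  obtain t act where t: "alg j s0 = (t, act)" by fastforce
  have "em_step b alg j (s0, D1) \<noteq> None" using assms(4) c by simp
  then have "act \<noteq> Halt" using t by (auto simp: em_step_def)
  moreover have "s (Suc j) = fst (the (em_step b alg j (s0, D1)))" "D (Suc j) = snd (the (em_step b alg j (s0, D1)))"
    using c by (simp_all add: s_def D_def run_mem_def run_disk_def)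
  moreover have "a j = step_addr alg j s0" using sD by (simp add: a_def run_addr_def s_def)
  ultimately show "s (Suc j) = step_mem b alg j (s j) (D j (a j))"
    "D (Suc j) = (D j)(a j := step_block b alg j (s j) (D j (a j)))"
    unfolding sD using t
    by (cases act; simp add: em_step_def step_mem_def step_block_def step_addr_def)+
qed

lemma run_block_eq:
  assumes "em_config m b alg D0 (Suc j) \<noteq> None"
  shows "run_block m b alg D0 j =
    step_block b alg j (run_mem m b alg D0 j) (run_disk m b alg D0 j (run_addr m b alg D0 j))"
  using run_Suc(2)[OF assms] by (simp add: run_block_def)

lemma config_not_None_mono: "em_config m b alg D0 T \<noteq> None \<Longrightarrow> j \<le> T \<Longrightarrow> em_config m b alg D0 j \<noteq> None"
  by (intro notI) (simp add: em_config_None_mono)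

lemma run_disk_unchanged:
  assumes "em_config m b alg D0 k \<noteq> None" "j \<le> k"
    and "\<And>i. j \<le> i \<Longrightarrow> i < k \<Longrightarrow> run_addr m b alg D0 i \<noteq> a"
  shows "run_disk m b alg D0 k a = run_disk m b alg D0 j a"
  using assms(2,1,3)
proof (induction k rule: dec_induct)
  case (step i)
  have "em_config m b alg D0 i \<noteq> None" using step.prems(1) config_not_None_mono[of m b alg D0 "Suc i" i] by simp
  then have "run_disk m b alg D0 i a = run_disk m b alg D0 j a" using step.IH step.prems(2) by simp
  moreover have "run_addr m b alg D0 i \<noteq> a" using step by simp
  ultimately show ?case using run_Suc(2)[OF step.prems(1)] by simp
qed simp

text \<open>Addresses outside the first \<open>N\<close> blocks are replaced by the time of their first use: a run
  does not depend on the names of the scratch blocks.\<close>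

definition canonical_addr :: "nat \<Rightarrow> (nat \<Rightarrow> nat) \<Rightarrow> nat \<Rightarrow> nat" where
  "canonical_addr N ad j = (if ad j < N then ad j else N + (LEAST i. ad i = ad j))"

lemma canonical_addr_eq_iff: "canonical_addr N ad i = canonical_addr N ad j \<longleftrightarrow> ad i = ad j"
proof -
  define L where "L j = (LEAST i. ad i = ad j)" for j
  have L: "ad (L j) = ad j" for j unfolding L_def by (rule LeastI[of _ j]) simp
  have c: "canonical_addr N ad j = (if ad j < N then ad j else N + L j)" for j
    by (simp add: canonical_addr_def L_def)
  have "ad i = ad j" if "canonical_addr N ad i = canonical_addr N ad j"
  proof (cases "ad i < N \<or> ad j < N")
    case True
    then show ?thesis using that unfolding c by (cases "ad i < N"; cases "ad j < N"; simp)
  next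
    case False
    then have "L i = L j" using that unfolding c by simp
    then show ?thesis using L[of i] L[of j] by simp
  qed
  then show ?thesis by (auto simp: canonical_addr_def)
qed

lemma canonical_addr_less: "j < T \<Longrightarrow> canonical_addr N ad j < N + T"
proof -
  assume "j < T"
  moreover have "(LEAST i. ad i = ad j) \<le> j" by (rule Least_le) simp
  ultimately show ?thesis by (simp add: canonical_addr_def)
qed

lemma canonical_addr_fixed: "canonical_addr N ad j < N \<Longrightarrow> canonical_addr N ad j = ad j"
  by (auto simp: canonical_addr_def split: if_splits)

section \<open>Dependencies between the accesses of a pattern\<close>

definition first_access :: "(nat \<Rightarrow> nat) \<Rightarrow> nat \<Rightarrow> nat \<Rightarrow> bool" where
  "first_access ca T j \<longleftrightarrow> j < T \<and> (\<forall>i<j. ca i \<noteq> ca j)"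

definition prev_access :: "(nat \<Rightarrow> nat) \<Rightarrow> nat \<Rightarrow> nat \<Rightarrow> nat \<Rightarrow> bool" where
  "prev_access ca T i j \<longleftrightarrow> i < j \<and> j < T \<and> ca i = ca j \<and> (\<forall>k. i < k \<and> k < j \<longrightarrow> ca k \<noteq> ca j)"

definition last_access :: "(nat \<Rightarrow> nat) \<Rightarrow> nat \<Rightarrow> nat \<Rightarrow> bool" where
  "last_access ca T j \<longleftrightarrow> j < T \<and> (\<forall>k. j < k \<and> k < T \<longrightarrow> ca k \<noteq> ca j)"

lemma first_or_prev_access:
  assumes "j < T"
  shows "first_access ca T j \<or> (\<exists>i. prev_access ca T i j)"
proof (cases "\<exists>i<j. ca i = ca j")
  case True
  define i where "i = Max {i. i < j \<and> ca i = ca j}"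
  have fin: "finite {i. i < j \<and> ca i = ca j}" by simp
  have "i \<in> {i. i < j \<and> ca i = ca j}" unfolding i_def using True fin by (intro Max_in) auto
  moreover have "k \<le> i" if "k < j" "ca k = ca j" for k unfolding i_def using that fin by (intro Max_ge) auto
  ultimately have "prev_access ca T i j" using assms by (force simp: prev_access_def)
  then show ?thesis by blast
qed (use assms in \<open>auto simp: first_access_def\<close>)

lemma ex_last_access:
  assumes "j < T"
  shows "\<exists>i. last_access ca T i \<and> ca i = ca j"
proof -
  define i where "i = Max {i. i < T \<and> ca i = ca j}"
  have fin: "finite {i. i < T \<and> ca i = ca j}" by simp
  have "i \<in> {i. i < T \<and> ca i = ca j}" unfolding i_def using assms fin by (intro Max_in) auto
  moreover have "k \<le> i" if "k < T" "ca k = ca j" for k unfolding i_def using that fin by (intro Max_ge) auto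
  ultimately show ?thesis unfolding last_access_def by (intro exI[of _ i]) force
qed

definition follows_pattern where
  "follows_pattern m b alg N T ca D0 \<longleftrightarrow> em_config m b alg D0 T \<noteq> None \<and>
     (\<forall>j<T. ca j = canonical_addr N (run_addr m b alg D0) j)"

lemma follows_pattern_prev:
  assumes fp: "follows_pattern m b alg N T ca D0" and pv: "prev_access ca T i j"
  shows "run_disk m b alg D0 j (run_addr m b alg D0 j) = run_block m b alg D0 i"
proof -
  let ?ad = "run_addr m b alg D0"
  have j: "i < j" "j < T" using pv by (auto simp: prev_access_def)
  have ca: "k < T \<Longrightarrow> l < T \<Longrightarrow> ca k = ca l \<longleftrightarrow> ?ad k = ?ad l" for k l
    using fp by (simp add: follows_pattern_def canonical_addr_eq_iff)
  have "?ad i = ?ad j" using pv ca[of i j] j by (simp add: prev_access_def)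
  moreover have "run_disk m b alg D0 j (?ad j) = run_disk m b alg D0 (Suc i) (?ad j)"
  proof (rule run_disk_unchanged)
    show "em_config m b alg D0 j \<noteq> None"
      using fp j config_not_None_mono[of m b alg D0 T j] by (simp add: follows_pattern_def)
    show "?ad k \<noteq> ?ad j" if "Suc i \<le> k" "k < j" for k
      using pv ca[of k j] that j by (auto simp: prev_access_def)
  qed (use j in simp)
  ultimately show ?thesis by (simp add: run_block_def)
qed

lemma follows_pattern_first:
  assumes fp: "follows_pattern m b alg N T ca D0" and fa: "first_access ca T j"
  shows "run_disk m b alg D0 j (run_addr m b alg D0 j) = D0 (run_addr m b alg D0 j)"
proof -
  let ?ad = "run_addr m b alg D0"
  have j: "j < T" using fa by (auto simp: first_access_def)
  have "run_disk m b alg D0 j (?ad j) = run_disk m b alg D0 0 (?ad j)"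
  proof (rule run_disk_unchanged)
    show "em_config m b alg D0 j \<noteq> None"
      using fp j config_not_None_mono[of m b alg D0 T j] by (simp add: follows_pattern_def)
    show "?ad k \<noteq> ?ad j" if "0 \<le> k" "k < j" for k
      using fa fp that j by (auto simp: first_access_def follows_pattern_def canonical_addr_eq_iff)
  qed simp
  then show ?thesis by simp
qed

lemma follows_pattern_last:
  assumes fp: "follows_pattern m b alg N T ca D0" and la: "last_access ca T j" "ca j = a" "a < N"
  shows "run_disk m b alg D0 T a = run_block m b alg D0 j"
proof -
  let ?ad = "run_addr m b alg D0"
  have j: "j < T" using la by (auto simp: last_access_def)
  have a: "?ad j = a" using fp la j canonical_addr_fixed[of N ?ad j] by (simp add: follows_pattern_def)
  have "run_disk m b alg D0 T a = run_disk m b alg D0 (Suc j) a"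
  proof (rule run_disk_unchanged)
    show "em_config m b alg D0 T \<noteq> None" using fp by (simp add: follows_pattern_def)
    show "?ad k \<noteq> a" if "Suc j \<le> k" "k < T" for k
      using la fp that j a by (auto simp: last_access_def follows_pattern_def canonical_addr_eq_iff)
  qed (use j in simp)
  then show ?thesis using a by (simp add: run_block_def)
qed

lemma follows_pattern_untouched:
  assumes fp: "follows_pattern m b alg N T ca D0" and "\<And>j. j < T \<Longrightarrow> ca j \<noteq> a" "a < N"
  shows "run_disk m b alg D0 T a = D0 a"
proof -
  have "run_disk m b alg D0 T a = run_disk m b alg D0 0 a"
  proof (rule run_disk_unchanged)
    show "em_config m b alg D0 T \<noteq> None" using fp by (simp add: follows_pattern_def)
    show "run_addr m b alg D0 k \<noteq> a" if "0 \<le> k" "k < T" for k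
      using assms that unfolding follows_pattern_def canonical_addr_def by metis
  qed simp
  then show ?thesis by simp
qed

text \<open>Inside the phase, equal memories give equal addresses. The block accessed is then an
  input block or an initially common block on its first access, a version from before the phase, or
  a version made in the phase; the hypotheses cover the first two cases and the induction the last.
  Hence a phase is a function of what enters it.\<close>

lemma phase_determined:
  assumes fp: "follows_pattern m b alg N T ca D0" "follows_pattern m b alg N T ca D1"
    and mem: "run_mem m b alg D0 lo = run_mem m b alg D1 lo"
    and prev: "\<And>i j. prev_access ca T i j \<Longrightarrow> lo \<le> j \<Longrightarrow> j < hi \<Longrightarrow> i < lo \<Longrightarrow>
        run_block m b alg D0 i = run_block m b alg D1 i"
    and first: "\<And>j. first_access ca T j \<Longrightarrow> lo \<le> j \<Longrightarrow> j < hi \<Longrightarrow> ca j < A \<Longrightarrow> D0 (ca j) = D1 (ca j)"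
    and zero: "\<And>a. A \<le> a \<Longrightarrow> D0 a = D1 a" and A: "A \<le> N"
    and j: "lo \<le> j" "j \<le> hi" "j \<le> T"
  shows "run_mem m b alg D0 j = run_mem m b alg D1 j \<and>
     (\<forall>i. lo \<le> i \<and> i < j \<longrightarrow> run_block m b alg D0 i = run_block m b alg D1 i)"
  using j
proof (induction j rule: dec_induct)
  case base
  then show ?case using mem by (simp add: not_less[symmetric])
next
  case (step j)
  have j: "j < T" "j < hi" using step by auto
  have memj: "run_mem m b alg D0 j = run_mem m b alg D1 j" using step by simp
  have ad: "run_addr m b alg D0 j = run_addr m b alg D1 j" using memj by (simp add: run_addr_def)
  have cfg: "em_config m b alg D0 (Suc j) \<noteq> None" "em_config m b alg D1 (Suc j) \<noteq> None"
    using fp j config_not_None_mono[of m b alg _ T "Suc j"] by (simp_all add: follows_pattern_def)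
  have blk: "run_disk m b alg D0 j (run_addr m b alg D0 j) = run_disk m b alg D1 j (run_addr m b alg D1 j)"
  proof (cases "first_access ca T j")
    case True
    have "D0 (run_addr m b alg D0 j) = D1 (run_addr m b alg D0 j)"
    proof (cases "ca j < A")
      case True
      moreover have "run_addr m b alg D0 j = ca j"
        using True A fp(1) j canonical_addr_fixed[of N "run_addr m b alg D0" j] by (simp add: follows_pattern_def)
      ultimately show ?thesis using first[OF \<open>first_access ca T j\<close>] step j by simp
    next
      \<comment> \<open>An address differs from its canonical name only if it is at least
        \<open>N\<close>, and hence at least \<open>A\<close>.\<close>
      case False
      then have "A \<le> run_addr m b alg D0 j"
        using fp(1) j A by (auto simp: follows_pattern_def canonical_addr_def split: if_splits)
      then show ?thesis by (rule zero)
    qed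
    then show ?thesis
      using follows_pattern_first[OF fp(1) True] follows_pattern_first[OF fp(2) True] ad by simp
  next
    case False
    then obtain i where i: "prev_access ca T i j" using first_or_prev_access[OF j(1)] by blast
    have "run_block m b alg D0 i = run_block m b alg D1 i"
    proof (cases "i < lo")
      case True
      then show ?thesis using prev[OF i] step j by simp
    next
      case False
      moreover have "i < j" using i by (simp add: prev_access_def)
      ultimately show ?thesis using step by simp
    qed
    then show ?thesis using follows_pattern_prev[OF fp(1) i] follows_pattern_prev[OF fp(2) i] by simp
  qed
  have "run_mem m b alg D0 (Suc j) = run_mem m b alg D1 (Suc j)"
    using run_Suc(1)[OF cfg(1)] run_Suc(1)[OF cfg(2)] memj blk by simp
  moreover have "run_block m b alg D0 j = run_block m b alg D1 j"
    using run_block_eq[OF cfg(1)] run_block_eq[OF cfg(2)] memj blk by simp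
  ultimately show ?case using step by (auto simp: less_Suc_eq)
qed

lemma run_lengths:
  assumes "\<And>j s. length s = m \<Longrightarrow> length (fst (alg j s)) = m" "b \<le> m" "\<And>a. length (D0 a) = b"
    and "em_config m b alg D0 j \<noteq> None"
  shows "length (run_mem m b alg D0 j) = m" "length (run_disk m b alg D0 j a) = b"
proof -
  obtain s D where "em_config m b alg D0 j = Some (s, D)" using assms(4) by auto
  with em_config_reachable[of m alg b D0 j s D] assms(1-3)
  show "length (run_mem m b alg D0 j) = m" "length (run_disk m b alg D0 j a) = b"
    by (auto simp: run_mem_def run_disk_def)
qed

lemma card_changed_blocks_le:
  assumes "em_config m b alg D0 T \<noteq> None"
  shows "finite {a. run_disk m b alg D0 T a \<noteq> D0 a} \<and> card {a. run_disk m b alg D0 T a \<noteq> D0 a} \<le> T"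
proof -
  have sub: "{a. run_disk m b alg D0 T a \<noteq> D0 a} \<subseteq> run_addr m b alg D0 ` {..<T}"
  proof
    fix a assume a: "a \<in> {a. run_disk m b alg D0 T a \<noteq> D0 a}"
    show "a \<in> run_addr m b alg D0 ` {..<T}"
    proof (rule ccontr)
      assume "a \<notin> run_addr m b alg D0 ` {..<T}"
      then have "run_disk m b alg D0 T a = run_disk m b alg D0 0 a"
        using assms by (intro run_disk_unchanged) auto
      then show False using a by simp
    qed
  qed
  moreover have "card (run_addr m b alg D0 ` {..<T}) \<le> T" using card_image_le[of "{..<T}" "run_addr m b alg D0"] by simp
  ultimately show ?thesis
    using finite_subset[OF sub] card_mono[OF _ sub] by (meson finite_imageI finite_lessThan order_trans)
qed

section \<open>Consequences of the conjecture\<close>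

text \<open>Edge and decoding functions exist as soon as each message is constant on the source
  assignments with the same view at the vertex. They are obtained by picking any assignment with the
  given view, which spares the explicit construction of codes later.\<close>

lemma nc_achievesI:
  assumes S: "S = PiE {..<pairs I} Al"
    and Al: "\<And>i. i < pairs I \<Longrightarrow> finite (Al i) \<and> Al i \<noteq> {} \<and> r \<le> entropy2 S (\<lambda>x. x i)"
    and cap: "\<And>e. e \<in> edges I \<Longrightarrow> entropy2 S (\<lambda>x. msg x e) \<le> capacity I e"
    and edge: "\<And>e x y. e \<in> edges I \<Longrightarrow> x \<in> S \<Longrightarrow> y \<in> S \<Longrightarrow> (\<And>i. i < pairs I \<Longrightarrow> source I i = fst e \<Longrightarrow> x i = y i) \<Longrightarrow>
       (\<And>e'. e' \<in> edges I \<Longrightarrow> snd e' = fst e \<Longrightarrow> msg x e' = msg y e') \<Longrightarrow> msg x e = msg y e"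
    and dec: "\<And>i x y. i < pairs I \<Longrightarrow> x \<in> S \<Longrightarrow> y \<in> S \<Longrightarrow> (\<And>j. j < pairs I \<Longrightarrow> source I j = sink I i \<Longrightarrow> x j = y j) \<Longrightarrow>
       (\<And>e. e \<in> edges I \<Longrightarrow> snd e = sink I i \<Longrightarrow> msg x e = msg y e) \<Longrightarrow> x i = y i"
  shows "nc_achieves I r"
proof -
  define view where "view v x = (restrict x (sources_at I v), restrict (msg x) (in_edges I v))" for v x
  define pick where "pick v a g = (SOME x. x \<in> S \<and> view v x = (a, g))" for v a g
  have pick: "pick v (fst (view v x)) (snd (view v x)) \<in> S \<and>
       view v (pick v (fst (view v x)) (snd (view v x))) = view v x" if "x \<in> S" for v x
    unfolding pick_def by (rule someI2[of _ x]) (use that in auto)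
  have viewD: "(\<forall>i<pairs I. source I i = v \<longrightarrow> x i = y i) \<and> (\<forall>e\<in>edges I. snd e = v \<longrightarrow> msg x e = msg y e)"
    if eq: "view v x = view v y" for v x y
  proof (intro conjI allI impI ballI)
    fix i assume "i < pairs I" "source I i = v"
    moreover have "restrict x (sources_at I v) i = restrict y (sources_at I v) i"
      using eq by (simp add: view_def)
    ultimately show "x i = y i" by (simp add: sources_at_def)
  next
    fix e assume "e \<in> edges I" "snd e = v"
    moreover have "restrict (msg x) (in_edges I v) e = restrict (msg y) (in_edges I v) e"
      using eq by (simp add: view_def)
    ultimately show "msg x e = msg y e" by (simp add: in_edges_def)
  qed
  define N where "N = \<lparr>source_alphabet = Al, edge_alphabet = (\<lambda>_. UNIV),
     edge_fun = (\<lambda>e a g. msg (pick (fst e) a g) e), decode_fun = (\<lambda>i a g. pick (sink I i) a g i)\<rparr>"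
  have S_eq: "source_messages I N = S" by (simp add: source_messages_def N_def S)
  have "nc_solution I N msg"
    unfolding nc_solution_def S_eq
  proof (intro conjI allI impI ballI)
    fix x e assume x: "x \<in> S" and e: "e \<in> edges I"
    define y where "y = pick (fst e) (fst (view (fst e) x)) (snd (view (fst e) x))"
    have y: "y \<in> S" "view (fst e) y = view (fst e) x" using pick[OF x] unfolding y_def by blast+
    have "msg y e = msg x e"
      by (rule edge[OF e y(1) x]) (use viewD[OF y(2)] in blast)+
    then show "msg x e = edge_fun N e (restrict x (sources_at I (fst e))) (restrict (msg x) (in_edges I (fst e)))"
      by (simp add: N_def view_def y_def)
  next
    fix x i assume x: "x \<in> S" and i: "i < pairs I"
    define y where "y = pick (sink I i) (fst (view (sink I i) x)) (snd (view (sink I i) x))"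
    have y: "y \<in> S" "view (sink I i) y = view (sink I i) x" using pick[OF x] unfolding y_def by blast+
    have "y i = x i"
      by (rule dec[OF i y(1) x]) (use viewD[OF y(2)] in blast)+
    then show "decode_fun N i (restrict x (sources_at I (sink I i))) (restrict (msg x) (in_edges I (sink I i))) = x i"
      by (simp add: N_def view_def y_def)
  qed (use Al in \<open>auto simp: N_def\<close>)
  then show ?thesis unfolding nc_achieves_def using Al cap S_eq by (intro exI[of _ N] exI[of _ msg]) auto
qed

text \<open>Weak duality: summing flow conservation against the potential \<open>D\<close> shows
  that the unit of flow climbs from the source to the sink, while along an edge, in either
  direction, it climbs by at most the weight.\<close>

lemma flow_cost_ge_potential_difference:
  fixes D :: "nat \<Rightarrow> real"
  assumes wf: "kpairs_wf I" and f: "multicommodity_flow I f" and i: "i < pairs I"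
    and D: "\<And>u v. (u, v) \<in> edges I \<Longrightarrow> \<bar>D u - D v\<bar> \<le> wt (u, v)"
  shows "D (sink I i) - D (source I i) \<le> (\<Sum>(u, v)\<in>edges I. wt (u, v) * (f i u v + f i v u))"
proof -
  let ?V = "verts I" and ?E = "edges I"
  have finV: "finite ?V" and EV: "?E \<subseteq> ?V \<times> ?V" and st: "source I i \<in> ?V" "sink I i \<in> ?V"
    using wf i by (auto simp: kpairs_wf_def)
  have finE: "finite ?E" using finV EV finite_subset by blast
  have f0: "\<And>u v. f i u v \<ge> 0" and fE: "\<And>u v. (u, v) \<notin> ?E \<Longrightarrow> (v, u) \<notin> ?E \<Longrightarrow> f i u v = 0"
    and cons: "\<And>u. u \<in> ?V \<Longrightarrow> (\<Sum>v\<in>?V. f i u v) - (\<Sum>v\<in>?V. f i v u) = of_bool (u = source I i) - of_bool (u = sink I i)"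
    using f i by (auto simp: multicommodity_flow_def)
  have "D (source I i) - D (sink I i) = (\<Sum>u\<in>?V. D u * (of_bool (u = source I i) - of_bool (u = sink I i)))"
    using st finV by (simp add: right_diff_distrib sum_subtractf)
  also have "\<dots> = (\<Sum>u\<in>?V. D u * ((\<Sum>v\<in>?V. f i u v) - (\<Sum>v\<in>?V. f i v u)))"
    using cons by (intro sum.cong) auto
  also have "\<dots> = (\<Sum>u\<in>?V. \<Sum>v\<in>?V. D u * f i u v) - (\<Sum>u\<in>?V. \<Sum>v\<in>?V. D u * f i v u)"
    by (simp add: right_diff_distrib sum_subtractf sum_distrib_left)
  also have "(\<Sum>u\<in>?V. \<Sum>v\<in>?V. D u * f i v u) = (\<Sum>u\<in>?V. \<Sum>v\<in>?V. D v * f i u v)"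
    by (rule sum.swap)
  finally have "D (sink I i) - D (source I i) = (\<Sum>u\<in>?V. \<Sum>v\<in>?V. (D v - D u) * f i u v)"
    by (simp add: left_diff_distrib sum_subtractf)
  also have "\<dots> = (\<Sum>(u, v)\<in>?V \<times> ?V. (D v - D u) * f i u v)" by (simp add: sum.cartesian_product)
  also have "\<dots> = (\<Sum>(u, v)\<in>?E \<union> ?E\<inverse>. (D v - D u) * f i u v)"
  proof (rule sum.mono_neutral_right)
    show "\<forall>p\<in>?V \<times> ?V - (?E \<union> ?E\<inverse>). (case p of (u, v) \<Rightarrow> (D v - D u) * f i u v) = 0"
      using fE by fastforce
  qed (use finV EV in auto)
  also have "\<dots> \<le> (\<Sum>(u, v)\<in>?E \<union> ?E\<inverse>. \<bar>D u - D v\<bar> * f i u v)"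
    using f0 by (intro sum_mono) (auto intro!: mult_right_mono)
  also have "\<dots> \<le> (\<Sum>(u, v)\<in>?E. \<bar>D u - D v\<bar> * f i u v) + (\<Sum>(u, v)\<in>?E\<inverse>. \<bar>D u - D v\<bar> * f i u v)"
  proof -
    have "0 \<le> (\<Sum>(u, v)\<in>?E \<inter> ?E\<inverse>. \<bar>D u - D v\<bar> * f i u v)" using f0 by (intro sum_nonneg) auto
    then show ?thesis using finE by (simp add: sum_Un)
  qed
  also have "(\<Sum>(u, v)\<in>?E\<inverse>. \<bar>D u - D v\<bar> * f i u v) = (\<Sum>(u, v)\<in>?E. \<bar>D u - D v\<bar> * f i v u)"
    by (rule sum.reindex_bij_witness[of _ "\<lambda>(u, v). (v, u)" "\<lambda>(u, v). (v, u)"]) (auto simp: abs_minus_commute)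
  also have "(\<Sum>(u, v)\<in>?E. \<bar>D u - D v\<bar> * f i u v) + (\<Sum>(u, v)\<in>?E. \<bar>D u - D v\<bar> * f i v u)
     = (\<Sum>(u, v)\<in>?E. \<bar>D u - D v\<bar> * (f i u v + f i v u))"
    by (simp add: sum.distrib[symmetric] case_prod_beta distrib_left)
  also have "\<dots> \<le> (\<Sum>(u, v)\<in>?E. wt (u, v) * (f i u v + f i v u))"
    using D f0 by (intro sum_mono) (auto intro!: mult_right_mono)
  finally show ?thesis .
qed

text \<open>The dual form in which the conjecture is used. Each pair in \<open>J\<close> needs flow
  of weighted length at least \<open>len\<close>, and at rate \<open>r\<close> the capacities bound
  the weighted total.\<close>

lemma kpairs_weighted_capacity_bound:
  assumes conj: "undirected_k_pairs_conjecture" and wf: "kpairs_wf I" and nc: "nc_achieves I \<rho>" and \<rho>: "0 \<le> \<rho>"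
    and J: "J \<subseteq> {..<pairs I}" and wt: "\<And>e. e \<in> edges I \<Longrightarrow> 0 \<le> wt e"
    and D: "\<And>i u v. i \<in> J \<Longrightarrow> (u, v) \<in> edges I \<Longrightarrow> \<bar>D i u - D i v :: real\<bar> \<le> wt (u, v)"
    and len: "\<And>i. i \<in> J \<Longrightarrow> len \<le> D i (sink I i) - D i (source I i)" and len0: "0 \<le> len"
  shows "real (card J) * len * \<rho> \<le> (\<Sum>e\<in>edges I. wt e * capacity I e)"
proof (rule ccontr)
  let ?C = "\<Sum>e\<in>edges I. wt e * capacity I e"
  assume "\<not> ?thesis"
  then have lt: "?C < real (card J) * len * \<rho>" by simp
  have C0: "0 \<le> ?C" using wf wt by (intro sum_nonneg mult_nonneg_nonneg) (auto simp: kpairs_wf_def less_imp_le)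
  then have pos: "real (card J) * len > 0"
  proof -
    have "real (card J) * len \<noteq> 0" using lt C0 by (intro notI) simp
    moreover have "real (card J) * len \<ge> 0" using len0 by simp
    ultimately show ?thesis by linarith
  qed
  \<comment> \<open>The rate at which the claim would be tight. The flow rate is a supremum that may
    not be attained, so a flow is obtained at some rate strictly above \<open>r'\<close>, and the
    dual bound then gives \<open>r \<le> r'\<close>.\<close>
  define r' where "r' = ?C / (real (card J) * len)"
  have r': "0 \<le> r'" "r' < \<rho>" using lt pos C0 by (auto simp: r'_def field_simps)
  have "ennreal \<rho> \<le> nc_rate I" unfolding nc_rate_def using nc \<rho> by (intro SUP_upper) auto
  also have "\<dots> \<le> flow_rate I" using conj wf by (simp add: undirected_k_pairs_conjecture_def)
  finally have "ennreal r' < flow_rate I" using r' by (meson ennreal_less_iff order_less_le_trans)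
  then obtain r where r: "0 \<le> r" "flow_achieves I r" "r' < r"
    unfolding flow_rate_def less_SUP_iff using r' by (auto simp: ennreal_less_iff)
  then obtain f where f: "multicommodity_flow I f"
    and le: "\<And>u v. (u, v) \<in> edges I \<Longrightarrow> r * (\<Sum>i<pairs I. f i u v + f i v u) \<le> capacity I (u, v)"
    by (auto simp: flow_achieves_def)
  have "real (card J) * len = (\<Sum>i\<in>J. len)" by simp
  also have "\<dots> \<le> (\<Sum>i\<in>J. \<Sum>(u, v)\<in>edges I. wt (u, v) * (f i u v + f i v u))"
  proof (rule sum_mono)
    fix i assume i: "i \<in> J"
    have "len \<le> D i (sink I i) - D i (source I i)" by (rule len[OF i])
    also have "\<dots> \<le> (\<Sum>(u, v)\<in>edges I. wt (u, v) * (f i u v + f i v u))"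
      using i J by (intro flow_cost_ge_potential_difference[OF wf f] D[OF i]) auto
    finally show "len \<le> (\<Sum>(u, v)\<in>edges I. wt (u, v) * (f i u v + f i v u))" .
  qed
  also have "\<dots> \<le> (\<Sum>i<pairs I. \<Sum>(u, v)\<in>edges I. wt (u, v) * (f i u v + f i v u))"
    using J wt f by (intro sum_mono2 sum_nonneg) (auto simp: multicommodity_flow_def intro!: mult_nonneg_nonneg)
  also have "\<dots> = (\<Sum>(u, v)\<in>edges I. wt (u, v) * (\<Sum>i<pairs I. f i u v + f i v u))"
    by (subst sum.swap) (simp add: case_prod_beta sum_distrib_left)
  finally have "r * (real (card J) * len) \<le> r * (\<Sum>(u, v)\<in>edges I. wt (u, v) * (\<Sum>i<pairs I. f i u v + f i v u))"
    using r by (intro mult_left_mono)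
  also have "\<dots> = (\<Sum>(u, v)\<in>edges I. wt (u, v) * (r * (\<Sum>i<pairs I. f i u v + f i v u)))"
    by (simp add: sum_distrib_left case_prod_beta mult_ac)
  also have "\<dots> \<le> ?C" using le wt by (intro sum_mono) (auto intro!: mult_left_mono)
  finally have "r \<le> r'" using pos by (simp add: r'_def field_simps)
  then show False using r by simp
qed

text \<open>Transfers the bound to graphs on any countable vertex type by encoding vertices with
  \<open>to_nat\<close>, so that the network below can use a datatype of nodes.\<close>

theorem kpairs_weighted_capacity_bound_graph:
  fixes E :: "('v::countable \<times> 'v) set" and cap wt :: "'v \<times> 'v \<Rightarrow> real" and msg :: "(nat \<Rightarrow> nat) \<Rightarrow> 'v \<times> 'v \<Rightarrow> nat"
  assumes conj: "undirected_k_pairs_conjecture" and E: "finite E" "acyclic E"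
    and cap: "\<And>e. e \<in> E \<Longrightarrow> 0 < cap e"
    and S: "S = PiE {..<k} Al"
    and Al: "\<And>i. i < k \<Longrightarrow> finite (Al i) \<and> Al i \<noteq> {} \<and> \<rho> \<le> entropy2 S (\<lambda>x. x i)"
    and ent: "\<And>e. e \<in> E \<Longrightarrow> entropy2 S (\<lambda>x. msg x e) \<le> cap e"
    and edge: "\<And>e x y. e \<in> E \<Longrightarrow> x \<in> S \<Longrightarrow> y \<in> S \<Longrightarrow> (\<And>i. i < k \<Longrightarrow> src i = fst e \<Longrightarrow> x i = y i) \<Longrightarrow>
       (\<And>e'. e' \<in> E \<Longrightarrow> snd e' = fst e \<Longrightarrow> msg x e' = msg y e') \<Longrightarrow> msg x e = msg y e"
    and dec: "\<And>i x y. i < k \<Longrightarrow> x \<in> S \<Longrightarrow> y \<in> S \<Longrightarrow> (\<And>j. j < k \<Longrightarrow> src j = snk i \<Longrightarrow> x j = y j) \<Longrightarrow>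
       (\<And>e. e \<in> E \<Longrightarrow> snd e = snk i \<Longrightarrow> msg x e = msg y e) \<Longrightarrow> x i = y i"
    and \<rho>: "0 \<le> \<rho>"
    and J: "J \<subseteq> {..<k}" and wt: "\<And>e. e \<in> E \<Longrightarrow> 0 \<le> wt e"
    and D: "\<And>i u v. i \<in> J \<Longrightarrow> (u, v) \<in> E \<Longrightarrow> \<bar>D i u - D i v :: real\<bar> \<le> wt (u, v)"
    and len: "\<And>i. i \<in> J \<Longrightarrow> len \<le> D i (snk i) - D i (src i)" and len0: "0 \<le> len"
  shows "real (card J) * len * \<rho> \<le> (\<Sum>e\<in>E. wt e * cap e)"
proof -
  define enc where "enc = map_prod (to_nat :: 'v \<Rightarrow> nat) (to_nat :: 'v \<Rightarrow> nat)"
  define decp where "decp = map_prod (from_nat :: nat \<Rightarrow> 'v) (from_nat :: nat \<Rightarrow> 'v)"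
  have decp_enc [simp]: "decp (enc e) = e" for e by (cases e) (simp add: enc_def decp_def)
  have inj: "inj_on enc A" for A by (rule inj_on_inverseI[where g = decp]) simp
  define V where "V = fst ` E \<union> snd ` E \<union> src ` {..<k} \<union> snk ` {..<k}"
  define I where "I = \<lparr>verts = to_nat ` V, edges = enc ` E, capacity = (\<lambda>e. cap (decp e)), pairs = k,
     source = (\<lambda>i. to_nat (src i)), sink = (\<lambda>i. to_nat (snk i))\<rparr>"
  have acyc: "acyclic (enc ` E)"
    unfolding enc_def by (rule wf_acyclic[OF wf_map_prod_image[OF finite_acyclic_wf[OF E]]]) simp
  have EV: "enc e \<in> to_nat ` V \<times> to_nat ` V" if "e \<in> E" for e
  proof -
    have "fst e \<in> V" "snd e \<in> V" using that unfolding V_def by blast+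
    then show ?thesis by (cases e) (simp add: enc_def)
  qed
  have finV: "finite V" using E(1) by (simp add: V_def)
  have stV: "src i \<in> V \<and> snk i \<in> V" if "i < k" for i using that by (simp add: V_def)
  have sel: "verts I = to_nat ` V" "edges I = enc ` E" "capacity I (enc e) = cap e" "pairs I = k"
    "source I i = to_nat (src i)" "sink I i = to_nat (snk i)" for e i
    by (simp_all add: I_def)
  have wf: "kpairs_wf I"
    unfolding kpairs_wf_def sel
  proof (intro conjI)
    show "finite (to_nat ` V)" using finV by (rule finite_imageI)
    show "enc ` E \<subseteq> to_nat ` V \<times> to_nat ` V" using EV by blast
    show "acyclic (enc ` E)" by (rule acyc)
    show "\<forall>e\<in>enc ` E. 0 < capacity I e" using cap sel(3) by auto
    show "\<forall>i<k. to_nat (src i) \<in> to_nat ` V \<and> to_nat (snk i) \<in> to_nat ` V" using stV by blast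
  qed
  have "nc_achieves I \<rho>"
  proof (rule nc_achievesI[where S = S and Al = Al and msg = "\<lambda>x e. msg x (decp e)"])
    show "S = PiE {..<pairs I} Al" by (simp add: S I_def)
    show "finite (Al i) \<and> Al i \<noteq> {} \<and> \<rho> \<le> entropy2 S (\<lambda>x. x i)" if "i < pairs I" for i
      using Al that by (simp add: I_def)
    show "entropy2 S (\<lambda>x. msg x (decp e)) \<le> capacity I e" if "e \<in> edges I" for e
      using ent that by (auto simp: I_def)
  next
    fix e x y assume a: "e \<in> edges I" "x \<in> S" "y \<in> S" "\<And>i. i < pairs I \<Longrightarrow> source I i = fst e \<Longrightarrow> x i = y i"
      "\<And>e'. e' \<in> edges I \<Longrightarrow> snd e' = fst e \<Longrightarrow> msg x (decp e') = msg y (decp e')"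
    obtain e0 where e0: "e0 \<in> E" "e = enc e0" using a(1) by (auto simp: I_def)
    have "msg x e0 = msg y e0"
    proof (rule edge[OF e0(1) a(2,3)])
      show "x i = y i" if "i < k" "src i = fst e0" for i using a(4)[of i] that e0 by (simp add: I_def enc_def)
      show "msg x e' = msg y e'" if "e' \<in> E" "snd e' = fst e0" for e'
        using a(5)[of "enc e'"] that e0 by (simp add: I_def) (simp add: enc_def)
    qed
    then show "msg x (decp e) = msg y (decp e)" using e0 by simp
  next
    fix i x y assume a: "i < pairs I" "x \<in> S" "y \<in> S" "\<And>j. j < pairs I \<Longrightarrow> source I j = sink I i \<Longrightarrow> x j = y j"
      "\<And>e'. e' \<in> edges I \<Longrightarrow> snd e' = sink I i \<Longrightarrow> msg x (decp e') = msg y (decp e')"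
    show "x i = y i"
    proof (rule dec[OF _ a(2,3)])
      show "i < k" using a(1) by (simp add: I_def)
      show "x j = y j" if "j < k" "src j = snk i" for j using a(4)[of j] that by (simp add: I_def)
      show "msg x e' = msg y e'" if "e' \<in> E" "snd e' = snk i" for e'
        using a(5)[of "enc e'"] that by (simp add: I_def) (simp add: enc_def)
    qed
  qed
  then have "real (card J) * len * \<rho> \<le> (\<Sum>e\<in>edges I. wt (decp e) * capacity I e)"
    using J wt D len len0 \<rho>
    by (intro kpairs_weighted_capacity_bound[OF conj wf, where D = "\<lambda>i u. D i (from_nat u)"])
      (auto simp: I_def decp_def enc_def)
  also have "\<dots> = (\<Sum>e\<in>E. wt e * cap e)"
    by (simp add: I_def sum.reindex[OF inj])
  finally show ?thesis .
qed

section \<open>The network of an access pattern\<close>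

primrec nball :: "('v \<Rightarrow> 'v set) \<Rightarrow> 'v \<Rightarrow> nat \<Rightarrow> 'v set" where
  "nball nb s 0 = {s}"
| "nball nb s (Suc k) = nball nb s k \<union> (\<Union>v\<in>nball nb s k. nb v)"

lemma nball_mono: "k \<le> l \<Longrightarrow> nball nb s k \<subseteq> nball nb s l"
  by (induction l) (auto simp: le_Suc_eq)

lemma card_nball_le:
  assumes "\<And>v. finite (nb v) \<and> card (nb v) \<le> c"
  shows "finite (nball nb s k) \<and> card (nball nb s k) \<le> (c + 1) ^ k"
proof (induction k)
  case (Suc k)
  then have fin: "finite (nball nb s k)" by simp
  have "card (\<Union>v\<in>nball nb s k. nb v) \<le> (\<Sum>v\<in>nball nb s k. card (nb v))"
    by (rule card_UN_le[OF fin])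
  also have "\<dots> \<le> (\<Sum>v\<in>nball nb s k. c)" using assms by (intro sum_mono) auto
  finally have "card (\<Union>v\<in>nball nb s k. nb v) \<le> card (nball nb s k) * c" by simp
  then have "card (nball nb s (Suc k)) \<le> card (nball nb s k) + card (nball nb s k) * c"
    using card_Un_le[of "nball nb s k" "\<Union>v\<in>nball nb s k. nb v"] by simp
  also have "\<dots> = (c + 1) * card (nball nb s k)" by (simp add: algebra_simps)
  also have "\<dots> \<le> (c + 1) * (c + 1) ^ k" using Suc by (intro mult_left_mono) auto
  finally show ?case using fin assms by simp
qed simp

text \<open>Cutting off at \<open>l\<close> gives unreachable nodes a value and keeps the function
  1-Lipschitz along neighbours. It also confines potentials to values from 0 to \<open>l\<close>, on
  which the position \<open>l / 2\<close> of the hub relies.\<close>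

definition trunc_dist :: "('v \<Rightarrow> 'v set) \<Rightarrow> nat \<Rightarrow> 'v \<Rightarrow> 'v \<Rightarrow> nat" where
  "trunc_dist nb l s v = (if v \<in> nball nb s l then LEAST k. v \<in> nball nb s k else l)"

lemma trunc_dist_le: "trunc_dist nb l s v \<le> l"
  by (auto simp: trunc_dist_def intro: Least_le)

lemma trunc_dist_self: "trunc_dist nb l s s = 0"
  using nball_mono[of 0 l nb s] by (auto simp: trunc_dist_def intro: Least_eq_0)

lemma trunc_dist_far: "v \<notin> nball nb s l \<Longrightarrow> trunc_dist nb l s v = l"
  by (simp add: trunc_dist_def)

lemma trunc_dist_step:
  assumes "v \<in> nb u"
  shows "trunc_dist nb l s v \<le> trunc_dist nb l s u + 1"
proof (cases "u \<in> nball nb s l")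
  case True
  define k where "k = (LEAST k. u \<in> nball nb s k)"
  have k: "u \<in> nball nb s k" unfolding k_def using True by (rule LeastI)
  have td: "trunc_dist nb l s u = k" using True by (simp add: trunc_dist_def k_def)
  have v: "v \<in> nball nb s (Suc k)" using k assms by auto
  show ?thesis
  proof (cases "Suc k \<le> l")
    case True
    have "v \<in> nball nb s l" using v nball_mono[OF True, of nb s] by (rule_tac subsetD)
    moreover have "(LEAST k. v \<in> nball nb s k) \<le> Suc k" using v by (rule Least_le)
    ultimately show ?thesis using td by (simp add: trunc_dist_def)
  next
    case False
    then show ?thesis using trunc_dist_le[of nb l s v] td by simp
  qed
next
  case False
  then have "trunc_dist nb l s u = l" by (rule trunc_dist_far)
  then show ?thesis using trunc_dist_le[of nb l s v] by linarith
qed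

datatype node = Src nat | Hub | Wrd nat | Snk nat | Inp nat | Grp nat | Ver nat

instance node :: countable
  by countable_datatype

lemma first_access_unique: "first_access ca T i \<Longrightarrow> first_access ca T j \<Longrightarrow> ca i = ca j \<Longrightarrow> i = j"
  unfolding first_access_def by (metis linorder_neqE_nat)

lemma last_access_unique: "last_access ca T i \<Longrightarrow> last_access ca T j \<Longrightarrow> ca i = ca j \<Longrightarrow> i = j"
  unfolding last_access_def by (metis linorder_neqE_nat)

lemma prev_access_unique1: "prev_access ca T i j \<Longrightarrow> prev_access ca T i' j \<Longrightarrow> i = i'"
  unfolding prev_access_def by (metis linorder_neqE_nat)

lemma prev_access_unique2: "prev_access ca T i j \<Longrightarrow> prev_access ca T i j' \<Longrightarrow> j = j'"
  unfolding prev_access_def by (metis linorder_neqE_nat)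

text \<open>Adjacent input blocks are regarded as neighbours although the network has no edge between them: this
  bounds the potential difference along the edges from a word to the blocks that it meets.\<close>

definition core_nbrs where
  "core_nbrs p T ca v = (case v of
     Inp a \<Rightarrow> {Inp (a + 1), Inp (a - 1)} \<union> {Grp (j div p) | j. first_access ca T j \<and> ca j = a}
   | Grp g \<Rightarrow> {Grp (g + 1), Grp (g - 1)} \<union> {Ver j | j. j div p = g} \<union>
       {Inp (ca j) | j. first_access ca T j \<and> j div p = g} \<union> {Ver i | i j. prev_access ca T i j \<and> j div p = g}
   | Ver i \<Rightarrow> {Grp (i div p)} \<union> {Grp (j div p) | j. prev_access ca T i j}
   | _ \<Rightarrow> {})"

lemma card_le_one_witness:
  assumes "\<And>x y. x \<in> S \<Longrightarrow> y \<in> S \<Longrightarrow> x = y"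
  shows "finite S \<and> card S \<le> 1"
proof (cases "S = {}")
  case False
  then obtain x where "S = {x}" using assms by blast
  then show ?thesis by simp
qed simp

text \<open>The worst case is a phase: two adjacent phases, and for each of its \<open>p\<close>
  accesses one version, at most one input block and at most one earlier version, so
  \<open>2 + 3 * p\<close> in all. The hub and the other outer nodes have no neighbours here; a hub
  adjacent to everything would destroy all distances.\<close>

lemma card_core_nbrs_le:
  assumes p: "p \<ge> 1"
  shows "finite (core_nbrs p T ca v) \<and> card (core_nbrs p T ca v) \<le> 5 * p"
proof -
  have two: "card {x, y} \<le> 2" for x y :: node by (simp add: card_insert_if)
  show ?thesis
  proof (cases v)
    case (Inp a)
    let ?S = "{Grp (j div p) | j. first_access ca T j \<and> ca j = a}"
    have S: "finite ?S \<and> card ?S \<le> 1" by (rule card_le_one_witness) (use first_access_unique in blast)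
    have "card ({Inp (a + 1), Inp (a - 1)} \<union> ?S) \<le> 2 + 1"
      by (rule order_trans[OF card_Un_le]) (intro add_mono two, use S in simp)
    then show ?thesis using S Inp p by (simp add: core_nbrs_def)
  next
    case (Grp g)
    define P where "P = {j. j div p = g}"
    have P_eq: "P = {g * p..<g * p + p}"
      using p by (auto simp: P_def div_nat_eqI mult.commute intro: div_times_less_eq_dividend dividend_less_div_times)
        (metis div_mult_mod_eq less_eq_Suc_le mod_less_divisor nat_add_left_cancel_less mult.commute)
    have P: "finite P" "card P = p" by (simp_all add: P_eq)
    let ?S1 = "{Ver j | j. j div p = g}" and ?S2 = "{Inp (ca j) | j. first_access ca T j \<and> j div p = g}"
      and ?S3 = "{Ver i | i j. prev_access ca T i j \<and> j div p = g}"
    have "?S1 = Ver ` P" by (auto simp: P_def)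
    then have S1: "finite ?S1" "card ?S1 \<le> p" using P card_image_le[of P Ver] by auto
    have sub2: "?S2 \<subseteq> (\<lambda>j. Inp (ca j)) ` P" by (auto simp: P_def)
    then have S2: "finite ?S2" "card ?S2 \<le> p"
      using P card_image_le[of P "\<lambda>j. Inp (ca j)"] card_mono[OF _ sub2] finite_subset[OF sub2] by auto
    have sub3: "?S3 \<subseteq> (\<lambda>j. Ver (THE i. prev_access ca T i j)) ` P"
    proof clarify
      fix i j assume "prev_access ca T i j" "g = j div p"
      moreover from this have "(THE i. prev_access ca T i j) = i" by (intro the_equality) (auto intro: prev_access_unique1)
      ultimately show "Ver i \<in> (\<lambda>j. Ver (THE i. prev_access ca T i j)) ` P" by (auto simp: P_def image_iff)
    qed
    then have S3: "finite ?S3" "card ?S3 \<le> p"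
      using P card_image_le[of P "\<lambda>j. Ver (THE i. prev_access ca T i j)"] card_mono[OF _ sub3] finite_subset[OF sub3] by auto
    have "card ({Grp (g + 1), Grp (g - 1)} \<union> ?S1 \<union> ?S2 \<union> ?S3) \<le> ((2 + p) + p) + p"
      by (intro order_trans[OF card_Un_le] add_mono two S1 S2 S3)
    also have "\<dots> \<le> 5 * p" using p by simp
    finally show ?thesis using S1 S2 S3 Grp by (simp add: core_nbrs_def)
  next
    case (Ver i)
    let ?S = "{Grp (j div p) | j. prev_access ca T i j}"
    have S: "finite ?S \<and> card ?S \<le> 1" by (rule card_le_one_witness) (use prev_access_unique2 in blast)
    have "card ({Grp (i div p)} \<union> ?S) \<le> 1 + 1"
      by (rule order_trans[OF card_Un_le]) (intro add_mono, use S in simp_all)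
    then show ?thesis using S Ver p by (simp add: core_nbrs_def)
  qed (simp_all add: core_nbrs_def)
qed

text \<open>The network of a run with \<open>T\<close> I/Os grouped into phases of \<open>p\<close> I/Os.  \<open>Ver j\<close> is the version of a
  block after the \<open>j\<close>-th I/O, \<open>Inp a\<close> the initial content of block \<open>a\<close>, \<open>Grp g\<close> the \<open>g\<close>-th phase,
  and \<open>Wrd i\<close> computes from the message at \<open>Src i\<close> and the offset sent by \<open>Hub\<close> the word that is fed to the
  algorithm.  An entry of the input has at most \<open>2w\<close> bits and meets at most three blocks.  A read within the
  phase of the previous access to the same block needs no edge.\<close>

definition net_edges where
  "net_edges n A p T ca inb outb =
     (\<lambda>i. (Src i, Hub)) ` {..<n} \<union> (\<lambda>i. (Hub, Wrd i)) ` {..<n} \<union> (\<lambda>i. (Hub, Snk i)) ` {..<n} \<union>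
     (\<lambda>i. (Src i, Wrd i)) ` {..<n} \<union> (\<lambda>(i, d). (Wrd i, Inp (inb i + d))) ` ({..<n} \<times> {..<3}) \<union>
     (\<lambda>j. (Inp (ca j), Grp (j div p))) ` {j. first_access ca T j \<and> ca j < A} \<union>
     (\<lambda>g. (Grp g, Grp (g + 1))) ` {g. (g + 1) * p < T} \<union>
     (\<lambda>j. (Grp (j div p), Ver j)) ` {..<T} \<union>
     (\<lambda>(i, j). (Ver i, Grp (j div p))) ` {(i, j). prev_access ca T i j \<and> i div p \<noteq> j div p} \<union>
     (\<lambda>(i, j). (Ver j, Snk i)) ` {(i, j). i < n \<and> last_access ca T j \<and> ca j = A + outb i}"

text \<open>Bits carried: \<open>w\<close> for a word, \<open>b\<close> for a block,
  \<open>m\<close> for the memory handed to the next phase, and the entropy allowance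
  \<open>h i\<close> for an offset.\<close>

definition net_cap where
  "net_cap m b w h = (\<lambda>(u, v). case u of Src _ \<Rightarrow> real w
     | Hub \<Rightarrow> (case v of Wrd i \<Rightarrow> h i | Snk i \<Rightarrow> h i | _ \<Rightarrow> 0) | Wrd _ \<Rightarrow> real w
     | Grp _ \<Rightarrow> (case v of Grp _ \<Rightarrow> real m | _ \<Rightarrow> real b) | _ \<Rightarrow> real b)"

text \<open>The weight 2 at \<open>Wrd\<close> reflects that the last of the three blocks met by a
  word is at distance at most 2 from \<open>inb i\<close>; the weights 1 are single steps of the
  core distance.\<close>

definition net_wt where
  "net_wt l = (\<lambda>(u, v). case u of Src _ \<Rightarrow> (if v = Hub then real l / 2 else 0) | Hub \<Rightarrow> real l / 2 | Wrd _ \<Rightarrow> 2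
     | Ver _ \<Rightarrow> (case v of Snk _ \<Rightarrow> 0 | _ \<Rightarrow> 1) | _ \<Rightarrow> 1)"

text \<open>The hub is placed half way, so that a path through it has to use two hub edges of weight
  \<open>l / 2\<close>.  The weight 0 on the edges from \<open>Src\<close> to \<open>Wrd\<close> and from \<open>Ver\<close> to \<open>Snk\<close> makes their
  capacities irrelevant.\<close>

definition net_potential where
  "net_potential A p T ca inb outb l i0 v =
     (let td = (\<lambda>v. real (trunc_dist (core_nbrs p T ca) l (Inp (inb i0)) v)) in
      case v of Src i \<Rightarrow> td (Inp (inb i)) | Hub \<Rightarrow> real l / 2 | Wrd i \<Rightarrow> td (Inp (inb i))
      | Snk i \<Rightarrow> (if \<exists>j. last_access ca T j \<and> ca j = A + outb i
                  then td (Ver (THE j. last_access ca T j \<and> ca j = A + outb i)) else real l)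
      | _ \<Rightarrow> td v)"

text \<open>A pair whose output block is never accessed is far by vacuity; accordingly
  \<open>net_potential\<close> gives its sink the value \<open>l\<close>.\<close>

definition far_pairs where
  "far_pairs n A p T ca inb outb l = {i. i < n \<and>
     (\<forall>j. last_access ca T j \<and> ca j = A + outb i \<longrightarrow> Ver j \<notin> nball (core_nbrs p T ca) (Inp (inb i)) l)}"

lemma finite_net_indices:
  fixes n :: nat
  shows finite_first: "finite {j. first_access ca T j \<and> ca j < A}"
    and finite_prev: "finite {(i, j). prev_access ca T i j \<and> i div p \<noteq> j div p}"
    and finite_last: "finite {(i, j). i < n \<and> last_access ca T j \<and> ca j = A + outb i}"
    and finite_phases: "p \<ge> 1 \<Longrightarrow> finite {g. (g + 1) * p < T}"
proof -
  show "finite {j. first_access ca T j \<and> ca j < A}"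
    by (rule finite_subset[of _ "{..<T}"]) (auto simp: first_access_def)
  show "finite {(i, j). prev_access ca T i j \<and> i div p \<noteq> j div p}"
    by (rule finite_subset[of _ "{..<T} \<times> {..<T}"]) (auto simp: prev_access_def)
  show "finite {(i, j). i < n \<and> last_access ca T j \<and> ca j = A + outb i}"
    by (rule finite_subset[of _ "{..<n} \<times> {..<T}"]) (auto simp: last_access_def)
  assume p: "p \<ge> 1"
  have "g < T" if "(g + 1) * p < T" for g
  proof -
    have "g * 1 \<le> g * p" using p by (intro mult_le_mono2)
    moreover have "(g + 1) * p = g * p + p" by simp
    ultimately show ?thesis using that p by linarith
  qed
  then have "{g. (g + 1) * p < T} \<subseteq> {..<T}" by blast
  then show "finite {g. (g + 1) * p < T}" by (rule finite_subset) simp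
qed

lemma finite_net_edges: "p \<ge> 1 \<Longrightarrow> finite (net_edges n A p T ca inb outb)"
  unfolding net_edges_def
  by (intro finite_UnI finite_imageI finite_first finite_prev finite_last finite_phases) auto

lemma acyclic_net_edges: "acyclic (net_edges n A p T ca inb outb)"
proof -
  \<comment> \<open>Versions of phase \<open>g\<close> rank between phases \<open>g\<close> and
    \<open>g + 1\<close>. Accesses to a version of the same phase have no edge, so an edge from
    \<open>Ver\<close> to \<open>Grp\<close> leads to a strictly later phase.\<close>
  define rank where "rank v = (case v of Src _ \<Rightarrow> 0 | Hub \<Rightarrow> 1 | Wrd _ \<Rightarrow> 2 | Inp _ \<Rightarrow> 3
     | Grp g \<Rightarrow> 4 + 2 * g | Ver j \<Rightarrow> 5 + 2 * (j div p) | Snk _ \<Rightarrow> 6 + 2 * (T div p))" for v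
  have "net_edges n A p T ca inb outb \<subseteq> Wellfounded.measure rank"
  proof -
    have "i div p < j div p" if "prev_access ca T i j" "i div p \<noteq> j div p" for i j
      using that div_le_mono[of i j p] by (auto simp: prev_access_def)
    moreover have "j div p \<le> T div p" if "last_access ca T j" for j
      using that by (auto simp: last_access_def intro: div_le_mono)
    ultimately show ?thesis by (fastforce simp: net_edges_def rank_def)
  qed
  then show ?thesis using wf_measure wf_subset wf_acyclic by blast
qed

text \<open>Core edges join mutual neighbours, so the truncated distance changes by at most 1.
  Truncated distances lie between 0 and \<open>l\<close>, hence within \<open>l / 2\<close> of the
  hub. \<open>Src\<close> and \<open>Wrd\<close>, and likewise a sink and the last version of its
  block, have equal potentials.\<close>

lemma net_potential_edge:
  assumes e: "(u, v) \<in> net_edges n A p T ca inb outb"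
  shows "\<bar>net_potential A p T ca inb outb l i0 u - net_potential A p T ca inb outb l i0 v\<bar> \<le> net_wt l (u, v)"
proof -
  let ?pot = "net_potential A p T ca inb outb l i0"
  define td where "td v = trunc_dist (core_nbrs p T ca) l (Inp (inb i0)) v" for v
  have td_le: "real (td v) \<le> real l" for v unfolding td_def using trunc_dist_le by (metis of_nat_le_iff)
  have nbr: "\<bar>real (td x) - real (td y)\<bar> \<le> 1" if "x \<in> core_nbrs p T ca y" "y \<in> core_nbrs p T ca x" for x y
    using trunc_dist_step[where nb = "core_nbrs p T ca", OF that(1), of l "Inp (inb i0)"]
      trunc_dist_step[where nb = "core_nbrs p T ca", OF that(2), of l "Inp (inb i0)"]
    unfolding td_def by linarith
  have half: "\<bar>real (td x) - real l / 2\<bar> \<le> real l / 2" "\<bar>real l / 2 - real (td x)\<bar> \<le> real l / 2" for x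
    unfolding abs_le_iff using td_le[of x] of_nat_0_le_iff[of "td x", where 'a = real] by linarith+
  have inp1: "\<bar>real (td (Inp a)) - real (td (Inp (a + 1)))\<bar> \<le> 1" for a by (rule nbr) (auto simp: core_nbrs_def)
  have inp: "\<bar>real (td (Inp a)) - real (td (Inp (a + d)))\<bar> \<le> 2" if d: "d < 3" for a d
  proof -
    consider "d = 0" | "d = 1" | "d = 2" using d by linarith
    then show ?thesis using inp1[of a] inp1[of "a + 1"] by cases (simp_all add: abs_le_iff)
  qed
  have pot: "?pot (Src i) = td (Inp (inb i))"
    "?pot Hub = real l / 2"
    "?pot (Wrd i) = td (Inp (inb i))"
    "?pot (Inp i) = td (Inp i)"
    "?pot (Grp i) = td (Grp i)"
    "?pot (Ver i) = td (Ver i)" for i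
    by (simp_all add: net_potential_def td_def)
  have snk: "?pot (Snk i) = td (Ver j)" if "last_access ca T j" "ca j = A + outb i" for i j
  proof -
    have "(THE j. last_access ca T j \<and> ca j = A + outb i) = j"
      by (rule the_equality) (use that last_access_unique in \<open>auto intro: last_access_unique\<close>)
    then show ?thesis using that by (auto simp: net_potential_def td_def)
  qed
  have snk_half: "\<bar>real l / 2 - ?pot (Snk i)\<bar> \<le> real l / 2" for i
    using half(2) by (auto simp: net_potential_def td_def[symmetric] Let_def)
  have half': "\<bar>real (td x) - real l / 2\<bar> * 2 \<le> real l" "\<bar>real l / 2 - real (td x)\<bar> * 2 \<le> real l"
    "\<bar>real l / 2 - ?pot (Snk i)\<bar> * 2 \<le> real l" for x i
    using half[of x] snk_half[of i] by simp_all
  have e1: "\<bar>real (td (Inp (ca j))) - real (td (Grp (j div p)))\<bar> \<le> 1" if "first_access ca T j" for j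
    by (rule nbr) (use that in \<open>auto simp: core_nbrs_def\<close>)
  have e2: "\<bar>real (td (Grp g)) - real (td (Grp (g + 1)))\<bar> \<le> 1" for g
    by (rule nbr) (auto simp: core_nbrs_def)
  then have e2': "\<bar>real (td (Grp g)) - real (td (Grp (Suc g)))\<bar> \<le> 1" for g by simp
  have e3: "\<bar>real (td (Grp (j div p))) - real (td (Ver j))\<bar> \<le> 1" for j
    by (rule nbr) (auto simp: core_nbrs_def)
  have e4: "\<bar>real (td (Ver i)) - real (td (Grp (j div p)))\<bar> \<le> 1" if "prev_access ca T i j" for i j
    by (rule nbr) (use that in \<open>auto simp: core_nbrs_def\<close>)
  show ?thesis
    using e unfolding net_edges_def Un_iff
    by (elim disjE imageE; clarsimp simp: net_wt_def pot half' snk_half inp snk e1 e2' e3 e4)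
qed

lemma net_potential_far:
  assumes "i \<in> far_pairs n A p T ca inb outb l"
  shows "net_potential A p T ca inb outb l i (Snk i) - net_potential A p T ca inb outb l i (Src i) = real l"
proof -
  let ?pot = "net_potential A p T ca inb outb l i"
  have "?pot (Snk i) = real l"
  proof (cases "\<exists>j. last_access ca T j \<and> ca j = A + outb i")
    case True
    then obtain j where j: "last_access ca T j" "ca j = A + outb i" by blast
    have "(THE j. last_access ca T j \<and> ca j = A + outb i) = j"
      by (rule the_equality) (use j in \<open>auto intro: last_access_unique\<close>)
    then show ?thesis using j assms by (auto simp: net_potential_def far_pairs_def trunc_dist_far)
  next
    case False
    then show ?thesis by (simp only: net_potential_def Let_def node.case if_False)
  qed
  moreover have "?pot (Src i) = 0"
    by (simp add: net_potential_def trunc_dist_self)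
  ultimately show ?thesis by simp
qed

lemma sum_Un_le:
  fixes g :: "'a \<Rightarrow> real"
  assumes "finite X" "finite Y" "\<And>x. x \<in> X \<union> Y \<Longrightarrow> 0 \<le> g x"
  shows "sum g (X \<union> Y) \<le> sum g X + sum g Y"
proof -
  have "0 \<le> sum g (X \<inter> Y)" using assms by (intro sum_nonneg) auto
  then show ?thesis using assms by (simp add: sum_Un)
qed

text \<open>One term per class of edges. Hub edges carry \<open>w\<close> in and \<open>h i\<close>
  out twice, at weight \<open>l / 2\<close>; each word has three edges of weight 2; first accesses,
  new versions and reuse of versions contribute at most \<open>b * T\<close> each; the memory
  crosses at most \<open>T / p\<close> phase boundaries.\<close>

lemma net_weighted_capacity_le:
  assumes p: "p \<ge> 1" and h: "\<And>i. i < n \<Longrightarrow> 0 \<le> h i"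
  shows "(\<Sum>e\<in>net_edges n A p T ca inb outb. net_wt l e * net_cap m b w h e)
    \<le> real l / 2 * (real n * real w + 2 * (\<Sum>i<n. h i)) + 6 * real n * real w + 3 * real b * real T + real m * (real T / real p)"
proof -
  let ?g = "\<lambda>e. net_wt l e * net_cap m b w h e"
  define E where "E = [(\<lambda>i. (Src i, Hub)) ` {..<n}, (\<lambda>i. (Hub, Wrd i)) ` {..<n}, (\<lambda>i. (Hub, Snk i)) ` {..<n},
     (\<lambda>i. (Src i, Wrd i)) ` {..<n}, (\<lambda>(i, d). (Wrd i, Inp (inb i + d))) ` ({..<n} \<times> {..<3}),
     (\<lambda>j. (Inp (ca j), Grp (j div p))) ` {j. first_access ca T j \<and> ca j < A},
     (\<lambda>g. (Grp g, Grp (g + 1))) ` {g. (g + 1) * p < T},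
     (\<lambda>j. (Grp (j div p), Ver j)) ` {..<T},
     (\<lambda>(i, j). (Ver i, Grp (j div p))) ` {(i, j). prev_access ca T i j \<and> i div p \<noteq> j div p},
     (\<lambda>(i, j). (Ver j, Snk i)) ` {(i, j). i < n \<and> last_access ca T j \<and> ca j = A + outb i}]"
  have all: "net_edges n A p T ca inb outb = \<Union> (set E)" by (simp add: net_edges_def E_def Un_assoc)
  have fin: "finite X" if "X \<in> set E" for X
    using finite_net_edges[OF p, of n A T ca inb outb] that unfolding all by (meson Union_upper finite_subset)
  have nn: "0 \<le> ?g e" if "e \<in> \<Union> (set E)" for e
    using that h by (auto simp: E_def net_wt_def net_cap_def)
  have sum_union: "sum ?g (\<Union> (set Es)) \<le> sum_list (map (sum ?g) Es)" if "set Es \<subseteq> set E" for Es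
    using that
  proof (induction Es)
    case (Cons X Es)
    have "sum ?g (\<Union> (set (X # Es))) \<le> sum ?g X + sum ?g (\<Union> (set Es))"
      unfolding list.set Union_insert
    proof (rule sum_Un_le)
      show "finite X" using Cons.prems fin by simp
      show "finite (\<Union> (set Es))" using Cons.prems fin by (intro finite_Union) auto
      show "0 \<le> ?g e" if "e \<in> X \<union> \<Union> (set Es)" for e
      proof (rule nn)
        show "e \<in> \<Union> (set E)"
        proof -
          obtain Y where "Y \<in> set (X # Es)" "e \<in> Y" using \<open>e \<in> X \<union> \<Union> (set Es)\<close> by (cases "e \<in> X") auto
          then show ?thesis using Cons.prems by blast
        qed
      qed
    qed
    also have "sum ?g (\<Union> (set Es)) \<le> sum_list (map (sum ?g) Es)" using Cons by simp
    finally show ?case by simp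
  qed simp
  have img1: "sum ?g (f ` I) \<le> c" if "f ` I \<in> set E" "finite I" "(\<Sum>i\<in>I. ?g (f i)) \<le> c" for f and I :: "nat set" and c
  proof -
    have "sum ?g (f ` I) \<le> sum (?g \<circ> f) I"
      using that(1,2) by (intro sum_image_le nn) blast+
    then show ?thesis using that(3) unfolding o_def by (rule order_trans)
  qed
  have img2: "sum ?g (f ` I) \<le> c" if "f ` I \<in> set E" "finite I" "(\<Sum>i\<in>I. ?g (f i)) \<le> c" for f and I :: "(nat \<times> nat) set" and c
  proof -
    have "sum ?g (f ` I) \<le> sum (?g \<circ> f) I"
      using that(1,2) by (intro sum_image_le nn) blast+
    then show ?thesis using that(3) unfolding o_def by (rule order_trans)
  qed
  have x0: "sum ?g ((\<lambda>i. (Src i, Hub)) ` {..<n}) \<le> real l / 2 * (real n * real w)"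
    by (rule img1) (simp_all add: E_def net_wt_def net_cap_def)
  have x1: "sum ?g ((\<lambda>i. (Hub, Wrd i)) ` {..<n}) \<le> real l / 2 * (\<Sum>i<n. h i)"
    by (rule img1) (simp_all add: E_def net_wt_def net_cap_def sum_distrib_left)
  have x2: "sum ?g ((\<lambda>i. (Hub, Snk i)) ` {..<n}) \<le> real l / 2 * (\<Sum>i<n. h i)"
    by (rule img1) (simp_all add: E_def net_wt_def net_cap_def sum_distrib_left)
  have x3: "sum ?g ((\<lambda>i. (Src i, Wrd i)) ` {..<n}) \<le> 0"
    by (rule img1) (simp_all add: E_def net_wt_def net_cap_def)
  have x4: "sum ?g ((\<lambda>(i, d). (Wrd i, Inp (inb i + d))) ` ({..<n} \<times> {..<3})) \<le> 6 * real n * real w"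
    by (rule img2) (simp_all add: E_def net_wt_def net_cap_def case_prod_beta card_cartesian_product)
  have x5: "sum ?g ((\<lambda>j. (Inp (ca j), Grp (j div p))) ` {j. first_access ca T j \<and> ca j < A}) \<le> real b * real T"
  proof (rule img1)
    have sub: "{j. first_access ca T j \<and> ca j < A} \<subseteq> {..<T}" by (auto simp: first_access_def)
    show "finite {j. first_access ca T j \<and> ca j < A}" by (rule finite_first)
    have "card {j. first_access ca T j \<and> ca j < A} \<le> T" using card_mono[OF _ sub] by simp
    then have "real b * real (card {j. first_access ca T j \<and> ca j < A}) \<le> real b * real T"
      by (intro mult_left_mono) simp_all
    then show "(\<Sum>j | first_access ca T j \<and> ca j < A. ?g (Inp (ca j), Grp (j div p))) \<le> real b * real T"
      by (simp add: net_wt_def net_cap_def mult.commute)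
  qed (simp add: E_def)
  have x6: "sum ?g ((\<lambda>g. (Grp g, Grp (g + 1))) ` {g. (g + 1) * p < T}) \<le> real m * (real T / real p)"
  proof (rule img1)
    have "real (card {g. (g + 1) * p < T}) \<le> real T / real p"
    proof -
      have "g < T div p" if "(g + 1) * p < T" for g
        using that p by (metis Suc_eq_plus1 Suc_le_eq less_imp_le_nat less_eq_div_iff_mult_less_eq zero_less_one order_less_le_trans)
      then have "{g. (g + 1) * p < T} \<subseteq> {..<T div p}" by auto
      from card_mono[OF _ this] have "card {g. (g + 1) * p < T} \<le> T div p" by simp
      then have "real (card {g. (g + 1) * p < T}) \<le> real (T div p)" by simp
      also have "\<dots> \<le> real T / real p" by (rule of_nat_div_le_of_nat)
      finally show ?thesis .
    qed
    then have "real m * real (card {g. (g + 1) * p < T}) \<le> real m * (real T / real p)"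
      by (intro mult_left_mono) simp_all
    then show "(\<Sum>g | (g + 1) * p < T. ?g (Grp g, Grp (g + 1))) \<le> real m * (real T / real p)"
      by (simp add: net_wt_def net_cap_def mult.commute)
    show "finite {g. (g + 1) * p < T}" by (rule finite_phases[OF p])
  qed (simp add: E_def)
  have x7: "sum ?g ((\<lambda>j. (Grp (j div p), Ver j)) ` {..<T}) \<le> real b * real T"
    by (rule img1) (simp_all add: E_def net_wt_def net_cap_def)
  have x8: "sum ?g ((\<lambda>(i, j). (Ver i, Grp (j div p))) ` {(i, j). prev_access ca T i j \<and> i div p \<noteq> j div p}) \<le> real b * real T"
  proof (rule img2)
    let ?I = "{(i, j). prev_access ca T i j \<and> i div p \<noteq> j div p}"
    have inj: "inj_on snd ?I" by (auto simp: inj_on_def intro: prev_access_unique1)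
    have sub: "snd ` ?I \<subseteq> {..<T}" by (auto simp: prev_access_def)
    show fin: "finite ?I" by (rule inj_on_finite[OF inj sub]) simp
    have "card ?I \<le> T" using card_inj_on_le[OF inj sub] by simp
    then have "real b * real (card ?I) \<le> real b * real T"
      by (intro mult_left_mono) simp_all
    then show "(\<Sum>x\<in>?I. ?g (case x of (i, j) \<Rightarrow> (Ver i, Grp (j div p)))) \<le> real b * real T"
      by (simp add: net_wt_def net_cap_def case_prod_beta mult.commute)
  qed (simp add: E_def)
  have x9: "sum ?g ((\<lambda>(i, j). (Ver j, Snk i)) ` {(i, j). i < n \<and> last_access ca T j \<and> ca j = A + outb i}) \<le> 0"
  proof (rule img2)
    show "finite {(i, j). i < n \<and> last_access ca T j \<and> ca j = A + outb i}" by (rule finite_last)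
  qed (simp_all add: E_def net_wt_def net_cap_def case_prod_beta)
  have "(\<Sum>e\<in>net_edges n A p T ca inb outb. ?g e) \<le> sum_list (map (sum ?g) E)"
    unfolding all by (rule sum_union) simp
  also have "\<dots> \<le> real l / 2 * (real n * real w) + (real l / 2 * (\<Sum>i<n. h i) + (real l / 2 * (\<Sum>i<n. h i) + (0 +
      (6 * real n * real w + (real b * real T + (real m * (real T / real p) + (real b * real T + (real b * real T + (0 + 0)))))))))"
    unfolding E_def list.map sum_list.Cons sum_list.Nil
    by (intro add_mono x0 x1 x2 x3 x4 x5 x6 x7 x8 x9 order_refl)
  also have "\<dots> = real l / 2 * (real n * real w + 2 * (\<Sum>i<n. h i)) + 6 * real n * real w + 3 * real b * real T + real m * (real T / real p)"
    by (simp add: algebra_simps)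
  finally show ?thesis .
qed

section \<open>The network code of a run\<close>

lemma nth_concat_equal_lengths:
  assumes "\<And>xs. xs \<in> set xss \<Longrightarrow> length xs = c" "q < c * length xss"
  shows "concat xss ! q = xss ! (q div c) ! (q mod c)"
  using assms
proof (induction xss arbitrary: q)
  case (Cons xs xss)
  have c: "length xs = c" "c > 0" using Cons.prems by (auto intro: gr0I)
  show ?case
  proof (cases "q < c")
    case False
    then have "q - c < c * length xss" using Cons.prems(2) by simp
    then have "concat xss ! (q - c) = xss ! ((q - c) div c) ! ((q - c) mod c)"
      using Cons.prems(1) by (intro Cons.IH) auto
    moreover have "q div c = Suc ((q - c) div c)" "q mod c = (q - c) mod c"
      using False c by (simp_all add: le_div_geq le_mod_geq)
    ultimately show ?thesis using False c by (simp add: nth_append)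
  qed (use c in \<open>simp add: nth_append\<close>)
qed simp

lemma length_concat_equal_lengths:
  "(\<And>xs. xs \<in> set xss \<Longrightarrow> length xs = c) \<Longrightarrow> length (concat xss) = c * length xss"
  by (induction xss) auto

definition xor_bits :: "bits \<Rightarrow> bits \<Rightarrow> bits" where
  "xor_bits x y = map2 (\<noteq>) x y"

lemma length_xor_bits [simp]: "length (xor_bits x y) = min (length x) (length y)"
  by (simp add: xor_bits_def)

lemma xor_bits_cancel: "length x = length y \<Longrightarrow> xor_bits (xor_bits x y) y = x"
  by (intro nth_equalityI) (auto simp: xor_bits_def)

lemma xor_bits_commute: "xor_bits x y = xor_bits y x"
  by (intro nth_equalityI) (auto simp: xor_bits_def)

definition bit_words :: "nat \<Rightarrow> bits set" where
  "bit_words w = {s. length s = w}"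

lemma finite_bit_words [simp]: "finite (bit_words w)"
  using finite_lists_length_eq[of "UNIV :: bool set" w] by (simp add: bit_words_def)

lemma card_bit_words: "card (bit_words w) = 2 ^ w"
  using card_lists_length_eq[of "UNIV :: bool set" w] by (simp add: bit_words_def)

lemma bit_words_nonempty: "bit_words w \<noteq> {}"
  using Ex_list_of_length[of w] by (auto simp: bit_words_def)

lemma bij_betw_xor_bits:
  assumes "x \<in> bit_words w"
  shows "bij_betw (\<lambda>r. xor_bits r x) (bit_words w) (bit_words w)"
  by (rule bij_betwI[where g = "\<lambda>r. xor_bits r x"])
    (use assms in \<open>auto simp: bit_words_def xor_bits_cancel\<close>)

lemma entropy2_bits_le:
  fixes f :: "'a \<Rightarrow> bits"
  assumes "finite S" "S \<noteq> {}" "\<And>x. x \<in> S \<Longrightarrow> length (f x) = c"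
  shows "entropy2 S (\<lambda>x. to_nat (f x)) \<le> real c"
proof -
  have "(\<lambda>x. to_nat (f x)) ` S \<subseteq> to_nat ` bit_words c" using assms(3) by (auto simp: bit_words_def)
  then have "entropy2 S (\<lambda>x. to_nat (f x)) \<le> log 2 (real (card (to_nat ` bit_words c)))"
    by (rule entropy2_le_log_card[OF assms(1,2)]) simp
  also have "card (to_nat ` bit_words c) = 2 ^ c"
    by (subst card_image) (simp_all add: card_bit_words)
  finally show ?thesis by simp
qed

lemma index_bits_le: "log 2 (real n) \<le> real w \<Longrightarrow> index_bits n \<le> w"
  by (simp add: index_bits_def ceiling_le_iff nat_le_iff)

text \<open>Data words are indexed from 0 in a list and from 1 in the permutation problem.\<close>

definition word_disk where
  "word_disk b n \<pi> y = perm_disk b n \<pi> (\<lambda>i. y ! (i - 1))"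

lemma input_bits_words:
  assumes "y \<in> words (bit_words w) n"
  defines "c \<equiv> w + index_bits n"
  shows "length (input_bits n \<pi> (\<lambda>i. y ! (i - 1))) = c * n"
    and "q < c * n \<Longrightarrow> input_bits n \<pi> (\<lambda>i. y ! (i - 1)) ! q =
       (map (bit (\<pi> (q div c + 1) - 1)) [0..<index_bits n] @ y ! (q div c)) ! (q mod c)"
proof -
  let ?xss = "map (\<lambda>i. map (bit (\<pi> i - 1)) [0..<index_bits n] @ y ! (i - 1)) [1..<Suc n]"
  have len: "length xs = c" if xs: "xs \<in> set ?xss" for xs
  proof -
    obtain i where i: "1 \<le> i" "i \<le> n" "xs = map (bit (\<pi> i - 1)) [0..<index_bits n] @ y ! (i - 1)" using xs by auto
    have "y ! (i - 1) \<in> set y" using i assms(1) by (intro nth_mem) (auto simp: words_def)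
    then have "y ! (i - 1) \<in> bit_words w" using assms(1) by (auto simp: words_def)
    then show ?thesis using i by (simp add: c_def bit_words_def)
  qed
  show "length (input_bits n \<pi> (\<lambda>i. y ! (i - 1))) = c * n"
    unfolding input_bits_def using length_concat_equal_lengths[of ?xss c, OF len] by simp
  assume q: "q < c * n"
  then have "q div c < n" by (simp add: less_mult_imp_div_less mult.commute)
  moreover have "concat ?xss ! q = ?xss ! (q div c) ! (q mod c)"
    by (rule nth_concat_equal_lengths[OF len]) (use q \<open>q div c < n\<close> in simp_all)
  ultimately show "input_bits n \<pi> (\<lambda>i. y ! (i - 1)) ! q =
       (map (bit (\<pi> (q div c + 1) - 1)) [0..<index_bits n] @ y ! (q div c)) ! (q mod c)"
    unfolding input_bits_def by (simp del: upt_Suc)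
qed

lemma word_disk_zero:
  assumes "y \<in> words (bit_words w) n" "0 < b" "output_start b n w \<le> a"
  shows "word_disk b n \<pi> y a = replicate b False"
proof -
  have "real (n * (w + index_bits n)) / real b \<le> real (output_start b n w)"
    unfolding output_start_def by (simp add: of_nat_nat[symmetric] le_of_int_ceiling)
  also have "\<dots> \<le> real a" using assms(3) by simp
  finally have "real (n * (w + index_bits n)) \<le> real (a * b)" using assms(2) by (simp add: pos_divide_le_eq)
  then have "(w + index_bits n) * n \<le> a * b" by (simp only: of_nat_le_iff mult.commute)
  then show ?thesis
    using input_bits_words(1)[OF assms(1), of \<pi>] by (simp add: word_disk_def perm_disk_def)
qed

text \<open>The index bits are common to both disks since \<open>\<pi>\<close> is fixed, so a block
  depends only on the words that it meets. A bit of the entry that starts at \<open>i * c\<close>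
  lies before \<open>i * c + 2 * b\<close>, which gives the three values of
  \<open>d\<close>.\<close>

lemma word_disk_cong:
  assumes y: "y \<in> words (bit_words w) n" "z \<in> words (bit_words w) n" and b: "0 < b" "w \<le> b" and n: "index_bits n \<le> w"
    and eq: "\<And>i d. i < n \<Longrightarrow> d < 3 \<Longrightarrow> a = i * (w + index_bits n) div b + d \<Longrightarrow> y ! i = z ! i"
  shows "word_disk b n \<pi> y a = word_disk b n \<pi> z a"
proof -
  define c where "c = w + index_bits n"
  define u where "u y = input_bits n \<pi> (\<lambda>i. y ! (i - 1))" for y
  have len: "length (u y) = c * n" "length (u z) = c * n"
    using input_bits_words(1)[OF y(1), of \<pi>] input_bits_words(1)[OF y(2), of \<pi>] by (simp_all add: u_def c_def)
  have "take b (drop (a * b) (u y)) = take b (drop (a * b) (u z))"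
  proof (rule nth_equalityI)
    fix t assume "t < length (take b (drop (a * b) (u y)))"
    then have t: "t < b" "a * b + t < c * n" using len by auto
    define q where "q = a * b + t"
    define i where "i = q div c"
    have q: "q < c * n" using t by (simp add: q_def)
    then have i: "i < n" unfolding i_def by (simp add: less_mult_imp_div_less mult.commute)
    have c: "c > 0" using q by (auto intro: gr0I)
    have qa: "q div b = a" using t b by (simp add: q_def)
    have ic: "i * c \<le> q" "q < i * c + c"
      unfolding i_def using c div_mult_mod_eq[of q c] mod_less_divisor[of c q] by linarith+
    have "i * c div b \<le> a" using div_le_mono[OF ic(1), of b] qa by simp
    moreover have "a \<le> i * c div b + 2"
    proof -
      have "q \<le> i * c + b * 2" using ic(2) b n by (simp add: c_def)
      then have "q div b \<le> (i * c + b * 2) div b" by (rule div_le_mono)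
      then show ?thesis using qa b by simp
    qed
    ultimately have "y ! i = z ! i" using i by (intro eq[of i "a - i * c div b"]) (auto simp: c_def)
    then have "u y ! q = u z ! q"
      using input_bits_words(2)[OF y(1), of q \<pi>] input_bits_words(2)[OF y(2), of q \<pi>] q
      by (simp add: u_def c_def i_def)
    then show "take b (drop (a * b) (u y)) ! t = take b (drop (a * b) (u z)) ! t"
      using t len by (simp add: q_def)
  qed (use len in simp)
  moreover have "perm_disk b n \<pi> (\<lambda>i. y ! (i - 1)) a = take b (drop (a * b) (u y)) @ replicate (b - length (take b (drop (a * b) (u y)))) False" for y
    by (auto simp: perm_disk_def u_def min_def)
  ultimately show ?thesis unfolding word_disk_def by (simp add: len)
qed

lemma entropy2_reindex:
  assumes f: "bij_betw f S S'" and S: "finite S" "S \<noteq> {}"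
  shows "entropy2 S (\<lambda>x. g (f x)) = entropy2 S' g"
proof -
  have S': "S' = f ` S" and inj: "inj_on f S" using f by (simp_all add: bij_betw_def)
  have "card {s \<in> S. g (f s) = v} = card {s \<in> S'. g s = v}" for v
  proof -
    have "{s \<in> S'. g s = v} = f ` {s \<in> S. g (f s) = v}" by (auto simp: S')
    moreover have "inj_on f {s \<in> S. g (f s) = v}" using inj by (rule inj_on_subset) auto
    ultimately show ?thesis by (simp add: card_image)
  qed
  moreover have "card S = card S'" using f by (rule bij_betw_same_card)
  moreover have "(\<lambda>x. g (f x)) ` S = g ` S'" by (simp add: S' image_image)
  moreover have "finite S'" "S' \<noteq> {}" using S by (simp_all add: S')
  ultimately show ?thesis by (simp add: entropy2_eq_sum[OF S] entropy2_eq_sum)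
qed

definition decode_words :: "nat \<Rightarrow> (nat \<Rightarrow> nat) \<Rightarrow> bits list" where
  "decode_words n x = map (\<lambda>i. from_nat (x i)) [0..<n]"

lemma bij_betw_decode_words:
  "bij_betw (decode_words n) (PiE {..<n} (\<lambda>_. to_nat ` Q)) (words Q n)"
proof (rule bij_betwI[where g = "\<lambda>xs. \<lambda>i\<in>{..<n}. to_nat (xs ! i)"])
  show "decode_words n \<in> PiE {..<n} (\<lambda>_. to_nat ` Q) \<rightarrow> words Q n"
  proof
    fix x assume x: "x \<in> PiE {..<n} (\<lambda>_. to_nat ` Q)"
    have "from_nat (x i) \<in> Q" if "i < n" for i
    proof -
      have "x i \<in> to_nat ` Q" using PiE_mem[OF x, of i] that by simp
      then obtain q where "q \<in> Q" "x i = to_nat q" by blast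
      then show ?thesis by simp
    qed
    then show "decode_words n x \<in> words Q n" by (auto simp: decode_words_def words_def)
  qed
  show "(\<lambda>xs. \<lambda>i\<in>{..<n}. to_nat (xs ! i)) \<in> words Q n \<rightarrow> PiE {..<n} (\<lambda>_. to_nat ` Q)"
  proof
    fix xs assume "xs \<in> words Q n"
    then have "xs ! i \<in> Q" if "i < n" for i using that nth_mem[of i xs] by (auto simp: words_def)
    then show "(\<lambda>i\<in>{..<n}. to_nat (xs ! i)) \<in> PiE {..<n} (\<lambda>_. to_nat ` Q)"
      unfolding restrict_PiE_iff by blast
  qed
  show "(\<lambda>i\<in>{..<n}. to_nat (decode_words n x ! i)) = x" if x: "x \<in> PiE {..<n} (\<lambda>_. to_nat ` Q)" for x
  proof
    fix i
    show "(\<lambda>i\<in>{..<n}. to_nat (decode_words n x ! i)) i = x i"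
    proof (cases "i < n")
      case True
      then have "x i \<in> to_nat ` Q" using PiE_mem[OF x, of i] by simp
      then obtain q where "q \<in> Q" "x i = to_nat q" by blast
      then show ?thesis using True by (simp add: decode_words_def)
    qed (use PiE_arb[OF x, of i] in simp)
  qed
  show "decode_words n (\<lambda>i\<in>{..<n}. to_nat (xs ! i)) = xs" if "xs \<in> words Q n" for xs
    using that by (intro nth_equalityI) (auto simp: decode_words_def words_def)
qed

lemma net_edges_cases:
  assumes "e \<in> net_edges n A p T ca inb outb"
  obtains i where "i < n" "e = (Src i, Hub)" | i where "i < n" "e = (Hub, Wrd i)"
  | i where "i < n" "e = (Hub, Snk i)" | i where "i < n" "e = (Src i, Wrd i)"
  | i d where "i < n" "d < 3" "e = (Wrd i, Inp (inb i + d))"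
  | j where "first_access ca T j" "ca j < A" "e = (Inp (ca j), Grp (j div p))"
  | g where "(g + 1) * p < T" "e = (Grp g, Grp (g + 1))"
  | j where "j < T" "e = (Grp (j div p), Ver j)"
  | i j where "prev_access ca T i j" "i div p \<noteq> j div p" "e = (Ver i, Grp (j div p))"
  | i j where "i < n" "last_access ca T j" "ca j = A + outb i" "e = (Ver j, Snk i)"
  using assms unfolding net_edges_def Un_iff
  by (elim disjE imageE) (auto simp del: One_nat_def)

lemma net_edgesI:
  "i < n \<Longrightarrow> (Src i, Hub) \<in> net_edges n A p T ca inb outb"
  "i < n \<Longrightarrow> (Hub, Wrd i) \<in> net_edges n A p T ca inb outb"
  "i < n \<Longrightarrow> (Hub, Snk i) \<in> net_edges n A p T ca inb outb"
  "i < n \<Longrightarrow> (Src i, Wrd i) \<in> net_edges n A p T ca inb outb"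
  "i < n \<Longrightarrow> d < 3 \<Longrightarrow> (Wrd i, Inp (inb i + d)) \<in> net_edges n A p T ca inb outb"
  "first_access ca T j \<Longrightarrow> ca j < A \<Longrightarrow> (Inp (ca j), Grp (j div p)) \<in> net_edges n A p T ca inb outb"
  "(g + 1) * p < T \<Longrightarrow> (Grp g, Grp (g + 1)) \<in> net_edges n A p T ca inb outb"
  "j < T \<Longrightarrow> (Grp (j div p), Ver j) \<in> net_edges n A p T ca inb outb"
  "prev_access ca T k j \<Longrightarrow> k div p \<noteq> j div p \<Longrightarrow> (Ver k, Grp (j div p)) \<in> net_edges n A p T ca inb outb"
  "i < n \<Longrightarrow> last_access ca T j \<Longrightarrow> ca j = A + outb i \<Longrightarrow> (Ver j, Snk i) \<in> net_edges n A p T ca inb outb"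
  unfolding net_edges_def by (simp_all add: image_iff) blast+

text \<open>The word \<open>y\<close> fed to the algorithm depends on the whole of \<open>x\<close>
  and is known only to the hub, yet \<open>Wrd i\<close> recovers \<open>y ! i\<close> from
  \<open>x i\<close> and the offset, and the sink recovers \<open>x i\<close> from the output
  \<open>y ! i\<close> and the same offset. Since \<open>y\<close> always lies in \<open>F\<close>,
  every run has the pattern of the graph, and all messages in between are locally
  determined.\<close>

theorem run_network_bound:
  fixes n w B M T l :: nat and \<pi> ca :: "nat \<Rightarrow> nat" and F :: "bits list set" and Y :: "bits list \<Rightarrow> bits list"
  defines "b \<equiv> B * w" and "m \<equiv> M * w" and "A \<equiv> output_start (B * w) n w" and "p \<equiv> M div B"
    and "inb \<equiv> \<lambda>i. i * (w + index_bits n) div (B * w)" and "outb \<equiv> \<lambda>i. (\<pi> (i + 1) - 1) div B"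
  assumes conj: "undirected_k_pairs_conjecture"
    and par: "1 \<le> w" "1 \<le> B" "B \<le> M" "index_bits n \<le> w" and \<pi>: "\<pi> permutes {1..n}"
    and alg: "\<And>j s. length s = m \<Longrightarrow> length (fst (alg j s)) = m"
    and F: "F \<subseteq> words (bit_words w) n" and Y: "\<And>x. x \<in> words (bit_words w) n \<Longrightarrow> Y x \<in> F"
    and run: "\<And>y. y \<in> F \<Longrightarrow> follows_pattern m b alg (A + n) T ca (word_disk b n \<pi> y)"
    and out: "\<And>y i. y \<in> F \<Longrightarrow> i < n \<Longrightarrow>
        output_word B n w (run_disk m b alg (word_disk b n \<pi> y) T) (\<pi> (i + 1)) = y ! i"
    and h: "\<And>i. i < n \<Longrightarrow> 0 < h i \<and>
        entropy2 (words (bit_words w) n) (\<lambda>x. to_nat (xor_bits (Y x ! i) (x ! i))) \<le> h i"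
  shows "real (card (far_pairs n A p T ca inb outb l)) * real l * real w \<le>
     real l / 2 * (real n * real w + 2 * (\<Sum>i<n. h i)) + 6 * real n * real w + 3 * real b * real T + real m * (real T / real p)"
proof -
  define E where "E = net_edges n A p T ca inb outb"
  define W where "W = bit_words w"
  define S where "S = PiE {..<n} (\<lambda>_. (to_nat :: bits \<Rightarrow> nat) ` W)"
  define dec where "dec = decode_words n"
  define y where "y x = Y (dec x)" for x
  define D where "D x = word_disk b n \<pi> (y x)" for x
  define z where "z x i = xor_bits (y x ! i) (dec x ! i)" for x i
  define mm where "mm x = run_mem m b alg (D x)" for x
  define bb where "bb x = run_block m b alg (D x)" for x
  \<comment> \<open>A phase sends the memory at its end or the versions that it creates. The default
    0 is for pairs of nodes that are not edges.\<close>
  define msg where "msg x = (\<lambda>(u, v). case u of Src i \<Rightarrow> x i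
     | Hub \<Rightarrow> (case v of Wrd i \<Rightarrow> to_nat (z x i) | Snk i \<Rightarrow> to_nat (z x i) | _ \<Rightarrow> 0)
     | Wrd i \<Rightarrow> to_nat (y x ! i) | Inp a \<Rightarrow> to_nat (D x a)
     | Grp g \<Rightarrow> (case v of Grp _ \<Rightarrow> to_nat (mm x ((g + 1) * p)) | Ver j \<Rightarrow> to_nat (bb x j) | _ \<Rightarrow> 0)
     | Ver j \<Rightarrow> to_nat (bb x j) | Snk _ \<Rightarrow> 0)" for x :: "nat \<Rightarrow> nat"
  have b: "0 < b" "w \<le> b" "b \<le> m" and m: "0 < m" and p: "1 \<le> p"
    using par by (simp_all add: b_def m_def p_def Suc_le_eq div_greater_zero_iff)
  have A: "A = output_start b n w" by (simp add: A_def b_def)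
  have bij: "bij_betw dec S (words W n)" unfolding dec_def S_def by (rule bij_betw_decode_words)
  have fS: "finite S" "S \<noteq> {}"
    using bit_words_nonempty[of w] by (auto simp: S_def W_def PiE_eq_empty_iff intro!: finite_PiE)
  have decS: "dec x \<in> words W n" if "x \<in> S" for x using bij that by (auto simp: bij_betw_def)
  have yF: "y x \<in> F" if "x \<in> S" for x using Y decS[OF that] by (simp add: y_def W_def)
  have yW: "y x \<in> words (bit_words w) n" if "x \<in> S" for x using yF[OF that] F by auto
  have nth_W: "length (ys ! i) = w" if "ys \<in> words (bit_words w) n" "i < n" for ys i
  proof -
    have "ys ! i \<in> set ys" "set ys \<subseteq> bit_words w" using that by (auto simp: words_def)
    then show ?thesis by (auto simp: bit_words_def)
  qed
  have len_y: "length (y x ! i) = w" and len_d: "length (dec x ! i) = w" and dec_nth: "dec x ! i = from_nat (x i)"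
    if "x \<in> S" "i < n" for x i
    using nth_W[OF yW[OF that(1)] that(2)] nth_W[OF decS[OF that(1), unfolded W_def] that(2)] that(2)
    by (simp_all add: dec_def decode_words_def)
  have fp: "follows_pattern m b alg (A + n) T ca (D x)" if "x \<in> S" for x
    using run[OF yF[OF that]] by (simp add: D_def)
  have cfg: "em_config m b alg (D x) j \<noteq> None" if "x \<in> S" "j \<le> T" for x j
    using fp[OF that(1)] config_not_None_mono[OF _ that(2)] by (simp add: follows_pattern_def)
  have lenD: "length (D x a) = b" for x a by (simp add: D_def word_disk_def length_perm_disk)
  have len_mm: "length (mm x j) = m" if "x \<in> S" "j \<le> T" for x j
    unfolding mm_def by (rule run_lengths(1)[OF alg b(3) lenD cfg[OF that]])
  have len_bb: "length (bb x j) = b" if "x \<in> S" "j < T" for x j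
  proof -
    have "Suc j \<le> T" using that(2) by (rule Suc_leI)
    from run_lengths(2)[OF alg b(3) lenD cfg[OF that(1) this]] show ?thesis unfolding bb_def run_block_def .
  qed
  have outb: "outb i < n" if "i < n" for i
  proof -
    have "\<pi> (i + 1) \<in> {1..n}" using permutes_in_image[OF \<pi>, of "i + 1"] that by simp
    moreover have "outb i \<le> \<pi> (i + 1) - 1" by (simp add: outb_def)
    ultimately show ?thesis by auto
  qed
  have zero: "D x a = D x' a" if "x \<in> S" "x' \<in> S" "A \<le> a" for x x' a
    using word_disk_zero[OF yW[OF that(1)] b(1), of a] word_disk_zero[OF yW[OF that(2)] b(1), of a] that(3)
    by (simp add: D_def A)
  have msg_simps: "msg x (Src i, v) = x i" "msg x (Hub, Wrd i) = to_nat (z x i)" "msg x (Hub, Snk i) = to_nat (z x i)"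
    "msg x (Wrd i, v) = to_nat (y x ! i)" "msg x (Inp i, v) = to_nat (D x i)" "msg x (Grp i, Grp j) = to_nat (mm x ((i + 1) * p))"
    "msg x (Grp i, Ver j) = to_nat (bb x j)" "msg x (Ver j, v) = to_nat (bb x j)" for x i j v
    by (simp_all add: msg_def)
  have phase: "mm x j = mm x' j \<and> (\<forall>i. g * p \<le> i \<and> i < j \<longrightarrow> bb x i = bb x' i)"
    if x: "x \<in> S" "x' \<in> S" and eq: "\<And>e'. e' \<in> E \<Longrightarrow> snd e' = Grp g \<Longrightarrow> msg x e' = msg x' e'"
      and j: "g * p \<le> j" "j \<le> g * p + p" "j \<le> T" and g: "g * p < T" for x x' g j
    unfolding mm_def bb_def
  proof (rule phase_determined[OF fp[OF x(1)] fp[OF x(2)], where hi = "g * p + p" and A = A])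
    have div_g: "i div p = g" if "g * p \<le> i" "i < g * p + p" for i
      using that p by (intro div_nat_eqI) (simp_all add: mult.commute)
    show "run_mem m b alg (D x) (g * p) = run_mem m b alg (D x') (g * p)"
    \<comment> \<open>Phase 0 starts from the all-zero memory; a later phase receives its memory
      from the phase before it.\<close>
    proof (cases g)
      case (Suc g')
      have "(Grp g', Grp (g' + 1)) \<in> E" unfolding E_def by (rule net_edgesI) (use g Suc in simp)
      from eq[OF this] Suc have "to_nat (mm x (g * p)) = to_nat (mm x' (g * p))" by (simp add: msg_simps)
      then show ?thesis by (simp add: mm_def)
    qed simp
    show "run_block m b alg (D x) i = run_block m b alg (D x') i"
      if "prev_access ca T i k" "g * p \<le> k" "k < g * p + p" "i < g * p" for i k
    proof -
      have "k div p = g" using that div_g by simp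
      moreover have "i div p < g" using that(4) by (simp add: less_mult_imp_div_less)
      ultimately have "(Ver i, Grp (k div p)) \<in> E" unfolding E_def using that by (intro net_edgesI) auto
      from eq[OF this] \<open>k div p = g\<close> have "to_nat (bb x i) = to_nat (bb x' i)" by (simp add: msg_simps)
      then show ?thesis by (simp add: bb_def)
    qed
    show "D x (ca k) = D x' (ca k)"
      if "first_access ca T k" "g * p \<le> k" "k < g * p + p" "ca k < A" for k
    proof -
      have "k div p = g" using that div_g by simp
      moreover have "(Inp (ca k), Grp (k div p)) \<in> E" unfolding E_def using that by (intro net_edgesI)
      ultimately have "to_nat (D x (ca k)) = to_nat (D x' (ca k))" using eq[of "(Inp (ca k), Grp (k div p))"] by (simp add: msg_simps)
      then show ?thesis by simp
    qed
    show "D x a = D x' a" if "A \<le> a" for a by (rule zero[OF x that])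
  qed (use j in simp_all)
  have ent_z: "entropy2 S (\<lambda>x. to_nat (z x i)) \<le> h i" if "i < n" for i
    using entropy2_reindex[OF bij fS, of "\<lambda>x. to_nat (xor_bits (Y x ! i) (x ! i))"] h[OF that]
    by (simp add: z_def y_def W_def)
  have ent_x: "entropy2 S (\<lambda>x. x i) = real w" if "i < n" for i
  proof -
    have "entropy2 S (\<lambda>x. x i) = log 2 (real (card ((to_nat :: bits \<Rightarrow> nat) ` W)))"
      unfolding S_def by (rule entropy2_PiE_component) (use that bit_words_nonempty in \<open>auto simp: W_def\<close>)
    also have "card ((to_nat :: bits \<Rightarrow> nat) ` W) = 2 ^ w"
      by (subst card_image) (simp_all add: W_def card_bit_words)
    finally show ?thesis by simp
  qed
  have "real (card (far_pairs n A p T ca inb outb l)) * real l * real w \<le> (\<Sum>e\<in>E. net_wt l e * net_cap m b w h e)"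
  proof (rule kpairs_weighted_capacity_bound_graph[OF conj, where S = S and k = n and Al = "\<lambda>_. to_nat ` W" and msg = msg
        and src = Src and snk = Snk and D = "net_potential A p T ca inb outb l"])
    show "finite E" "acyclic E" unfolding E_def using p by (simp_all add: finite_net_edges acyclic_net_edges)
    show "0 < net_cap m b w h e" if "e \<in> E" for e
      using that unfolding E_def by (cases rule: net_edges_cases) (use par b m h in \<open>simp_all add: net_cap_def\<close>)
    show "S = PiE {..<n} (\<lambda>_. to_nat ` W)" by (simp add: S_def)
    show "finite (to_nat ` W) \<and> to_nat ` W \<noteq> {} \<and> real w \<le> entropy2 S (\<lambda>x. x i)" if "i < n" for i
      using ent_x[OF that] bit_words_nonempty by (simp add: W_def)
    show "entropy2 S (\<lambda>x. msg x e) \<le> net_cap m b w h e" if "e \<in> E" for e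
      using that unfolding E_def
    proof (cases rule: net_edges_cases)
      case (5 i d)
      then show ?thesis using fS len_y by (simp add: msg_simps net_cap_def entropy2_bits_le)
    next
      case (6 j)
      then show ?thesis using fS lenD by (simp add: msg_simps net_cap_def entropy2_bits_le)
    next
      case (7 g)
      then have "length (mm x ((g + 1) * p)) = m" if "x \<in> S" for x using len_mm[OF that, of "(g + 1) * p"] by simp
      then show ?thesis using fS 7 unfolding 7 msg_simps by (simp add: net_cap_def entropy2_bits_le del: mult_Suc)
    next
      case (8 j)
      then show ?thesis using fS len_bb by (simp add: msg_simps net_cap_def entropy2_bits_le)
    next
      case (9 i j)
      then have "i < T" by (auto simp: prev_access_def)
      then show ?thesis using fS len_bb 9 by (simp add: msg_simps net_cap_def entropy2_bits_le)
    next
      case (10 i j)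
      then have "j < T" by (auto simp: last_access_def)
      then show ?thesis using fS len_bb 10 by (simp add: msg_simps net_cap_def entropy2_bits_le)
    qed (simp_all add: msg_simps net_cap_def ent_x ent_z)
    show "far_pairs n A p T ca inb outb l \<subseteq> {..<n}" by (auto simp: far_pairs_def)
    show "0 \<le> net_wt l e" if "e \<in> E" for e
      using that unfolding E_def by (cases rule: net_edges_cases) (simp_all add: net_wt_def)
    show "\<bar>net_potential A p T ca inb outb l i u - net_potential A p T ca inb outb l i v\<bar> \<le> net_wt l (u, v)"
      if "(u, v) \<in> E" for i u v
      using that unfolding E_def by (rule net_potential_edge)
    show "real l \<le> net_potential A p T ca inb outb l i (Snk i) - net_potential A p T ca inb outb l i (Src i)"
      if "i \<in> far_pairs n A p T ca inb outb l" for i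
      using net_potential_far[OF that] by simp
  next
    fix e x x' assume e: "e \<in> E" and x: "x \<in> S" "x' \<in> S" and src: "\<And>i. i < n \<Longrightarrow> Src i = fst e \<Longrightarrow> x i = x' i"
      and ine: "\<And>e'. e' \<in> E \<Longrightarrow> snd e' = fst e \<Longrightarrow> msg x e' = msg x' e'"
    have hub: "z x i = z x' i" if "fst e = Hub" "i < n" for i
    proof -
      have "x k = x' k" if "k < n" for k
        using ine[of "(Src k, Hub)"] that \<open>fst e = Hub\<close> unfolding E_def by (simp add: msg_simps net_edgesI)
      then have "dec x = dec x'" by (simp add: dec_def decode_words_def)
      then show ?thesis by (simp add: z_def y_def)
    qed
    show "msg x e = msg x' e"
      using e unfolding E_def
    proof (cases rule: net_edges_cases)
      case (5 i d)
      have "to_nat (z x i) = to_nat (z x' i)" "x i = x' i"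
        using ine[of "(Hub, Wrd i)"] ine[of "(Src i, Wrd i)"] 5 unfolding E_def by (simp_all add: msg_simps net_edgesI)
      moreover have "y x ! i = xor_bits (z x i) (dec x ! i)" if "x \<in> S" for x
        using len_y len_d that 5 by (simp add: z_def xor_bits_cancel)
      ultimately have "y x ! i = y x' ! i" using x 5 dec_nth by simp
      then show ?thesis using 5 by (simp add: msg_simps)
    next
      case (6 j)
      have "D x (ca j) = D x' (ca j)"
        unfolding D_def
      proof (rule word_disk_cong[OF yW[OF x(1)] yW[OF x(2)] b(1,2) par(4)])
        fix i d assume i: "i < n" "d < 3" "ca j = i * (w + index_bits n) div b + d"
        have "(Wrd i, Inp (inb i + d)) \<in> E" unfolding E_def using i by (intro net_edgesI)
        from ine[OF this] i 6 have "to_nat (y x ! i) = to_nat (y x' ! i)" by (simp add: inb_def b_def msg_simps)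
        then show "y x ! i = y x' ! i" by simp
      qed
      then show ?thesis using 6 by (simp add: msg_simps)
    next
      case (7 g)
      have "mm x ((g + 1) * p) = mm x' ((g + 1) * p)"
        using phase[OF x, of g "(g + 1) * p"] ine 7 by simp
      then show ?thesis using 7 by (simp add: msg_simps)
    next
      case (8 j)
      have j: "j div p * p \<le> j" "j < j div p * p + p"
        using p div_mult_mod_eq[of j p] mod_less_divisor[of p j] by linarith+
      have "bb x j = bb x' j"
        using phase[OF x, of "j div p" "Suc j"] ine 8 j by simp
      then show ?thesis using 8 by (simp add: msg_simps)
    next
      case (9 i j)
      have "i < T" using 9 by (auto simp: prev_access_def)
      then show ?thesis using ine[of "(Grp (i div p), Ver i)"] 9 unfolding E_def by (simp add: msg_simps net_edgesI)
    next
      case (10 i j)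
      have "j < T" using 10 by (auto simp: last_access_def)
      then show ?thesis using ine[of "(Grp (j div p), Ver j)"] 10 unfolding E_def by (simp add: msg_simps net_edgesI)
    qed (use hub src in \<open>simp_all add: msg_simps\<close>)
  next
    fix i x x' assume i: "i < n" and x: "x \<in> S" "x' \<in> S"
      and ine: "\<And>e'. e' \<in> E \<Longrightarrow> snd e' = Snk i \<Longrightarrow> msg x e' = msg x' e'"
    have z: "z x i = z x' i" using ine[of "(Hub, Snk i)"] i unfolding E_def by (simp add: msg_simps net_edgesI)
    let ?a = "A + outb i"
    have a: "?a < A + n" using outb[OF i] by simp
    have "run_disk m b alg (D x) T ?a = run_disk m b alg (D x') T ?a"
    \<comment> \<open>An output block that is never accessed keeps its initial zeros, the same for
      all messages.\<close>
    proof (cases "\<exists>j<T. ca j = ?a")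
      case True
      then obtain j where j: "last_access ca T j" "ca j = ?a" using ex_last_access by metis
      have "bb x j = bb x' j" using ine[of "(Ver j, Snk i)"] i j unfolding E_def by (simp add: msg_simps net_edgesI)
      then show ?thesis
        using follows_pattern_last[OF fp[OF x(1)] j a] follows_pattern_last[OF fp[OF x(2)] j a] by (simp add: bb_def)
    next
      case False
      then show ?thesis
        using follows_pattern_untouched[OF fp[OF x(1)] _ a] follows_pattern_untouched[OF fp[OF x(2)] _ a] zero[OF x, of ?a] by auto
    qed
    then have "output_word B n w (run_disk m b alg (D x) T) (\<pi> (i + 1)) = output_word B n w (run_disk m b alg (D x') T) (\<pi> (i + 1))"
      by (simp add: output_word_def A_def outb_def)
    then have "y x ! i = y x' ! i" using out[OF yF[OF x(1)] i] out[OF yF[OF x(2)] i] by (simp add: D_def)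
    moreover have "dec x ! i = xor_bits (z x i) (y x ! i)" if "x \<in> S" for x
    proof -
      have "z x i = xor_bits (dec x ! i) (y x ! i)" by (simp add: z_def xor_bits_commute)
      then show ?thesis using len_y[OF that i] len_d[OF that i] by (simp add: xor_bits_cancel)
    qed
    ultimately have "from_nat (x i) = (from_nat (x' i) :: bits)" using x z dec_nth[OF x(1) i] dec_nth[OF x(2) i] by simp
    moreover have "x i \<in> to_nat ` W" "x' i \<in> to_nat ` W" using x i by (simp_all add: S_def PiE_iff)
    then obtain q q' where "q \<in> W" "x i = to_nat q" "q' \<in> W" "x' i = to_nat q'" by blast
    ultimately show "x i = x' i" by simp
  qed simp_all
  also have "\<dots> \<le> real l / 2 * (real n * real w + 2 * (\<Sum>i<n. h i)) + 6 * real n * real w + 3 * real b * real T + real m * (real T / real p)"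
    unfolding E_def by (rule net_weighted_capacity_le[OF p]) (use h in \<open>simp add: less_imp_le\<close>)
  finally show ?thesis .
qed

section \<open>Dense sets of inputs with a common access pattern\<close>

text \<open>With \<open>\<kappa>\<close> about \<open>w / 128\<close>, an offset from a list of
  \<open>K = 4 ^ \<kappa>\<close> costs \<open>2 * \<kappa> \<le> w / 64\<close> bits and a miss
  costs \<open>w\<close>. Since \<open>K * \<eta> = 2 ^ \<kappa>\<close>, unlucky misses are
  negligible. The expected number of misses is at most \<open>(n w / 2^15 + 2 n) / \<kappa>\<close>,
  which costs \<open>n w / 128 + 512 n\<close> bits. The total \<open>n * (513 + 3 w / 128)\<close>
  is at most \<open>n w / 32\<close> once \<open>w \<ge> 65664\<close>; this is where 70000 comes
  from.\<close>

lemma dense_set_code: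
  assumes w: "70000 \<le> w" and F: "F \<subseteq> words (bit_words w) n" "F \<noteq> {}"
    and def: "deficiency (bit_words w) n F \<le> real n * real w / 2 ^ 15"
  shows "\<exists>Y h. (\<forall>x\<in>words (bit_words w) n. Y x \<in> F) \<and>
     (\<forall>i<n. 0 < h i \<and> entropy2 (words (bit_words w) n) (\<lambda>x. to_nat (xor_bits (Y x ! i) (x ! i))) \<le> h i) \<and>
     (\<Sum>i<n. h i) \<le> real n * real w / 32"
proof -
  define Q where "Q = bit_words w"
  define q where "q = real (card Q)"
  define \<kappa> where "\<kappa> = w div 128"
  define \<eta> :: real where "\<eta> = 1 / 2 ^ \<kappa>"
  define K :: nat where "K = 4 ^ \<kappa>"
  define \<rho> where "\<rho> = (1 - \<eta>) ^ K"
  have \<kappa>: "real w / 256 \<le> real \<kappa>" "real \<kappa> \<le> real w / 128" "0 < \<kappa>" using w by (auto simp: \<kappa>_def)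
  have \<eta>: "0 < \<eta>" "\<eta> \<le> 1" by (simp_all add: \<eta>_def)
  have L: "log 2 (1/\<eta>) = real \<kappa>" by (simp add: \<eta>_def)
  have q: "q > 0" by (simp add: q_def Q_def card_bit_words)
  have "\<exists>R Y. (\<forall>i<n. R i \<subseteq> Q \<and> card (R i) \<le> K) \<and> (\<forall>a\<in>({[]} :: bits list set). \<forall>x\<in>words Q n. Y a x \<in> F) \<and>
     log 2 (1/\<eta>) * (\<Sum>a\<in>{[]}. \<Sum>x\<in>words Q n. \<Sum>i<n. of_bool (\<forall>r\<in>R i. xor_bits r (x!i) \<noteq> Y a x ! i))
     \<le> (\<Sum>a\<in>({[]} :: bits list set). real (card Q) ^ n *
          (deficiency Q n F + real n + real n * log 2 (1/\<eta>) * (1 - \<eta>) ^ K))"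
    by (rule transport_into_dense_family[where F = "\<lambda>_. F" and Q = Q and act = xor_bits and \<eta> = \<eta> and A = "{[]}" and n = n and K = K])
      (use F \<eta> bit_words_nonempty in \<open>auto simp: Q_def bij_betw_xor_bits\<close>)
  then obtain R and Y0 :: "bits list \<Rightarrow> bits list \<Rightarrow> bits list" where R0: "\<forall>i<n. R i \<subseteq> Q \<and> card (R i) \<le> K"
    and Y00: "\<forall>a\<in>{[]}. \<forall>x\<in>words Q n. Y0 a x \<in> F"
    and sum0: "log 2 (1/\<eta>) * (\<Sum>a\<in>{[]}. \<Sum>x\<in>words Q n. \<Sum>i<n. of_bool (\<forall>r\<in>R i. xor_bits r (x!i) \<noteq> Y0 a x ! i))
     \<le> (\<Sum>a\<in>({[]} :: bits list set). real (card Q) ^ n *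
          (deficiency Q n F + real n + real n * log 2 (1/\<eta>) * (1 - \<eta>) ^ K))"
    by (elim exE conjE)
  have R: "R i \<subseteq> Q \<and> card (R i) \<le> K" if "i < n" for i using R0 that by blast
  have Y0: "Y0 [] x \<in> F" if "x \<in> words Q n" for x using Y00 that by simp
  have sum: "real \<kappa> * (\<Sum>x\<in>words Q n. \<Sum>i<n. of_bool (\<forall>r\<in>R i. xor_bits r (x!i) \<noteq> Y0 [] x ! i))
       \<le> q ^ n * (deficiency Q n F + real n + real n * real \<kappa> * \<rho>)"
    using sum0 unfolding L \<rho>_def q_def by simp
  define Y where "Y = Y0 []"
  define miss where "miss i x \<longleftrightarrow> (\<forall>r\<in>R i. xor_bits r (x!i) \<noteq> Y x ! i)" for i x
  define cnt where "cnt i = real (card {x\<in>words Q n. miss i x})" for i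
  define h where "h i = 1 + log 2 (real K) + cnt i / q ^ n * real w" for i
  have finQ: "finite Q" by (simp add: Q_def)
  have cardW: "real (card (words Q n)) = q ^ n" using finQ by (simp add: card_words q_def)
  have neW: "words Q n \<noteq> {}" using F by (auto simp: Q_def)
  have logK: "log 2 (real K) = 2 * real \<kappa>"
  proof -
    have "real K = 2 ^ (2 * \<kappa>)" by (simp add: K_def power_mult)
    then have "log 2 (real K) = real (2 * \<kappa>)" by simp
    then show ?thesis by simp
  qed
  have ent: "entropy2 (words Q n) (\<lambda>x. to_nat (xor_bits (Y x ! i) (x ! i))) \<le> h i" if i: "i < n" for i
  proof -
    have len: "length (Y x ! i) = w" "length (x ! i) = w" if "x \<in> words Q n" for x
    proof -
      have "x ! i \<in> set x" "set x \<subseteq> Q" "Y x ! i \<in> set (Y x)" "set (Y x) \<subseteq> Q"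
        using that i Y0[OF that] F by (auto simp: words_def Y_def Q_def)
      then show "length (Y x ! i) = w" "length (x ! i) = w" by (auto simp: Q_def bit_words_def)
    qed
    let ?X = "\<lambda>x. to_nat (xor_bits (Y x ! i) (x ! i))"
    have "entropy2 (words Q n) ?X \<le> 1 + log 2 (real K) +
      real (card {x\<in>words Q n. ?X x \<notin> to_nat ` R i}) / real (card (words Q n)) * log 2 (real (card (to_nat ` Q)))"
    proof (rule entropy2_le_mixture)
      show "?X ` words Q n \<subseteq> to_nat ` Q" using len by (auto simp: Q_def bit_words_def)
      have "finite (R i)" using R[OF i] finQ finite_subset by blast
      then show "finite (to_nat ` R i)" by simp
      show "card (to_nat ` R i) \<le> K" using R[OF i] by (subst card_image) simp_all
    qed (use finQ neW in \<open>simp_all add: K_def\<close>)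
    also have "card (to_nat ` Q) = 2 ^ w" by (subst card_image) (simp_all add: Q_def card_bit_words)
    also have "log 2 (real (2 ^ w)) = real w" by simp
    also have "real (card {x\<in>words Q n. ?X x \<notin> to_nat ` R i}) \<le> cnt i"
      unfolding cnt_def
    proof (intro of_nat_mono card_mono)
      show "{x\<in>words Q n. ?X x \<notin> to_nat ` R i} \<subseteq> {x\<in>words Q n. miss i x}"
      proof clarify
        fix x assume x: "x \<in> words Q n" "?X x \<notin> to_nat ` R i"
        have "False" if r: "r \<in> R i" "xor_bits r (x!i) = Y x ! i" for r
        proof -
          have "length r = w" using r R[OF i] by (auto simp: Q_def bit_words_def)
          then have "xor_bits (Y x ! i) (x ! i) = r" unfolding r(2)[symmetric] using len[OF x(1)] by (intro xor_bits_cancel) simp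
          then show False using x(2) r(1) by auto
        qed
        then show "miss i x" by (auto simp: miss_def)
      qed
    qed (use finQ in simp)
    finally show ?thesis unfolding h_def cardW using q by (simp add: divide_right_mono mult_right_mono)
  qed
  have hpos: "0 < h i" for i unfolding h_def logK using q by (intro add_pos_nonneg) (simp_all add: cnt_def add_pos_nonneg)
  have "(\<Sum>i<n. cnt i) = (\<Sum>x\<in>words Q n. \<Sum>i<n. of_bool (miss i x))"
    unfolding cnt_def using finQ by (subst sum.swap) (simp add: Int_def)
  then have sum': "real \<kappa> * (\<Sum>i<n. cnt i) \<le> q ^ n * (deficiency Q n F + real n + real n * real \<kappa> * \<rho>)"
    using sum by (simp add: miss_def Y_def)
  have \<kappa>\<rho>: "real \<kappa> * \<rho> \<le> 1"
  proof -
    have "\<rho> \<le> exp (- \<eta>) ^ K" unfolding \<rho>_def using \<eta> exp_ge_add_one_self[of "- \<eta>"] by (intro power_mono) auto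
    also have "\<dots> = exp (- (real K * \<eta>))" by (simp add: exp_of_nat_mult[symmetric])
    also have "real K * \<eta> = 2 ^ \<kappa>"
    proof -
      have "real K = 2 ^ \<kappa> * 2 ^ \<kappa>" by (simp add: K_def power_mult_distrib[symmetric])
      then show ?thesis by (simp add: \<eta>_def)
    qed
    finally have "\<rho> \<le> exp (- (2 ^ \<kappa>))" .
    then have "real \<kappa> * \<rho> \<le> 2 ^ \<kappa> * exp (- (2 ^ \<kappa>))"
      using \<eta> by (intro mult_mono) (auto simp: \<rho>_def less_imp_le[OF of_nat_less_two_power])
    also have "\<dots> \<le> exp (2 ^ \<kappa>) * exp (- (2 ^ \<kappa>))"
    proof (rule mult_right_mono)
      show "(2 :: real) ^ \<kappa> \<le> exp (2 ^ \<kappa>)" using exp_ge_add_one_self[of "2 ^ \<kappa> :: real"] by linarith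
    qed simp
    also have "\<dots> = 1" by (simp add: exp_minus)
    finally show ?thesis .
  qed
  have "(\<Sum>i<n. cnt i) / q ^ n \<le> (deficiency Q n F + real n + real n * (real \<kappa> * \<rho>)) / real \<kappa>"
    using sum' q \<kappa>(3) by (simp add: field_simps)
  also have "\<dots> \<le> (real n * real w / 2 ^ 15 + real n + real n) / real \<kappa>"
    using def mult_left_mono[OF \<kappa>\<rho>, of "real n"] by (intro divide_right_mono add_mono) (simp_all add: Q_def)
  also have "\<dots> \<le> (real n * real w / 2 ^ 15 + real n + real n) / (real w / 256)"
    using \<kappa> w by (intro divide_left_mono) auto
  finally have C: "(\<Sum>i<n. cnt i) / q ^ n * real w \<le> (real n * real w / 2 ^ 15 + real n + real n) / (real w / 256) * real w"
    by (intro mult_right_mono) auto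
  also have "\<dots> = real n * real w / 128 + 512 * real n" using w by (simp add: field_simps)
  finally have C: "(\<Sum>i<n. cnt i) / q ^ n * real w \<le> real n * real w / 128 + 512 * real n" .
  have "(\<Sum>i<n. h i) = real n + real n * (2 * real \<kappa>) + (\<Sum>i<n. cnt i) / q ^ n * real w"
    by (simp add: h_def logK sum.distrib sum_divide_distrib sum_distrib_right distrib_left)
  also have "\<dots> \<le> real n + real n * (2 * (real w / 128)) + (real n * real w / 128 + 512 * real n)"
    using \<kappa> C by (intro add_mono mult_left_mono) auto
  also have "\<dots> = real n * (513 + real w * (3 / 128))" by (simp add: algebra_simps)
  also have "\<dots> \<le> real n * (real w / 32)" using w by (intro mult_left_mono) auto
  finally have "(\<Sum>i<n. h i) \<le> real n * real w / 32" by simp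
  then show ?thesis using Y0 ent hpos unfolding Y_def Q_def by blast
qed

section \<open>Counting patterns and the permutations near for a pattern\<close>

definition run_patterns :: "nat \<Rightarrow> nat \<Rightarrow> (nat \<times> (nat \<Rightarrow> nat)) set" where
  "run_patterns N t = Sigma {..t} (\<lambda>T. PiE {..<T} (\<lambda>_. {..<N + T}))"

lemma finite_run_patterns: "finite (run_patterns N t)"
  unfolding run_patterns_def by (intro finite_SigmaI finite_PiE) auto

lemma card_run_patterns_le:
  assumes "1 \<le> N"
  shows "card (run_patterns N t) \<le> (t + 1) * (N + t) ^ t"
proof -
  have "card (run_patterns N t) = (\<Sum>T\<le>t. (N + T) ^ T)"
    unfolding run_patterns_def by (subst card_SigmaI) (auto simp: card_PiE intro!: finite_PiE)
  also have "\<dots> \<le> (\<Sum>T\<le>t. (N + t) ^ t)"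
  proof (rule sum_mono)
    fix T assume "T \<in> {..t}"
    then have "(N + T) ^ T \<le> (N + t) ^ T" "(N + t) ^ T \<le> (N + t) ^ t"
      using assms by (auto intro: power_mono power_increasing)
    then show "(N + T) ^ T \<le> (N + t) ^ t" by simp
  qed
  finally show ?thesis by simp
qed

lemma popular_fibre:
  assumes "finite G" "finite P" "G \<noteq> {}" "\<And>y. y \<in> G \<Longrightarrow> f y \<in> P"
  shows "\<exists>v\<in>P. card G \<le> card {y\<in>G. f y = v} * card P \<and> {y\<in>G. f y = v} \<noteq> {}"
proof (rule ccontr)
  assume neg: "\<not> ?thesis"
  have lt: "card {y\<in>G. f y = v} * card P < card G" if "v \<in> P" for v
  proof (cases "{y\<in>G. f y = v} = {}")
    case True
    show ?thesis unfolding True using assms by (simp add: card_gt_0_iff)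
  next
    case False
    then show ?thesis using neg that by (meson not_le)
  qed
  have P: "P \<noteq> {}" using assms by auto
  have "card G = card (\<Union>v\<in>P. {y\<in>G. f y = v})" using assms(4) by (intro arg_cong[of _ _ card]) auto
  also have "\<dots> \<le> (\<Sum>v\<in>P. card {y\<in>G. f y = v})" by (rule card_UN_le[OF assms(2)])
  finally have "card G * card P \<le> (\<Sum>v\<in>P. card {y\<in>G. f y = v} * card P)"
    by (simp add: sum_distrib_right[symmetric])
  also have "\<dots> < (\<Sum>v\<in>P. card G)" using lt P assms(2) by (intro sum_strict_mono) auto
  finally show False by (simp add: mult.commute)
qed

text \<open>Pigeonhole over the patterns, which include the halting time, so that the outputs are
  all read off at the same \<open>T\<close>. Canonical addresses make the set of patterns
  finite.\<close>

lemma popular_pattern: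
  assumes G: "finite G" "G \<noteq> {}"
    and sol: "\<And>y. y \<in> G \<Longrightarrow> solves_within M B w n alg \<pi> (\<lambda>i. y ! (i - 1)) t"
  shows "\<exists>T ca F. (T, ca) \<in> run_patterns N t \<and> F \<subseteq> G \<and> F \<noteq> {} \<and> card G \<le> card F * card (run_patterns N t) \<and>
    (\<forall>y\<in>F. follows_pattern (M * w) (B * w) alg N T ca (word_disk (B * w) n \<pi> y) \<and>
       (\<forall>i<n. output_word B n w (run_disk (M * w) (B * w) alg (word_disk (B * w) n \<pi> y) T) (\<pi> (i + 1)) = y ! i))"
proof -
  define good where "good y T \<longleftrightarrow> T \<le> t \<and> em_config (M * w) (B * w) alg (word_disk (B * w) n \<pi> y) T \<noteq> None \<and>
    (\<forall>i<n. output_word B n w (run_disk (M * w) (B * w) alg (word_disk (B * w) n \<pi> y) T) (\<pi> (i + 1)) = y ! i)" for y T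
  define time where "time y = (SOME T. good y T)" for y
  have good: "good y (time y)" if y: "y \<in> G" for y
  proof -
    obtain T D where T: "T \<le> t" "halts_at (M * w) (B * w) alg (perm_disk (B * w) n \<pi> (\<lambda>i. y ! (i - 1))) T D"
      "\<And>i. i \<in> {1..n} \<Longrightarrow> output_word B n w D (\<pi> i) = y ! (i - 1)"
      using sol[OF y] unfolding solves_within_def by blast
    then have "good y T"
      using T(3)[of "_ + 1"] by (auto simp: good_def halts_at_def word_disk_def run_disk_def)
    then show ?thesis unfolding time_def by (rule someI)
  qed
  define pat where "pat y = (time y, restrict (canonical_addr N (run_addr (M * w) (B * w) alg (word_disk (B * w) n \<pi> y))) {..<time y})" for y
  have "pat y \<in> run_patterns N t" if "y \<in> G" for y
    using good[OF that] by (auto simp: pat_def run_patterns_def good_def restrict_PiE_iff canonical_addr_less)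
  from popular_fibre[where f = pat, OF G(1) finite_run_patterns G(2) this]
  obtain v where v: "v \<in> run_patterns N t" "card G \<le> card {y\<in>G. pat y = v} * card (run_patterns N t)" "{y\<in>G. pat y = v} \<noteq> {}"
    by blast
  obtain T ca where Tca: "v = (T, ca)" by fastforce
  have "follows_pattern (M * w) (B * w) alg N T ca (word_disk (B * w) n \<pi> y) \<and>
       (\<forall>i<n. output_word B n w (run_disk (M * w) (B * w) alg (word_disk (B * w) n \<pi> y) T) (\<pi> (i + 1)) = y ! i)"
    if "y \<in> G" "pat y = v" for y
  proof -
    have T: "T = time y" "ca = restrict (canonical_addr N (run_addr (M * w) (B * w) alg (word_disk (B * w) n \<pi> y))) {..<T}"
      using that(2) by (auto simp: pat_def Tca)
    have "ca j = canonical_addr N (run_addr (M * w) (B * w) alg (word_disk (B * w) n \<pi> y)) j" if "j < T" for j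
      by (subst T(2)) (simp add: that)
    then show ?thesis using good[OF that(1)] unfolding T(1)[symmetric] by (simp add: good_def follows_pattern_def)
  qed
  then show ?thesis using v unfolding Tca by (intro exI[of _ T] exI[of _ ca] exI[of _ "{y\<in>G. pat y = (T, ca)}"]) (auto simp: Tca)
qed

text \<open>Relates input word \<open>i\<close> and output word \<open>v\<close>, both counted from
  1, without mentioning a permutation: for each pattern the relation is fixed before permutations
  are counted against it.\<close>

definition near_output where
  "near_output B A p T ca inb l i v \<longleftrightarrow>
     (\<exists>j. last_access ca T j \<and> ca j = A + (v - 1) div B \<and> Ver j \<in> nball (core_nbrs p T ca) (Inp (inb (i - 1))) l)"

lemma card_same_block_le:
  assumes "1 \<le> B"
  shows "card {i\<in>{1..n}. (i - 1) div B = k} \<le> B"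
proof -
  have "{i\<in>{1..n}. (i - 1) div B = k} \<subseteq> {k * B + 1..k * B + B}"
  proof
    fix i assume "i \<in> {i\<in>{1..n}. (i - 1) div B = k}"
    then have i: "1 \<le> i" "(i - 1) div B = k" by auto
    have "i - 1 = (i - 1) div B * B + (i - 1) mod B" "(i - 1) mod B < B" using assms by simp_all
    then show "i \<in> {k * B + 1..k * B + B}" unfolding i(2) using i(1) by auto
  qed
  from card_mono[OF _ this] show ?thesis by simp
qed

text \<open>Each version in the ball belongs to at most one output block, and a block holds
  \<open>B\<close> words.\<close>

lemma card_near_output_le:
  assumes p: "1 \<le> p" and B: "1 \<le> B"
  shows "card {v\<in>{1..n}. near_output B A p T ca inb l i v} \<le> B * (5 * p + 1) ^ l"
proof -
  let ?ball = "nball (core_nbrs p T ca) (Inp (inb (i - 1))) l"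
  have ball: "finite ?ball" "card ?ball \<le> (5 * p + 1) ^ l"
    using card_nball_le[of "core_nbrs p T ca" "5 * p"] card_core_nbrs_le[OF p] by blast+
  define S where "S u = {v\<in>{1..n}. \<exists>j. u = Ver j \<and> ca j = A + (v - 1) div B}" for u
  have S: "card (S u) \<le> B" for u
  proof (cases "\<exists>j. u = Ver j")
    case True
    then obtain j where j: "u = Ver j" by blast
    have "S u \<subseteq> {v\<in>{1..n}. (v - 1) div B = ca j - A}" by (auto simp: S_def j)
    then have "card (S u) \<le> card {v\<in>{1..n}. (v - 1) div B = ca j - A}" by (intro card_mono) auto
    also have "\<dots> \<le> B" by (rule card_same_block_le[OF B])
    finally show ?thesis .
  qed (simp add: S_def)
  have "{v\<in>{1..n}. near_output B A p T ca inb l i v} \<subseteq> (\<Union>u\<in>?ball. S u)"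
    by (auto simp: near_output_def S_def)
  then have "card {v\<in>{1..n}. near_output B A p T ca inb l i v} \<le> card (\<Union>u\<in>?ball. S u)"
    using ball(1) by (intro card_mono) (auto simp: S_def)
  also have "\<dots> \<le> (\<Sum>u\<in>?ball. card (S u))" by (rule card_UN_le[OF ball(1)])
  also have "\<dots> \<le> (\<Sum>u\<in>?ball. B)" using S by (intro sum_mono) auto
  also have "\<dots> \<le> B * (5 * p + 1) ^ l" using ball(2) by (simp add: mult.commute)
  finally show ?thesis .
qed

lemma card_far_pairs:
  fixes \<pi> :: "nat \<Rightarrow> nat"
  shows "card (far_pairs n A p T ca inb (\<lambda>i. (\<pi> (i + 1) - 1) div B) l) +
     card {i\<in>{1..n}. near_output B A p T ca inb l i (\<pi> i)} = n"
proof -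
  let ?far = "far_pairs n A p T ca inb (\<lambda>i. (\<pi> (i + 1) - 1) div B) l"
  let ?near = "{i\<in>{1..n}. near_output B A p T ca inb l i (\<pi> i)}"
  have "Suc ` ?far = {1..n} - ?near"
  proof (intro set_eqI iffI)
    fix i assume i: "i \<in> {1..n} - ?near"
    then have "i - 1 \<in> ?far" by (auto simp: far_pairs_def near_output_def)
    moreover have "i = Suc (i - 1)" using i by simp
    ultimately show "i \<in> Suc ` ?far" by blast
  qed (auto simp: far_pairs_def near_output_def)
  moreover have "card (Suc ` ?far) = card ?far" by (simp add: card_image)
  ultimately have "card ?far = card ({1..n} - ?near)" by simp
  also have "\<dots> = n - card ?near" by (subst card_Diff_subset) auto
  finally have "card ?far = n - card ?near" .
  moreover have "card ?near \<le> card {1..n}" by (intro card_mono) auto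
  ultimately show ?thesis by simp
qed

text \<open>For data of all ones, every output block that holds a word must change from its initial
  zeros, and an I/O changes at most one block. Success has probability at least 2/3.\<close>

lemma expected_ios_ge_output_blocks:
  assumes par: "1 \<le> w" "1 \<le> B" "B \<le> M" and alg: "em_algorithm (M * w) alg"
    and err: "\<And>\<pi> d. perm_input n w \<pi> d \<Longrightarrow> error_prob M B w n alg \<pi> d \<le> 1/3"
  shows "\<exists>\<pi> d. perm_input n w \<pi> d \<and> ennreal (2/3 * (real n / real B)) \<le> expected_ios M B w n alg \<pi> d"
proof -
  interpret prob_space coins by (rule prob_space_coins)
  define y where "y = replicate n (replicate w True)"
  define d where "d = (\<lambda>i. y ! (i - 1))"
  have y: "y \<in> words (bit_words w) n" by (auto simp: y_def words_def bit_words_def)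
  have dT: "d i = replicate w True" if "i \<in> {1..n}" for i using that by (auto simp: d_def y_def)
  have inp: "perm_input n w id d" using dT by (simp add: perm_input_def permutes_id)
  let ?S = "{\<omega> \<in> space coins. solves_perm M B w n (alg \<omega>) id d}"
  let ?N = "\<lambda>\<omega>. num_ios (M * w) (B * w) (alg \<omega>) (perm_disk (B * w) n id d)"
  have S: "?S \<in> sets coins" by (rule measurable_solves_perm[OF alg par(3)])
  have "space coins - ?S = {\<omega> \<in> space coins. \<not> solves_perm M B w n (alg \<omega>) id d}" by auto
  then have PS: "2/3 \<le> measure coins ?S" using err[OF inp] prob_compl[OF S] by (simp add: error_prob_def)
  have N: "ennreal (real n / real B) \<le> ?N \<omega>" if sol: "solves_perm M B w n (alg \<omega>) id d" for \<omega>
  proof -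
    obtain T s D where T: "em_config (M * w) (B * w) (alg \<omega>) (perm_disk (B * w) n id d) T = Some (s, D)"
      "em_config (M * w) (B * w) (alg \<omega>) (perm_disk (B * w) n id d) (Suc T) = None"
      "\<And>i. i \<in> {1..n} \<Longrightarrow> output_word B n w D i = d i"
      using sol unfolding solves_perm_def halts_with_def by auto
    let ?A = "output_start (B * w) n w"
    define bl where "bl i = ?A + (i - 1) div B" for i
    have D: "run_disk (M * w) (B * w) (alg \<omega>) (perm_disk (B * w) n id d) T = D" using T(1) by (simp add: run_disk_def)
    have "bl ` {1..n} \<subseteq> {a. D a \<noteq> perm_disk (B * w) n id d a}"
    proof clarify
      fix i assume i: "i \<in> {1..n}" and eq: "D (bl i) = perm_disk (B * w) n id d (bl i)"
      have "perm_disk (B * w) n id d (bl i) = replicate (B * w) False"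
        using word_disk_zero[OF y, of "B * w" "bl i" id] par by (simp add: word_disk_def d_def bl_def)
      then have "output_word B n w D i = replicate (min w (B * w - (i - 1) mod B * w)) False"
        using eq by (simp add: output_word_def bl_def min.commute)
      moreover have "output_word B n w D i = replicate w True" using T(3)[OF i] dT[OF i] by simp
      moreover have "w \<le> B * w - (i - 1) mod B * w"
      proof -
        have "(i - 1) mod B + 1 \<le> B" using par mod_less_divisor[of B "i - 1"] by linarith
        from mult_le_mono1[OF this, of w] show ?thesis by simp
      qed
      ultimately show False using par by (simp add: min_def)
    qed
    then have "card (bl ` {1..n}) \<le> T"
      using card_changed_blocks_le[of "M * w" "B * w" "alg \<omega>" "perm_disk (B * w) n id d" T] T(1) card_mono
      unfolding D by (metis (no_types, lifting) option.distinct(1) order_trans)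
    moreover have "n \<le> B * card (bl ` {1..n})"
    proof -
      have "card {1..n} \<le> card (\<Union>v\<in>bl ` {1..n}. {i\<in>{1..n}. bl i = v})" by (intro card_mono) auto
      also have "\<dots> \<le> (\<Sum>v\<in>bl ` {1..n}. card {i\<in>{1..n}. bl i = v})" by (intro card_UN_le) simp
      also have "\<dots> \<le> (\<Sum>v\<in>bl ` {1..n}. B)"
      proof (rule sum_mono)
        fix v
        have "card {i\<in>{1..n}. bl i = v} \<le> card {i\<in>{1..n}. (i - 1) div B = v - ?A}"
          by (intro card_mono) (auto simp: bl_def)
        also have "\<dots> \<le> B" by (rule card_same_block_le[OF par(2)])
        finally show "card {i\<in>{1..n}. bl i = v} \<le> B" .
      qed
      finally show ?thesis by (simp add: mult.commute)
    qed
    ultimately have "n \<le> B * T" by (meson le_trans mult_le_mono2)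
    then have "real n \<le> real B * real T" by (metis of_nat_le_iff of_nat_mult)
    then have "real n / real B \<le> real T" using par by (simp add: field_simps)
    moreover have "?N \<omega> = of_nat T"
      by (rule num_ios_halts_at[where D = D]) (use T in \<open>auto simp: halts_at_def\<close>)
    ultimately show ?thesis by (simp add: ennreal_of_nat_eq_real_of_nat ennreal_leI)
  qed
  have "ennreal (2/3 * (real n / real B)) \<le> ennreal (real n / real B) * ennreal (measure coins ?S)"
    using mult_left_mono[OF PS, of "real n / real B"]
    by (subst ennreal_mult[symmetric]) (auto intro!: ennreal_leI simp: mult.commute)
  also have "\<dots> = (\<integral>\<^sup>+\<omega>. ennreal (real n / real B) * indicator ?S \<omega> \<partial>coins)"
    using S by (subst nn_integral_cmult_indicator) (auto simp: emeasure_eq_measure)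
  also have "\<dots> \<le> expected_ios M B w n alg id d"
    unfolding expected_ios_def using N by (intro nn_integral_mono) (auto simp: indicator_def)
  finally show ?thesis using inp by blast
qed

section \<open>Good permutations\<close>

text \<open>Half of all pairs of permutation and data succeed. A permutation outside the set counts
  for less than a quarter of its data and one inside for at most all, so the set contains at least a
  quarter of the permutations.\<close>

lemma many_good_permutations:
  assumes par: "1 \<le> w" "1 \<le> B" "B \<le> M" and alg: "em_algorithm (M * w) alg"
    and err: "\<And>\<pi> d. perm_input n w \<pi> d \<Longrightarrow> error_prob M B w n alg \<pi> d \<le> 1/3"
    and ios: "\<And>\<pi> d. perm_input n w \<pi> d \<Longrightarrow> expected_ios M B w n alg \<pi> d \<le> ennreal Z"
    and t: "6 * Z \<le> real t + 1" "0 \<le> Z"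
  shows "\<exists>\<omega>. fact n \<le> 4 * card {\<pi>. \<pi> permutes {1..n} \<and>
     (2 ^ w) ^ n \<le> 4 * card {y \<in> words (bit_words w) n. solves_within M B w n (alg \<omega>) \<pi> (\<lambda>i. y ! (i - 1)) t}}"
proof -
  let ?sol = "\<lambda>\<omega>. solves_within M B w n (alg \<omega>)"
  define W where "W = words (bit_words w) n"
  define df where "df = (\<lambda>y i. (y :: bits list) ! (i - 1))"
  define Pm where "Pm = {\<pi>. \<pi> permutes {1..n}}"
  have W: "finite W" "card W = (2 ^ w) ^ n" by (simp_all add: W_def card_words card_bit_words)
  have Pm: "finite Pm" "card Pm = fact n" by (simp_all add: Pm_def finite_permutations card_permutations)
  have inj: "inj_on df W"
  proof (rule inj_onI)
    fix y z assume y: "y \<in> W" "z \<in> W" "df y = df z"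
    show "y = z"
    proof (rule nth_equalityI)
      fix i
      have "df y (i + 1) = df z (i + 1)" using y(3) by simp
      then show "y ! i = z ! i" by (simp add: df_def)
    qed (use y in \<open>simp add: W_def words_def\<close>)
  qed
  define I where "I = Pm \<times> df ` W"
  have inp: "perm_input n w \<pi> d" if \<pi>d: "(\<pi>, d) \<in> I" for \<pi> d
  proof -
    obtain y where y: "y \<in> W" "d = df y" "\<pi> permutes {1..n}" using \<pi>d by (auto simp: I_def Pm_def)
    have "length (y ! (i - 1)) = w" if "i \<in> {1..n}" for i
    proof -
      have "y ! (i - 1) \<in> set y" "set y \<subseteq> bit_words w" using y(1) that by (auto simp: W_def words_def)
      then show ?thesis by (auto simp: bit_words_def)
    qed
    then show ?thesis using y by (simp add: perm_input_def df_def)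
  qed
  have "finite I" using W Pm by (simp add: I_def)
  then obtain \<omega> where \<omega>: "card I \<le> 2 * card {(\<pi>, d) \<in> I. ?sol \<omega> \<pi> d t}"
    using good_coins_exist[OF alg par(3) _ err[OF inp] ios[OF inp] t] by blast
  define g where "g \<pi> = card {y \<in> W. ?sol \<omega> \<pi> (df y) t}" for \<pi>
  define Gd where "Gd = {\<pi>\<in>Pm. (2 ^ w) ^ n \<le> 4 * g \<pi>}"
  have "card {(\<pi>, d) \<in> I. ?sol \<omega> \<pi> d t} = (\<Sum>\<pi>\<in>Pm. g \<pi>)"
  proof -
    have "{(\<pi>, d) \<in> I. ?sol \<omega> \<pi> d t} =
        Sigma Pm (\<lambda>\<pi>. df ` {y \<in> W. ?sol \<omega> \<pi> (df y) t})"
      by (auto simp: I_def)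
    moreover have "card (df ` {y \<in> W. ?sol \<omega> \<pi> (df y) t}) = g \<pi>" for \<pi>
      unfolding g_def by (rule card_image) (rule inj_on_subset[OF inj], auto)
    ultimately show ?thesis using Pm W by (simp add: card_SigmaI)
  qed
  moreover have "card I = fact n * (2 ^ w) ^ n"
    using W Pm inj by (simp add: I_def card_cartesian_product card_image)
  ultimately have "4 * (fact n * (2 ^ w) ^ n) \<le> 2 * (\<Sum>\<pi>\<in>Pm. 4 * g \<pi>)"
    using \<omega> by (simp add: sum_distrib_left[symmetric])
  also have "(\<Sum>\<pi>\<in>Pm. 4 * g \<pi>) \<le> (\<Sum>\<pi>\<in>Pm. (2 ^ w) ^ n + of_bool (\<pi> \<in> Gd) * (4 * (2 ^ w) ^ n))"
  proof (rule sum_mono)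
    fix \<pi> assume "\<pi> \<in> Pm"
    have "g \<pi> \<le> card W" unfolding g_def using W by (intro card_mono) auto
    then show "4 * g \<pi> \<le> (2 ^ w) ^ n + of_bool (\<pi> \<in> Gd) * (4 * (2 ^ w) ^ n)"
      using \<open>\<pi> \<in> Pm\<close> W by (cases "\<pi> \<in> Gd") (auto simp: Gd_def)
  qed
  also have "\<dots> = fact n * (2 ^ w) ^ n + card Gd * (4 * (2 ^ w) ^ n)"
    using Pm by (simp add: sum.distrib sum_distrib_right[symmetric] Gd_def Int_def del: sum_of_bool_mult_eq sum_mult_of_bool_eq)
  finally have "4 * fact n * (2 ^ w) ^ n \<le> (2 * fact n + 8 * card Gd) * (2 ^ w) ^ n"
    by (simp add: algebra_simps)
  then have "4 * fact n \<le> 2 * fact n + 8 * card Gd" by (simp only: mult_le_cancel2) simp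
  then have "fact n \<le> 4 * card Gd" by simp
  then show ?thesis unfolding Gd_def Pm_def g_def W_def df_def by (intro exI[of _ \<omega>]) simp
qed

text \<open>Union bound: the permutations that have \<open>q\<close> near points under some pattern
  are less than a quarter of all and cannot exhaust \<open>Gd\<close>. All patterns are excluded at
  once because the popular pattern depends on the permutation.\<close>

lemma good_permutation_far:
  fixes P :: "(nat \<times> (nat \<Rightarrow> nat)) set"
  assumes p: "1 \<le> p" and B: "1 \<le> B" and P: "finite P"
    and Gd: "fact n \<le> 4 * card Gd" "Gd \<subseteq> {\<pi>. \<pi> permutes {1..n}}"
    and small: "real (card P) * 4 ^ n * (real (B * (5 * p + 1) ^ l) / real n) ^ q < 1/4"
  shows "\<exists>\<pi>\<in>Gd. \<forall>(T, ca)\<in>P. card {i\<in>{1..n}. near_output B A p T ca inb l i (\<pi> i)} < q"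
proof (rule ccontr)
  assume neg: "\<not> ?thesis"
  define bad where "bad = (\<lambda>(T, ca). {\<pi>. \<pi> permutes {1..n} \<and> q \<le> card {i\<in>{1..n}. near_output B A p T ca inb l i (\<pi> i)}})"
  let ?c = "4 ^ n * fact n * (real (B * (5 * p + 1) ^ l) / real n) ^ q"
  have bad: "real (card (bad x)) \<le> ?c" for x
  proof -
    obtain T ca where x: "x = (T, ca)" by fastforce
    have "real (card {\<pi>. \<pi> permutes {1..n} \<and> q \<le> card {i\<in>{1..n}. near_output B A p T ca inb l i (\<pi> i)}})
      \<le> 4 ^ card {1..n} * fact (card {1..n}) * (real (B * (5 * p + 1) ^ l) / real (card {1..n})) ^ q"
      by (rule card_permutations_many_near_le) (use card_near_output_le[OF p B] B in auto)
    then show ?thesis by (simp add: bad_def x)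
  qed
  have fin: "finite (\<Union>x\<in>P. bad x)"
    by (rule finite_subset[of _ "{\<pi>. \<pi> permutes {1..n}}"]) (auto simp: bad_def finite_permutations)
  have "Gd \<subseteq> (\<Union>x\<in>P. bad x)"
  proof
    fix \<pi> assume \<pi>: "\<pi> \<in> Gd"
    then obtain T ca where "(T, ca) \<in> P" "\<not> card {i\<in>{1..n}. near_output B A p T ca inb l i (\<pi> i)} < q" using neg by blast
    then show "\<pi> \<in> (\<Union>x\<in>P. bad x)" using \<pi> Gd(2) by (auto simp: bad_def not_less intro!: bexI[of _ "(T, ca)"])
  qed
  then have "real (card Gd) \<le> real (card (\<Union>x\<in>P. bad x))" using fin by (intro of_nat_mono card_mono)
  also have "\<dots> \<le> (\<Sum>x\<in>P. real (card (bad x)))"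
    using card_UN_le[OF P, of bad] by (metis of_nat_le_iff of_nat_sum)
  also have "\<dots> \<le> (\<Sum>x\<in>P. ?c)" by (intro sum_mono bad)
  also have "\<dots> = fact n * (real (card P) * 4 ^ n * (real (B * (5 * p + 1) ^ l) / real n) ^ q)" by simp
  also have "\<dots> < fact n * (1/4)" using small by (intro mult_strict_left_mono) auto
  finally have "4 * real (card Gd) < fact n" by simp
  moreover have "real (fact n) \<le> real (4 * card Gd)" using Gd(1) by (simp only: of_nat_le_iff)
  ultimately show False by simp
qed

text \<open>Demand \<open>15/16\<close>, minus the hub share
  \<open>1/2 * (1 + 1/16) = 17/32\<close>, leaves \<open>13/32\<close> of \<open>n l w\<close>. The
  5 is 3 from the block edges plus 2 from the memory edges; a common factor \<open>w\<close>
  cancels.\<close>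

lemma solves_slow_if_far:
  assumes conj: "undirected_k_pairs_conjecture"
    and par: "70000 \<le> w" "1 \<le> B" "B \<le> M" "index_bits n \<le> w" and \<pi>: "\<pi> permutes {1..n}"
    and alg: "\<And>j s. length s = M * w \<Longrightarrow> length (fst (alg j s)) = M * w"
    and G: "(2 ^ w) ^ n \<le> 4 * card {y \<in> words (bit_words w) n. solves_within M B w n alg \<pi> (\<lambda>i. y ! (i - 1)) t}"
  defines "A \<equiv> output_start (B * w) n w" and "p \<equiv> M div B"
    and "inb \<equiv> \<lambda>i. i * (w + index_bits n) div (B * w)"
  assumes P: "log 2 (4 * real (card (run_patterns (A + n) t))) \<le> real n * real w / 2 ^ 15"
    and far: "\<And>T ca. (T, ca) \<in> run_patterns (A + n) t \<Longrightarrow>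
       16 * card {i\<in>{1..n}. near_output B A p T ca inb l i (\<pi> i)} \<le> n"
  shows "13 / 32 * real n * real l \<le> 6 * real n + 5 * real B * real t"
proof -
  define W where "W = words (bit_words w) n"
  define Gs where "Gs = {y \<in> W. solves_within M B w n alg \<pi> (\<lambda>i. y ! (i - 1)) t}"
  have "finite Gs" by (simp add: Gs_def W_def)
  moreover have cG: "(2 ^ w) ^ n \<le> 4 * card Gs" using G by (simp add: Gs_def W_def)
  then have "Gs \<noteq> {}" by (auto simp: card_eq_0_iff)
  ultimately obtain T ca F where F: "(T, ca) \<in> run_patterns (A + n) t" "F \<subseteq> Gs" "F \<noteq> {}"
    "card Gs \<le> card F * card (run_patterns (A + n) t)"
    and run: "\<And>y. y \<in> F \<Longrightarrow> follows_pattern (M * w) (B * w) alg (A + n) T ca (word_disk (B * w) n \<pi> y)"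
    and out: "\<And>y i. y \<in> F \<Longrightarrow> i < n \<Longrightarrow>
       output_word B n w (run_disk (M * w) (B * w) alg (word_disk (B * w) n \<pi> y) T) (\<pi> (i + 1)) = y ! i"
    using popular_pattern[of Gs M B w n alg \<pi> t "A + n"] unfolding Gs_def by blast
  have FW: "F \<subseteq> words (bit_words w) n" using F by (auto simp: Gs_def W_def)
  then have finF: "finite F" by (rule finite_subset) simp
  have F0: "0 < real (card F)" using finF F(3) by (simp add: card_gt_0_iff)
  have "deficiency (bit_words w) n F \<le> log 2 (4 * real (card (run_patterns (A + n) t)))"
  proof -
    have "(2 ^ w) ^ n \<le> 4 * (card F * card (run_patterns (A + n) t))" using cG F(4) by linarith
    then have "real ((2 ^ w) ^ n) \<le> real (4 * (card F * card (run_patterns (A + n) t)))" by (simp only: of_nat_le_iff)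
    then have "(2 ^ w) ^ n / real (card F) \<le> 4 * real (card (run_patterns (A + n) t))"
      using F0 by (simp add: field_simps)
    then show ?thesis unfolding deficiency_def card_bit_words using F0 by (intro log_mono) auto
  qed
  then have "deficiency (bit_words w) n F \<le> real n * real w / 2 ^ 15" using P by linarith
  from dense_set_code[OF par(1) FW F(3) this] obtain Y h where Y: "\<And>x. x \<in> words (bit_words w) n \<Longrightarrow> Y x \<in> F"
    and h: "\<And>i. i < n \<Longrightarrow> 0 < h i \<and> entropy2 (words (bit_words w) n) (\<lambda>x. to_nat (xor_bits (Y x ! i) (x ! i))) \<le> h i"
    and hs: "(\<Sum>i<n. h i) \<le> real n * real w / 32"
    by blast
  let ?far = "far_pairs n A p T ca inb (\<lambda>i. (\<pi> (i + 1) - 1) div B) l"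
  have w1: "1 \<le> w" using par by simp
  have bound: "real (card ?far) * real l * real w \<le>
     real l / 2 * (real n * real w + 2 * (\<Sum>i<n. h i)) + 6 * real n * real w + 3 * real (B * w) * real T + real (M * w) * (real T / real p)"
    unfolding A_def p_def inb_def
    by (rule run_network_bound[OF conj w1 par(2,3,4) \<pi> alg FW Y run[unfolded A_def] out h])
  have "card ?far + card {i\<in>{1..n}. near_output B A p T ca inb l i (\<pi> i)} = n" by (rule card_far_pairs)
  then have "15 * n \<le> 16 * card ?far" using far[OF F(1)] by linarith
  then have "real (15 * n) \<le> real (16 * card ?far)" by (simp only: of_nat_le_iff)
  then have farn: "15 / 16 * real n \<le> real (card ?far)" by simp
  have T: "T \<le> t" using F(1) by (simp add: run_patterns_def)
  have p: "1 \<le> p" using par by (simp add: p_def Suc_le_eq div_greater_zero_iff)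
  \<comment> \<open>Rounding \<open>M / B\<close> down to \<open>p\<close> loses at most a factor 2,
    so a memory spread over the \<open>p\<close> I/Os of a phase costs at most two blocks per
    I/O.\<close>
  have "M \<le> 2 * (p * B)"
  proof -
    have "M = p * B + M mod B" "M mod B < B" using par by (simp_all add: p_def)
    moreover have "B \<le> p * B" using p by simp
    ultimately show ?thesis by linarith
  qed
  then have "real M \<le> real (2 * (p * B))" by (simp only: of_nat_le_iff)
  then have Mp: "real M / real p \<le> 2 * real B" using p by (simp add: field_simps)
  have "15 / 16 * real n * real l * real w \<le> real (card ?far) * real l * real w"
    using farn by (intro mult_right_mono) auto
  also note bound
  also have "real l / 2 * (real n * real w + 2 * (\<Sum>i<n. h i)) \<le> real l / 2 * (real n * real w + 2 * (real n * real w / 32))"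
    using hs by (intro mult_left_mono add_left_mono) auto
  also have "real (M * w) * (real T / real p) = (real M / real p) * (real T * real w)" by simp
  also have "\<dots> \<le> (2 * real B) * (real t * real w)"
    using Mp T by (intro mult_mono mult_right_mono) auto
  also have "3 * real (B * w) * real T \<le> 3 * real B * (real t * real w)"
    using mult_left_mono[OF mult_right_mono[of "real T" "real t" "real w"], of "3 * real B"] T by (simp add: mult_ac)
  finally have "15 / 16 * real n * real l * real w \<le> real l / 2 * (real n * real w + 2 * (real n * real w / 32)) +
     6 * real n * real w + 3 * real B * (real t * real w) + 2 * real B * (real t * real w)" by simp
  then have "(13 / 32 * real n * real l) * real w \<le> (6 * real n + 5 * real B * real t) * real w"
    by (simp add: algebra_simps)
  then show ?thesis using w1 by (simp only: mult_le_cancel_right_pos of_nat_0_less_iff)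
qed

section \<open>Choice of the parameters\<close>

lemma log2_of_nat_le: "log 2 (real k) \<le> real k"
proof (cases "k = 0")
  case False
  have "log 2 (real k) \<le> log 2 (2 ^ k)"
    using False of_nat_less_two_power[of k, where 'a = real] by (intro log_mono) auto
  then show ?thesis by simp
qed (simp add: log_def)

lemma output_start_le:
  assumes "1 \<le> B" "1 \<le> w" "index_bits n \<le> w" "1 \<le> n"
  shows "output_start (B * w) n w \<le> 3 * n"
proof -
  have "real (n * (w + index_bits n)) / real (B * w) \<le> real (n * (2 * w)) / real (1 * w)"
    using assms by (intro frac_le of_nat_mono mult_le_mono) auto
  also have "\<dots> = real (2 * n)" using assms by simp
  finally have "\<lceil>real (n * (w + index_bits n)) / real (B * w)\<rceil> \<le> int (2 * n)"
    by (simp add: ceiling_le_iff)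
  then have "output_start (B * w) n w \<le> 2 * n" unfolding output_start_def by (simp only: nat_le_iff)
  then show ?thesis by simp
qed

lemma run_patterns_card_log_le:
  assumes n: "8 \<le> n" and A: "A \<le> 3 * n" and t: "t \<le> n"
  shows "real (card (run_patterns (A + n) t)) \<le> 2 powr ((2 + 2 * real t) * log 2 (real n))"
proof -
  have "card (run_patterns (A + n) t) \<le> (t + 1) * (A + n + t) ^ t"
    using n by (intro card_run_patterns_le) auto
  also have "\<dots> \<le> (n * n) * (n * n) ^ t"
  proof (intro mult_le_mono power_mono)
    have "8 * n \<le> n * n" using n by (rule mult_le_mono1)
    then show "t + 1 \<le> n * n" "A + n + t \<le> n * n" using A t n by linarith+
  qed simp
  also have "\<dots> = n ^ (2 + 2 * t)" by (simp add: power_add power_mult power2_eq_square)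
  finally have "real (card (run_patterns (A + n) t)) \<le> real (n ^ (2 + 2 * t))" by (simp only: of_nat_le_iff)
  also have "\<dots> = real n powr (2 + 2 * real t)"
    using n powr_realpow[of "real n" "2 + 2 * t"] by simp
  also have "\<dots> = (2 powr log 2 (real n)) powr (2 + 2 * real t)" using n by simp
  also have "\<dots> = 2 powr ((2 + 2 * real t) * log 2 (real n))" by (simp only: powr_powr mult.commute)
  finally show ?thesis .
qed

text \<open>\<open>X\<close> stands for the minimum in the theorem and \<open>t\<close> for six
  times the supposed cost, as Markov's inequality requires. The bound 70000 gives the same bound for
  \<open>w\<close>; \<open>262144 = 2 ^ 18\<close> absorbs \<open>4 * log n\<close> into
  \<open>n * log n / 2 ^ 16\<close>; a logarithm above 198 absorbs the losses \<open>6 n\<close> and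
  \<open>4 ^ n\<close>.\<close>

locale parameter_regime =
  fixes n w M B t :: nat and X :: real
  assumes n: "70000 \<le> log 2 (real n)" "262144 \<le> n" "log 2 (real n) \<le> real w"
    and BM: "1 \<le> B" "B \<le> M"
    and X: "0 \<le> X" "X \<le> real n" "X \<le> real n / real B * log (2 * real M / real B) (real n / real B)"
    and Lg: "198 < log (2 * real M / real B) (real n / real B)"
    and t: "real t \<le> 6 * (X / 2 ^ 21)"
begin

definition "lam = log 2 (real n)"
definition "beta = log 2 (real n / real B)"
definition "mu = log 2 (2 * real M / real B)"
definition "Lgr = log (2 * real M / real B) (real n / real B)"
text \<open>As \<open>5 * p + 1 \<le> (2M/B) ^ 3\<close>, radius \<open>Lgr / 6\<close> keeps the
  ball below \<open>(2M/B) powr (Lgr / 2)\<close>, the square root of \<open>n / B\<close>.\<close>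

definition "lev = nat \<lfloor>Lgr / 6\<rfloor>"
text \<open>Fewer than \<open>quota\<close> near points means at most \<open>n div 16\<close>, which
  leaves at least \<open>15/16\<close> of the pairs far.\<close>

definition "quota = n div 16 + 1"

lemma pos: "0 < real n" "0 < real B" "0 < real M"
  using n BM by auto

lemma mu_ge: "1 \<le> mu"
proof -
  have "2 \<le> 2 * real M / real B" using BM pos by (simp add: field_simps)
  then have "log 2 2 \<le> mu" unfolding mu_def by (intro log_mono) auto
  then show ?thesis by simp
qed

lemma beta_eq: "beta = Lgr * mu"
proof -
  have "ln (2 * real M / real B) \<noteq> 0" using mu_ge by (auto simp: mu_def log_def)
  then show ?thesis by (simp add: beta_def mu_def Lgr_def log_def)
qed

lemma beta_ge: "Lgr \<le> beta" "198 < beta"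
proof -
  have "Lgr * 1 \<le> Lgr * mu" using mu_ge Lg by (intro mult_left_mono) (auto simp: Lgr_def)
  then show "Lgr \<le> beta" by (simp add: beta_eq)
  then show "198 < beta" using Lg by (simp add: Lgr_def)
qed

lemma beta_lam: "beta = lam - log 2 (real B)"
  using pos by (simp add: beta_def lam_def log_divide)

text \<open>Patterns cost \<open>log n\<close> bits per I/O, but distances gain only
  \<open>beta = log (n/B)\<close>. If \<open>B * B \<le> n\<close>, then
  \<open>log n \<le> 2 * beta\<close> and \<open>X \<le> n\<close> suffices. Otherwise
  \<open>log n < 2 * log B \<le> 2 * B\<close>, up to equality, and this factor \<open>B\<close> is
  cancelled by \<open>X \<le> n / B * beta\<close>.\<close>

lemma X_lam_le: "X * lam \<le> 2 * real n * beta"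
proof (cases "B * B \<le> n")
  case True
  then have "real (B * B) \<le> real n" by (simp only: of_nat_le_iff)
  then have "log 2 (real (B * B)) \<le> lam" unfolding lam_def using pos by (intro log_mono) auto
  then have "2 * log 2 (real B) \<le> lam" using pos by (simp add: log_mult)
  then have "lam \<le> 2 * beta" by (simp add: beta_lam)
  then have "X * lam \<le> real n * (2 * beta)" using X n beta_ge by (intro mult_mono) (auto simp: lam_def)
  then show ?thesis by simp
next
  case False
  then have "real n \<le> real (B * B)" by (simp only: of_nat_le_iff)
  then have "lam \<le> log 2 (real (B * B))" unfolding lam_def using pos by (intro log_mono) auto
  then have lam: "lam \<le> 2 * real B" using pos log2_of_nat_le[of B] by (simp add: log_mult)
  have "X \<le> real n / real B * beta"
    using X(3) beta_ge(1) pos by (intro order_trans[OF X(3)] mult_left_mono) (auto simp: Lgr_def)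
  then have "X * lam \<le> (real n / real B * beta) * (2 * real B)"
    using lam X n beta_ge by (intro mult_mono) (auto simp: lam_def)
  then show ?thesis using pos by simp
qed

lemma t_lam_le: "real t * lam \<le> 12 * (real n * beta) / 2 ^ 21" "real t * lam \<le> 6 * (real n * lam) / 2 ^ 21"
proof -
  have lam: "0 \<le> lam" using n by (simp add: lam_def)
  have *: "real t * lam \<le> 6 * (X / 2 ^ 21) * lam" using t lam by (intro mult_right_mono)
  then show "real t * lam \<le> 12 * (real n * beta) / 2 ^ 21" using X_lam_le by simp
  have "X * lam \<le> real n * lam" using X lam by (intro mult_right_mono)
  then show "real t * lam \<le> 6 * (real n * lam) / 2 ^ 21" using * by simp
qed

lemma t_le: "t \<le> n"
proof -
  have "real t \<le> real n" using t X by simp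
  then show ?thesis by simp
qed

lemma B_t_le: "real B * real t \<le> 6 * (real n * Lgr) / 2 ^ 21"
proof -
  have "6 * (X / 2 ^ 21) \<le> 6 * ((real n / real B * Lgr) / 2 ^ 21)"
    using X(3) unfolding Lgr_def by (intro mult_left_mono divide_right_mono) auto
  then have "real B * real t \<le> real B * (6 * ((real n / real B * Lgr) / 2 ^ 21))"
    using t by (intro mult_left_mono order_trans[OF t]) auto
  then show ?thesis using pos by simp
qed

lemma lev: "real lev \<le> Lgr / 6" "Lgr / 6 - 1 < real lev"
  using Lg unfolding lev_def Lgr_def by linarith+

lemma contradiction_at_lev: "\<not> 13 / 32 * real n * real lev \<le> 6 * real n + 5 * real B * real t"
proof
  assume "13 / 32 * real n * real lev \<le> 6 * real n + 5 * real B * real t"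
  also have "\<dots> \<le> 6 * real n + 5 * (6 * (real n * Lgr) / 2 ^ 21)" using B_t_le by simp
  finally have "real n * (13 / 32 * real lev) \<le> real n * (6 + 30 * Lgr / 2 ^ 21)"
    by (simp add: algebra_simps)
  then have "13 / 32 * real lev \<le> 6 + 30 * Lgr / 2 ^ 21" using pos by (simp only: mult_le_cancel_left_pos)
  then have "13 / 32 * real lev \<le> 6 + Lgr / 1000" using Lg by (simp add: Lgr_def)
  then show False using lev(2) Lg unfolding Lgr_def by linarith
qed

lemma pattern_count_small_for_data:
  assumes A: "A \<le> 3 * n"
  shows "log 2 (4 * real (card (run_patterns (A + n) t))) \<le> real n * real w / 2 ^ 15"
proof -
  let ?c = "real (card (run_patterns (A + n) t))"
  have lam: "70000 \<le> lam" using n by (simp add: lam_def)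
  have "log 2 (4 * ?c) \<le> 2 + (2 + 2 * real t) * lam"
  proof (cases "?c = 0")
    case True
    then have "log 2 (4 * ?c) = 0" by (simp add: log_def)
    then show ?thesis using lam by simp
  next
    case False
    then have "0 < ?c" by simp
    have c: "?c \<le> 2 powr ((2 + 2 * real t) * lam)"
      unfolding lam_def by (rule run_patterns_card_log_le) (use n A t_le in auto)
    then have "log 2 ?c \<le> log 2 (2 powr ((2 + 2 * real t) * lam))" using \<open>0 < ?c\<close> by (intro log_mono) auto
    moreover have "log 2 (4 * ?c) = log 2 4 + log 2 ?c" using \<open>0 < ?c\<close> by (intro log_mult_pos) auto
    moreover have "log 2 (4 :: real) = 2"
    proof -
      have "log 2 ((2 :: real) ^ 2) = 2" by (subst log_nat_power) auto
      then show ?thesis by simp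
    qed
    ultimately show ?thesis by simp
  qed
  also have "\<dots> = 2 + 2 * lam + 2 * (real t * lam)" by (simp add: algebra_simps)
  also have "\<dots> \<le> 4 * lam + 2 * (6 * (real n * lam) / 2 ^ 21)" using t_lam_le(2) lam by linarith
  also have "4 * lam \<le> real n * lam / 2 ^ 16"
    using mult_right_mono[of 262144 "real n" lam] n lam by simp
  also have "real n * lam / 2 ^ 16 + 2 * (6 * (real n * lam) / 2 ^ 21) \<le> real n * lam / 2 ^ 15"
    using pos lam by (simp add: field_simps)
  also have "\<dots> \<le> real n * real w / 2 ^ 15"
    using n pos unfolding lam_def by (intro divide_right_mono mult_left_mono) auto
  finally show ?thesis by simp
qed

text \<open>Each of the at least \<open>n / 16\<close> near points contributes a factor
  \<open>2 powr (- beta / 2)\<close>, a gain of \<open>n * beta / 32\<close> bits. Against it stand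
  at most \<open>4 n\<close> bits from \<open>2 * lam + 2 * n\<close> and a tiny fraction of
  \<open>n * beta\<close> from \<open>2 * t * lam\<close>; \<open>beta > 198\<close>
  decides.\<close>

lemma pattern_count_small_for_permutations:
  assumes A: "A \<le> 3 * n"
  shows "real (card (run_patterns (A + n) t)) * 4 ^ n * (real (B * (5 * (M div B) + 1) ^ lev) / real n) ^ quota < 1/4"
proof -
  define p where "p = M div B"
  have p: "1 \<le> p" using BM by (simp add: p_def Suc_le_eq div_greater_zero_iff)
  have pM: "real p \<le> real M / real B" unfolding p_def by (rule of_nat_div_le_of_nat)
  have two_mu: "2 * real M / real B = 2 powr mu" using pos by (simp add: mu_def)
  have base: "real (5 * p + 1) \<le> (2 powr mu) ^ 3"
  proof -
    have "p ^ 1 \<le> p ^ 3" using p by (intro power_increasing) auto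
    then have "5 * p + 1 \<le> (2 * p) ^ 3" using p by (simp add: power_mult_distrib)
    then have "real (5 * p + 1) \<le> real ((2 * p) ^ 3)" by (simp only: of_nat_le_iff)
    also have "\<dots> = (2 * real p) ^ 3" by simp
    also have "\<dots> \<le> (2 powr mu) ^ 3" using pM unfolding two_mu[symmetric] by (intro power_mono) auto
    finally show ?thesis .
  qed
  have "real ((5 * p + 1) ^ lev) \<le> ((2 powr mu) ^ 3) ^ lev"
    using base by (simp only: of_nat_power) (intro power_mono, auto)
  also have "\<dots> = 2 powr (mu * (3 * real lev))" by (simp add: power_mult[symmetric] powr_power mult_ac)
  also have "\<dots> \<le> 2 powr (beta / 2)"
  proof (intro powr_mono)
    have "mu * (3 * real lev) \<le> mu * (Lgr / 2)" using lev mu_ge by (intro mult_left_mono) auto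
    then show "mu * (3 * real lev) \<le> beta / 2" by (simp add: beta_eq mult.commute)
  qed simp
  finally have ball: "real ((5 * p + 1) ^ lev) \<le> 2 powr (beta / 2)" .
  have nB: "real n / real B = 2 powr beta" using pos by (simp add: beta_def)
  have "real (B * (5 * p + 1) ^ lev) / real n = real ((5 * p + 1) ^ lev) / (real n / real B)" by simp
  also have "\<dots> \<le> 2 powr (beta / 2) / 2 powr beta" unfolding nB using ball by (intro divide_right_mono) auto
  also have "\<dots> = 2 powr (- (beta / 2))" by (simp add: powr_diff[symmetric])
  finally have K: "real (B * (5 * p + 1) ^ lev) / real n \<le> 2 powr (- (beta / 2))" .
  have "(real (B * (5 * p + 1) ^ lev) / real n) ^ quota \<le> (2 powr (- (beta / 2))) ^ quota"
    using K by (intro power_mono) auto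
  also have "\<dots> = 2 powr (- (beta / 2) * real quota)" by (simp add: powr_power mult_ac)
  finally have K': "(real (B * (5 * p + 1) ^ lev) / real n) ^ quota \<le> 2 powr (- (beta / 2) * real quota)" .
  have four: "(4 :: real) ^ n = 2 powr (2 * real n)"
    using powr_realpow[of "2::real" "2 * n"] by (simp add: power_mult)
  have c: "real (card (run_patterns (A + n) t)) \<le> 2 powr ((2 + 2 * real t) * lam)"
    unfolding lam_def by (rule run_patterns_card_log_le) (use n A t_le in auto)
  have "real (card (run_patterns (A + n) t)) * 4 ^ n * (real (B * (5 * p + 1) ^ lev) / real n) ^ quota
      \<le> 2 powr ((2 + 2 * real t) * lam) * 2 powr (2 * real n) * 2 powr (- (beta / 2) * real quota)"
    unfolding four using c K' by (intro mult_mono) auto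
  also have "\<dots> = 2 powr ((2 + 2 * real t) * lam + 2 * real n + - (beta / 2) * real quota)"
    by (simp only: powr_add)
  also have "\<dots> < 2 powr (- 2)"
  proof (intro powr_less_mono)
    have q: "real n / 16 \<le> real quota"
    proof -
      have "n \<le> 16 * quota" unfolding quota_def by simp
      then have "real n \<le> real (16 * quota)" by (simp only: of_nat_le_iff)
      then show ?thesis by simp
    qed
    have "(beta / 2) * (real n / 16) \<le> (beta / 2) * real quota" using q beta_ge by (intro mult_left_mono) auto
    then have z: "real n * beta / 32 \<le> (beta / 2) * real quota" by (simp add: mult.commute)
    have l: "lam \<le> real n" unfolding lam_def by (rule log2_of_nat_le)
    have a: "198 * real n \<le> real n * beta" using mult_left_mono[of 198 beta "real n"] beta_ge(2) by simp
    have "2 * lam + 2 * (real t * lam) + 2 * real n - (beta / 2) * real quota < - 2"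
    proof -
      have "262144 \<le> real n" using n(2) by simp
      moreover have "real t * lam \<le> 12 * (real n * beta) / 2097152" using t_lam_le(1) by simp
      moreover have "2 * x + 2 * y + 2 * r - s < - 2"
        if "262144 \<le> r" "y \<le> 12 * c / 2097152" "c / 32 \<le> s" "x \<le> r" "198 * r \<le> c" for x y r s c :: real
        using that by argo
      ultimately show ?thesis using z l a by blast
    qed
    then show "(2 + 2 * real t) * lam + 2 * real n + - (beta / 2) * real quota < - 2"
      by (simp add: algebra_simps)
  qed simp
  also have "(2 :: real) powr (- 2) = 1/4" by (simp add: powr_minus_divide)
  finally show ?thesis by (simp add: p_def)
qed

end

section \<open>The lower bound\<close>

lemma (in parameter_regime) fast_algorithm_impossible:
  assumes conj: "undirected_k_pairs_conjecture" and alg: "em_algorithm (M * w) alg"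
    and err: "\<And>\<pi> d. perm_input n w \<pi> d \<Longrightarrow> error_prob M B w n alg \<pi> d \<le> 1/3"
    and ios: "\<And>\<pi> d. perm_input n w \<pi> d \<Longrightarrow> expected_ios M B w n alg \<pi> d \<le> ennreal (X / 2 ^ 21)"
    and t': "6 * (X / 2 ^ 21) \<le> real t + 1"
  shows False
proof -
  have w: "70000 \<le> w" "index_bits n \<le> w" using n index_bits_le[of n w] by linarith+
  have w1: "1 \<le> w" using w by simp
  have p: "1 \<le> M div B" using BM by (simp add: Suc_le_eq div_greater_zero_iff)
  define A where "A = output_start (B * w) n w"
  have A: "A \<le> 3 * n" unfolding A_def by (rule output_start_le[OF BM(1) w1 w(2)]) (use n in simp)
  define inb where "inb = (\<lambda>i. i * (w + index_bits n) div (B * w))"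
  obtain \<omega> where \<omega>: "fact n \<le> 4 * card {\<pi>. \<pi> permutes {1..n} \<and>
     (2 ^ w) ^ n \<le> 4 * card {y \<in> words (bit_words w) n. solves_within M B w n (alg \<omega>) \<pi> (\<lambda>i. y ! (i - 1)) t}}"
    using many_good_permutations[OF w1 BM alg err ios t'] X(1) by auto
  define Gd where "Gd = {\<pi>. \<pi> permutes {1..n} \<and>
     (2 ^ w) ^ n \<le> 4 * card {y \<in> words (bit_words w) n. solves_within M B w n (alg \<omega>) \<pi> (\<lambda>i. y ! (i - 1)) t}}"
  have "\<exists>\<pi>\<in>Gd. \<forall>(T, ca)\<in>run_patterns (A + n) t.
      card {i\<in>{1..n}. near_output B A (M div B) T ca inb lev i (\<pi> i)} < quota"
  proof (rule good_permutation_far[OF p BM(1) finite_run_patterns])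
    show "fact n \<le> 4 * card Gd" using \<omega> by (simp only: Gd_def)
  qed (use pattern_count_small_for_permutations[OF A] in \<open>auto simp: Gd_def\<close>)
  then obtain \<pi> where \<pi>: "\<pi> \<in> Gd" and near: "\<And>T ca. (T, ca) \<in> run_patterns (A + n) t \<Longrightarrow>
      card {i\<in>{1..n}. near_output B A (M div B) T ca inb lev i (\<pi> i)} < quota"
    by fast
  have "13 / 32 * real n * real lev \<le> 6 * real n + 5 * real B * real t"
  proof (rule solves_slow_if_far[OF conj w(1) BM w(2)])
    show "\<pi> permutes {1..n}" using \<pi> by (simp add: Gd_def)
    show "length (fst (alg \<omega> j s)) = M * w" if "length s = M * w" for j s
      using alg that by (simp add: em_algorithm_def)
    show "(2 ^ w) ^ n \<le> 4 * card {y \<in> words (bit_words w) n. solves_within M B w n (alg \<omega>) \<pi> (\<lambda>i. y ! (i - 1)) t}"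
      using \<pi> by (simp add: Gd_def)
    show "log 2 (4 * real (card (run_patterns (output_start (B * w) n w + n) t))) \<le> real n * real w / 2 ^ 15"
      using pattern_count_small_for_data[OF A] by (simp add: A_def)
    show "16 * card {i\<in>{1..n}. near_output B (output_start (B * w) n w) (M div B) T ca (\<lambda>i. i * (w + index_bits n) div (B * w)) lev i (\<pi> i)} \<le> n"
      if "(T, ca) \<in> run_patterns (output_start (B * w) n w + n) t" for T ca
      using near[of T ca] that unfolding A_def inb_def quota_def by linarith
  qed
  then show False using contradiction_at_lev by simp
qed

theorem theorem4:
  assumes "undirected_k_pairs_conjecture"
  shows "\<exists>c::real. c > 0 \<and> (\<exists>n0::nat. \<forall>n\<ge>n0. \<forall>(w::nat) (M::nat) (B::nat) (alg::rand_algorithm).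
           real w \<ge> log 2 (real n) \<and> 1 \<le> B \<and> B \<le> M \<and>
           em_algorithm (M * w) alg \<and>
           (\<forall>\<pi> d. perm_input n w \<pi> d \<longrightarrow> error_prob M B w n alg \<pi> d \<le> 1/3) \<longrightarrow>
           (\<exists>\<pi> d. perm_input n w \<pi> d \<and>
              expected_ios M B w n alg \<pi> d \<ge>
                ennreal (c * Min {real n,
                                  real n * real w / log 2 (real n * real w),
                                  real n / real B * log (2 * real M / real B) (real n / real B)})))"
proof -
  \<comment> \<open>The threshold \<open>2 ^ k\<close> forces \<open>log 2 n\<close>, and therefore
    \<open>w\<close>, to be at least 70000.\<close>
  obtain k :: nat where k: "70000 \<le> k" by blast
  have main: "\<exists>\<pi> d. perm_input n w \<pi> d \<and> expected_ios M B w n alg \<pi> d \<ge>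
                ennreal (1 / 2 ^ 21 * Min {real n, real n * real w / log 2 (real n * real w),
                                  real n / real B * log (2 * real M / real B) (real n / real B)})"
    if n: "2 ^ k \<le> n" and w: "log 2 (real n) \<le> real w" and BM: "1 \<le> B" "B \<le> M" and alg: "em_algorithm (M * w) alg"
      and err: "\<And>\<pi> d. perm_input n w \<pi> d \<Longrightarrow> error_prob M B w n alg \<pi> d \<le> 1/3"
    for n w M B :: nat and alg
  proof -
    define Lg where "Lg = log (2 * real M / real B) (real n / real B)"
    define X where "X = Min {real n, real n * real w / log 2 (real n * real w), real n / real B * Lg}"
    have "real (2 ^ k) \<le> real n" using n by (simp only: of_nat_le_iff)
    then have "log 2 (real (2 ^ k)) \<le> log 2 (real n)" by (intro log_mono) auto
    then have logn: "70000 \<le> log 2 (real n)" using k by simp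
    have n18: "262144 \<le> n"
    proof -
      have "(2 :: nat) ^ 18 \<le> 2 ^ k" using k by (intro power_increasing) auto
      then show ?thesis using n by simp
    qed
    have w1: "1 \<le> w" using w logn by linarith
    have X: "X \<le> real n" "X \<le> real n / real B * Lg" by (simp_all add: X_def)
    show ?thesis
    proof (cases "Lg \<le> 198")
      \<comment> \<open>This covers bounded logarithms and also negative ones, where
        \<open>B > n\<close>. Counting output blocks suffices since
        \<open>198 / 2 ^ 21 \<le> 2/3\<close>.\<close>
      case True
      have "1 / 2 ^ 21 * X \<le> 1 / 2 ^ 21 * (real n / real B * 198)"
        using True by (intro mult_left_mono order_trans[OF X(2)]) auto
      also have "\<dots> = (198 / 2 ^ 21) * (real n / real B)" by simp
      also have "\<dots> \<le> 2/3 * (real n / real B)" by (intro mult_right_mono) auto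
      finally have "ennreal (1 / 2 ^ 21 * X) \<le> ennreal (2/3 * (real n / real B))" by (rule ennreal_leI)
      then show ?thesis
        using expected_ios_ge_output_blocks[OF w1 BM alg err] unfolding X_def Lg_def by (meson order_trans)
    next
      case False
      have nw: "1 \<le> real n * real w"
      proof -
        have "1 * 1 \<le> real n * real w" using n18 w1 by (intro mult_mono) auto
        then show ?thesis by simp
      qed
      have X0: "0 \<le> X"
        using False nw by (simp add: X_def)
      \<comment> \<open>Rounding down serves both sides: \<open>t\<close> stays small enough for
        counting patterns, and \<open>t + 1\<close> is large enough for Markov's inequality.\<close>
      define t where "t = nat \<lfloor>6 * (X / 2 ^ 21)\<rfloor>"
      have t_bounds: "real t \<le> 6 * (X / 2 ^ 21)" "6 * (X / 2 ^ 21) \<le> real t + 1"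
      proof -
        have "real (nat \<lfloor>u\<rfloor>) \<le> u" "u \<le> real (nat \<lfloor>u\<rfloor>) + 1" if "0 \<le> u" for u :: real
          using that by linarith+
        from this[of "6 * (X / 2 ^ 21)"] X0
        show "real t \<le> 6 * (X / 2 ^ 21)" "6 * (X / 2 ^ 21) \<le> real t + 1" by (simp_all add: t_def)
      qed
      interpret parameter_regime n w M B t X
        by unfold_locales (use logn n18 w BM X0 X False t_bounds in \<open>simp_all add: Lg_def\<close>)
      show ?thesis
      proof (rule ccontr)
        assume neg: "\<not> ?thesis"
        have ios: "expected_ios M B w n alg \<pi> d \<le> ennreal (X / 2 ^ 21)" if "perm_input n w \<pi> d" for \<pi> d
        proof -
          have "\<not> ennreal (1 / 2 ^ 21 * X) \<le> expected_ios M B w n alg \<pi> d"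
            using neg that unfolding X_def Lg_def by blast
          then have "expected_ios M B w n alg \<pi> d < ennreal (1 / 2 ^ 21 * X)" by (simp only: not_le)
          moreover have "1 / 2 ^ 21 * X = X / 2 ^ 21" by simp
          ultimately show ?thesis by (simp only: less_imp_le)
        qed
        show False by (rule fast_algorithm_impossible[OF assms alg err ios t_bounds(2)])
      qed
    qed
  qed
  show ?thesis
    by (intro exI[of _ "1 / 2 ^ 21 :: real"] conjI exI[of _ "2 ^ k :: nat"]) (use main in simp, use main in blast)
qed

end
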